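(* Let $\mathcal{N}\subseteq\mathbb{V}^{m\times n}$ be a nonempty open set, let $g:\mathbb{R}^m\to\mathbb{R}^m$ be absolutely symmetric on an open set $\hat\sigma_{\mathcal{N}}\subseteq\mathbb{R}^m$ containing $\{\sigma(X)\mid X\in\mathcal{N}\}$, and let $G:\mathcal{N}\to\mathbb{V}^{m\times n}$ be the spectral operator with respect to $g$. Let $\overline{X}\in\mathcal{N}$ and assume that $g$ is locally Lipschitz continuous near $\overline\sigma=\sigma(\overline{X})$ (so that $G$ is locally Lipschitz continuous near $\overline{X}$). Let $0<\rho\le1$. Then $G$ is $\rho$-order G-semismooth at $\overline{X}$ if and only if $g$ is $\rho$-order G-semismooth at $\overline\sigma$.
   Context: Fix $m\le n$. $\mathbb{V}^{m\times n}$ denotes either $\mathbb{R}^{m\times n}$ or $\mathbb{C}^{m\times n}$, viewed as a real Euclidean space with inner product $\langle X,Y\rangle=\mathrm{Re}(\mathrm{trace}(X^{*}Y))$ and induced norm, where $X^{*}$ is the (conjugate) transpose. $\mathbb{O}^p$ is the set of $p\times p$ orthogonal (real case) or unitary (complex case) matrices. $\sigma(Z)\in\mathbb{R}^m$ is the vector of singular values $\sigma_1(Z)\ge\cdots\ge\sigma_m(Z)\ge0$ of $Z\in\mathbb{V}^{m\times n}$; $\mathrm{Diag}(x)$ is the diagonal matrix with diagonal $x$; $\mathbb{O}^{m,n}(Z)$ is the set of pairs $(U,V)\in\mathbb{O}^m\times\mathbb{O}^n$ with $Z=U[\mathrm{Diag}(\sigma(Z))\quad 0]V^{*}$. A signed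 permutation matrix is a square matrix with exactly one nonzero entry in each row and each column, that entry being $\pm1$. The mapping $g:\mathbb{R}^m\to\mathbb{R}^m$ is absolutely symmetric on a set $D$ if $g(Qx)=Qg(x)$ for every $x\in D$ and every $m\times m$ signed permutation matrix $Q$. The spectral operator $G$ with respect to $g$ is $G(X)=U[\mathrm{Diag}(g(\sigma(X)))\quad 0]V^{*}$ for $X\in\mathcal{N}$, where $(U,V)\in\mathbb{O}^{m,n}(X)$ (the value does not depend on the choice of $(U,V)$). A function is locally Lipschitz continuous near a point if it is Lipschitz continuous on some neighborhood of that point. Let $F:\mathcal{O}\to\mathcal{Z}'$ be locally Lipschitz continuous on an open set $\mathcal{O}\subseteq\mathcal{Z}$, with $\mathcal{Z},\mathcal{Z}'$ finite dimensional real Euclidean spaces, and let $\mathcal{D}_F$ be the set of points of $\mathcal{O}$ where $F$ is Fréchet differentiable. The B-subdifferential is $\partial_BF(z):=\{\lim_{k}F'(z^k)\mid z^k\in\mathcal{D}_F,\ z^k\to z\}$ (all limits that exist), and Clarke's generalized Jacobian is $\partial F(z):=\mathrm{conv}\,\partial_BF(z)$. For $\rho>0$, $F$ is $\rho$-order G-semismooth at $z\in\mathcal{O}$ if for any $y\to z$ and $V\in\partial F(y)$, $F(y)-F(z)-V(y-z)=O(\|y-z\|^{1+\rho})$. For functions that are locally Lipschitz near $z$, this is applied on a neighborhood of $z$. *)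

theory Defs
  imports "HOL-Analysis.Analysis" "Jordan_Normal_Form.Conjugate"
begin

text \<open>
  An \<open>m \<times> n\<close> matrix over \<open>\<real>\<close> or \<open>\<complex>\<close> is an element of \<open>real ^ 'n ^ 'm\<close> or \<open>complex ^ 'n ^ 'm\<close>.
  The matrix-level definitions are stated for both scalar types at once, using
  \<^const>\<open>conjugate\<close>, which is the identity on \<^typ>\<open>real\<close> and \<^const>\<open>cnj\<close> on \<^typ>\<open>complex\<close>.
  The index types are finite linear orders, so that "the first row", "the diagonal" and
  "nonincreasing" make sense.
\<close>

definition conj_transpose :: "'a::conjugate ^ 'n ^ 'm \<Rightarrow> 'a ^ 'm ^ 'n"
  where "conj_transpose A = (\<chi> i j. conjugate (A $ j $ i))"

text \<open>The library inner product on both matrix spaces is the real part of the trace form.\<close>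

lemma inner_matrix_real:
  fixes X Y :: "real ^ 'n ^ 'm"
  shows "X \<bullet> Y = trace (conj_transpose X ** Y)"
  unfolding inner_vec_def trace_def conj_transpose_def matrix_matrix_mult_def
  by (simp add: sum.swap[of _ "UNIV :: 'n set"])

lemma inner_matrix_complex:
  fixes X Y :: "complex ^ 'n ^ 'm"
  shows "X \<bullet> Y = Re (trace (conj_transpose X ** Y))"
  unfolding inner_vec_def trace_def conj_transpose_def matrix_matrix_mult_def
  by (simp add: sum.swap[of _ "UNIV :: 'n set"] inner_complex_def)

definition unitary_matrices :: "('a::{conjugate,semiring_1} ^ 'p ^ 'p) set"
  where "unitary_matrices =
    {U. conj_transpose U ** U = mat 1 \<and> U ** conj_transpose U = mat 1}"

text \<open>
  The block matrix \<open>[Diag x  0]\<close>. The number \<open>card {..<i}\<close> is the zero-based position of the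
  index \<open>i\<close> in its index type, so the entries of \<open>x\<close> sit where row and column position agree.
\<close>

definition rect_diag ::
    "real ^ 'm::{finite,linorder} \<Rightarrow> 'a::real_algebra_1 ^ 'n::{finite,linorder} ^ 'm::{finite,linorder}"
  where "rect_diag x = (\<chi> i j. if card {..<i} = card {..<j} then of_real (x $ i) else 0)"

text \<open>
  For \<open>m \<le> n\<close> the singular values are the nonnegative square roots of the eigenvalues of
  \<open>Z Z\<^sup>*\<close>, repeated according to multiplicity and listed in nonincreasing order. The
  multiplicities are read off the characteristic polynomial.
\<close>

definition singular_values ::
    "'a::{conjugate,real_normed_field} ^ 'n ^ 'm::{finite,linorder}
      \<Rightarrow> real ^ 'm::{finite,linorder}"
  where "singular_values Z = (THE s.
    (\<forall>i. 0 \<le> s $ i) \<and> (\<forall>i j. i \<le> j \<longrightarrow> s $ j \<le> s $ i) \<and>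
    (\<forall>t. det (mat t - Z ** conj_transpose Z) = (\<Prod>i\<in>UNIV. t - of_real ((s $ i)\<^sup>2))))"

definition svd_pairs ::
    "'a::{conjugate,real_normed_field} ^ 'n::{finite,linorder} ^ 'm::{finite,linorder}
      \<Rightarrow> (('a ^ 'm::{finite,linorder} ^ 'm::{finite,linorder}) \<times>
          ('a ^ 'n::{finite,linorder} ^ 'n::{finite,linorder})) set"
  where "svd_pairs Z = {(U, V). U \<in> unitary_matrices \<and> V \<in> unitary_matrices \<and>
    Z = U ** rect_diag (singular_values Z) ** conj_transpose V}"

definition signed_permutation_matrix :: "real ^ 'm ^ 'm \<Rightarrow> bool"
  where "signed_permutation_matrix Q \<longleftrightarrow>
    (\<forall>i. \<exists>!j. Q $ i $ j \<noteq> 0) \<and> (\<forall>j. \<exists>!i. Q $ i $ j \<noteq> 0) \<and>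
    (\<forall>i j. Q $ i $ j \<noteq> 0 \<longrightarrow> Q $ i $ j = 1 \<or> Q $ i $ j = -1)"

definition absolutely_symmetric_on :: "(real ^ 'm) set \<Rightarrow> (real ^ 'm \<Rightarrow> real ^ 'm) \<Rightarrow> bool"
  where "absolutely_symmetric_on D g \<longleftrightarrow>
    (\<forall>x\<in>D. \<forall>Q. signed_permutation_matrix Q \<longrightarrow> g (Q *v x) = Q *v g x)"

text \<open>
  The value is independent of the chosen pair at every \<open>X\<close> for which \<open>g\<close> is absolutely symmetric
  on a set containing the singular value vector of \<open>X\<close>.
\<close>

definition spectral_operator ::
    "(real ^ 'm::{finite,linorder} \<Rightarrow> real ^ 'm::{finite,linorder})
      \<Rightarrow> 'a::{conjugate,real_normed_field} ^ 'n::{finite,linorder} ^ 'm::{finite,linorder}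
      \<Rightarrow> 'a ^ 'n::{finite,linorder} ^ 'm::{finite,linorder}"
  where "spectral_operator g X = (SOME Y. \<exists>(U, V)\<in>svd_pairs X.
    Y = U ** rect_diag (g (singular_values X)) ** conj_transpose V)"

definition lipschitz_near :: "('a::metric_space \<Rightarrow> 'b::metric_space) \<Rightarrow> 'a \<Rightarrow> bool"
  where "lipschitz_near F z \<longleftrightarrow> (\<exists>L W. open W \<and> z \<in> W \<and> L-lipschitz_on W F)"

text \<open>
  Derivatives are elements of the normed space of bounded linear maps; in finite dimension its
  topology is the usual one on linear maps. \<open>S\<close> is the open domain of \<open>F\<close>.
\<close>

definition B_subdifferential ::
    "'a::euclidean_space set \<Rightarrow> ('a \<Rightarrow> 'b::euclidean_space) \<Rightarrow> 'a \<Rightarrow> ('a \<Rightarrow>\<^sub>L 'b) set"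
  where "B_subdifferential S F z = {A. \<exists>x A'.
    (\<forall>k::nat. x k \<in> S \<and> (F has_derivative blinfun_apply (A' k)) (at (x k))) \<and>
    x \<longlonglongrightarrow> z \<and> A' \<longlonglongrightarrow> A}"

definition clarke_jacobian ::
    "'a::euclidean_space set \<Rightarrow> ('a \<Rightarrow> 'b::euclidean_space) \<Rightarrow> 'a \<Rightarrow> ('a \<Rightarrow>\<^sub>L 'b) set"
  where "clarke_jacobian S F z = convex hull (B_subdifferential S F z)"

definition G_semismooth_on ::
    "'a::euclidean_space set \<Rightarrow> real \<Rightarrow> ('a \<Rightarrow> 'b::euclidean_space) \<Rightarrow> 'a \<Rightarrow> bool"
  where "G_semismooth_on S \<rho> F z \<longleftrightarrow>
    open S \<and> z \<in> S \<and> (\<forall>x\<in>S. lipschitz_near F x) \<and>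
    (\<exists>C. \<forall>\<^sub>F y in nhds z. \<forall>A\<in>clarke_jacobian S F y.
       norm (F y - F z - blinfun_apply A (y - z)) \<le> C * norm (y - z) powr (1 + \<rho>))"

text \<open>
  For a function with domain \<open>D\<close>, semismoothness at \<open>z\<close> is semismoothness on some open
  neighbourhood of \<open>z\<close> in \<open>D\<close> on which the function is locally Lipschitz continuous.
\<close>

definition G_semismooth_at ::
    "'a::euclidean_space set \<Rightarrow> real \<Rightarrow> ('a \<Rightarrow> 'b::euclidean_space) \<Rightarrow> 'a \<Rightarrow> bool"
  where "G_semismooth_at D \<rho> F z \<longleftrightarrow> (\<exists>S\<subseteq>D. G_semismooth_on S \<rho> F z)"

end

theory Submission
  imports Defs
begin

text \<open>
  A function is \<open>\<rho>\<close>-order G-semismooth iff its linearisation error at nearby points of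
  differentiability is \<open>O(|y - z|\<^bsup>1+\<rho>\<^esup>)\<close>, because that estimate survives limits and convex
  hulls of derivatives. It therefore suffices to compare derivatives of \<open>g\<close> and \<open>G\<close>.

  Near \<open>X = U [Diag x  0] V\<^sup>*\<close> the derivative of \<open>G\<close> at \<open>X\<close> is \<open>g'(x)\<close> along diagonal
  directions, and along directions \<open>K X - X L\<close> with \<open>K\<close>, \<open>L\<close> skew it is \<open>K G(X) - G(X) L\<close>. If \<open>X\<close> is
  close to \<open>Xbar\<close>, the singular vectors of \<open>X\<close> differ by \<open>O(|X - Xbar|)\<close> from some singular vectors of
  \<open>Xbar\<close>, so up to \<open>O(|X - Xbar|\<^sup>2)\<close> the increment \<open>X - Xbar\<close> is a sum of such directions, and the
  linearisation error of \<open>G\<close> is that of \<open>g\<close> up to \<open>O(|X - Xbar|\<^sup>2)\<close>. The quadratic remainder is harmless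
  since \<open>\<rho> \<le> 1\<close>. Conversely, \<open>G\<close> restricted to diagonal matrices is \<open>g\<close>, and \<open>G\<close> is differentiable
  wherever \<open>g\<close> is.
\<close>

text \<open>Singular vectors are determined only up to unitary pairs (P, Q) with P [Diag s 0] =
  [Diag s 0] Q. At repeated or zero singular values this stabilizer is large and no choice of
  singular vectors is continuous. \<open>near_stabilizer\<close> replaces continuity: a unitary pair
  that almost intertwines [Diag s 0] is linearly close to one that does so exactly, and the exact
  pair can be absorbed into the singular vectors of the base matrix. Degenerate values matter again
  in the converse: the derivative of \<open>G\<close> contains divided differences of
  \<open>g\<close>, undefined at coinciding values. Equivariance of \<open>g\<close> forces its
  Jacobian into a form that supplies the missing values and makes the result compatible with the
  stabilizer. One variational principle yields the singular value decomposition, sorting and the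
  Lipschitz bound: pair an orbit with a diagonal of strictly decreasing positive weights; a
  maximiser is diagonal and sorted, and the maximal value is Lipschitz. Below, A^H is
  \<open>conj_transpose A\<close> and D_x is \<open>rect_diag x\<close>.\<close>

section \<open>Scalars\<close>

text \<open>One proof serves both scalar fields. Beyond additivity only conjugate x * x = |x|^2 is
  postulated; multiplicativity follows by cancellation, and polarisation makes
  \<open>1 \<bullet> x\<close> the real part.\<close>

class real_or_complex = conjugate + real_normed_field + euclidean_space +
  assumes conjugate_add: "conjugate (x + y) = conjugate x + conjugate y"
    and conjugate_mult_self_scaleR: "conjugate x * x = (norm x * norm x) *\<^sub>R 1"

instance real :: real_or_complex
  by standard simp_all

instance complex :: real_or_complex
  by standard (simp_all add: complex_eq_iff cmod_def algebra_simps power2_eq_square)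

lemma conjugate_mult_self: "conjugate x * x = of_real ((norm (x::'a::real_or_complex))\<^sup>2)"
  unfolding conjugate_mult_self_scaleR of_real_def power2_eq_square ..

lemma conjugate_0 [simp]: "conjugate (0::'a::real_or_complex) = 0"
  using conjugate_add[of 0 0] by simp

lemma conjugate_minus [simp]: "conjugate (- x) = - conjugate (x::'a::real_or_complex)"
  using conjugate_add[of x "-x"] by (simp add: eq_neg_iff_add_eq_0 add.commute)

lemma conjugate_diff: "conjugate (x - y) = conjugate x - conjugate (y::'a::real_or_complex)"
  using conjugate_add[of x "-y"] by simp

lemma conjugate_sum: "conjugate (sum f A) = (\<Sum>x\<in>A. conjugate (f x :: 'a::real_or_complex))"
  by (induction A rule: infinite_finite_induct) (auto simp: conjugate_add)

lemma conjugate_mult: "conjugate (x * y) = conjugate x * conjugate (y::'a::real_or_complex)"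
proof (cases "x = 0 \<or> y = 0")
  case False
  have "conjugate (x * y) * (x * y) = (conjugate x * x) * (conjugate y * y)"
    by (simp only: conjugate_mult_self norm_mult power_mult_distrib of_real_mult)
  then have "conjugate (x * y) * (x * y) = (conjugate x * conjugate y) * (x * y)"
    by (simp add: mult_ac)
  then show ?thesis using False by simp
qed auto

lemma conjugate_of_real [simp]: "conjugate (of_real r) = (of_real r :: 'a::real_or_complex)"
proof (cases "r = 0")
  case False
  have "conjugate (of_real r) * of_real r = (of_real r * of_real r :: 'a)"
    by (simp add: conjugate_mult_self power2_eq_square)
  then show ?thesis using False by simp
qed simp

lemma conjugate_1 [simp]: "conjugate 1 = (1::'a::real_or_complex)"
  using conjugate_of_real[of 1] by simp

lemma conjugate_scaleR [simp]: "conjugate (r *\<^sub>R x) = r *\<^sub>R conjugate (x::'a::real_or_complex)"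
  by (simp add: scaleR_conv_of_real conjugate_mult)

lemma conjugate_mult_add:
  "conjugate x * y + x * conjugate y = of_real (2 * (x \<bullet> y))" for x y :: "'a::real_or_complex"
proof -
  have "conjugate (x + y) * (x + y) = conjugate x * x + conjugate y * y + (conjugate x * y + x * conjugate y)"
    by (simp add: conjugate_add algebra_simps)
  then have "conjugate x * y + x * conjugate y
      = of_real ((norm (x + y))\<^sup>2 - (norm x)\<^sup>2 - (norm y)\<^sup>2)"
    by (simp add: conjugate_mult_self del: of_real_power)
  also have "(norm (x + y))\<^sup>2 - (norm x)\<^sup>2 - (norm y)\<^sup>2 = 2 * (x \<bullet> y)"
    by (simp add: power2_norm_eq_inner inner_add inner_commute)
  finally show ?thesis .
qed

lemma inner_of_real: "of_real r \<bullet> (of_real s :: 'a::real_or_complex) = r * s"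
proof -
  have "of_real (2 * (of_real r \<bullet> (of_real s :: 'a))) = (of_real (2 * (r * s)) :: 'a)"
    unfolding conjugate_mult_add[symmetric] by simp
  then show ?thesis unfolding of_real_eq_iff by simp
qed

lemma inner_one_of_real [simp]: "1 \<bullet> (of_real r :: 'a::real_or_complex) = r"
  using inner_of_real[of 1 r] by simp

lemma inner_of_real_left: "of_real r \<bullet> (x :: 'a::real_or_complex) = r * (1 \<bullet> x)"
  by (metis inner_scaleR_left of_real_def)

lemma inner_one_conjugate [simp]: "1 \<bullet> conjugate x = 1 \<bullet> (x :: 'a::real_or_complex)"
proof -
  have "of_real (2 * (1 \<bullet> conjugate x)) = (of_real (2 * (1 \<bullet> x)) :: 'a)"
    unfolding conjugate_mult_add[symmetric] by simp
  then show ?thesis unfolding of_real_eq_iff by simp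
qed

lemma inner_conv_conjugate: "x \<bullet> y = 1 \<bullet> (conjugate x * y)" for x y :: "'a::real_or_complex"
proof -
  have "1 \<bullet> (conjugate x * y) = 1 \<bullet> (x * conjugate y)"
    by (metis conjugate_id conjugate_mult inner_one_conjugate)
  then have "2 * (1 \<bullet> (conjugate x * y)) = 1 \<bullet> (conjugate x * y + x * conjugate y)"
    by (simp add: inner_add_right)
  then show ?thesis by (simp only: conjugate_mult_add inner_one_of_real) 
qed

lemma self_adjoint_imp_of_real:
  assumes "conjugate x = (x::'a::real_or_complex)" shows "x = of_real (1 \<bullet> x)"
  using conjugate_mult_add[of 1 x] assms by simp

section \<open>Matrices\<close>

lemma conj_transpose_nth [simp]: "conj_transpose A $ i $ j = conjugate (A $ j $ i)"
  by (simp add: conj_transpose_def)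

lemma conj_transpose_conj_transpose [simp]: "conj_transpose (conj_transpose A) = A"
  by (simp add: vec_eq_iff)

lemma conj_transpose_add: "conj_transpose (A + B) = conj_transpose A + conj_transpose (B :: 'a::real_or_complex^'n^'m)"
  by (simp add: vec_eq_iff conjugate_add)

lemma conj_transpose_diff: "conj_transpose (A - B) = conj_transpose A - conj_transpose (B :: 'a::real_or_complex^'n^'m)"
  by (simp add: vec_eq_iff conjugate_diff)

lemma conj_transpose_scaleR [simp]: "conj_transpose (r *\<^sub>R A) = r *\<^sub>R conj_transpose (A :: 'a::real_or_complex^'n^'m)"
  by (simp add: vec_eq_iff)

lemma conj_transpose_mat_1 [simp]: "conj_transpose (mat 1 :: 'a::real_or_complex^'n^'n) = mat 1"
  by (simp add: vec_eq_iff mat_def)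

lemma conj_transpose_mult:
  "conj_transpose (A ** B) = conj_transpose B ** conj_transpose (A :: 'a::real_or_complex^'n^'m)"
  by (simp add: vec_eq_iff matrix_matrix_mult_def conjugate_sum conjugate_mult mult.commute)

lemma matrix_mult_diff_right: "A ** (B - C) = A ** B - A ** (C :: 'a::ring_1^'n^'m)"
  by (simp add: vec_eq_iff matrix_matrix_mult_def right_diff_distrib sum_subtractf)

lemma matrix_mult_diff_left: "(A - B) ** C = A ** C - B ** (C :: 'a::ring_1^'n^'m)"
  by (simp add: vec_eq_iff matrix_matrix_mult_def left_diff_distrib sum_subtractf)

lemma matrix_mult_add_left: "(A + B) ** C = A ** C + B ** (C :: 'a::semiring_1^'n^'m)"
  by (simp add: vec_eq_iff matrix_matrix_mult_def distrib_right sum.distrib)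

lemma matrix_mult_minus_right: "A ** (- B) = - (A ** (B :: 'a::ring_1^'n^'m))"
  by (simp add: vec_eq_iff matrix_matrix_mult_def sum_negf)

lemma matrix_mult_minus_left: "(- A) ** B = - (A ** (B :: 'a::ring_1^'n^'m))"
  by (simp add: vec_eq_iff matrix_matrix_mult_def sum_negf)

lemma matrix_mult_scaleR_right: "A ** (r *\<^sub>R B) = r *\<^sub>R (A ** (B :: 'a::real_algebra_1^'n^'m))"
  by (simp add: vec_eq_iff matrix_matrix_mult_def scaleR_sum_right)

lemma matrix_mult_scaleR_left: "(r *\<^sub>R A) ** B = r *\<^sub>R (A ** (B :: 'a::real_algebra_1^'n^'m))"
  by (simp add: vec_eq_iff matrix_matrix_mult_def scaleR_sum_right)

lemmas matrix_distribs = matrix_add_ldistrib matrix_mult_add_left matrix_mult_diff_right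
  matrix_mult_diff_left matrix_mult_minus_left matrix_mult_minus_right
  matrix_mult_scaleR_left matrix_mult_scaleR_right
  conj_transpose_add conj_transpose_diff conj_transpose_mult

lemma inner_matrix: "X \<bullet> Y = 1 \<bullet> trace (conj_transpose X ** Y)" for X Y :: "'a::real_or_complex^'n^'m"
  unfolding inner_vec_def trace_def matrix_matrix_mult_def
  by (simp add: inner_sum_right sum.swap[of _ "UNIV :: 'n set"] inner_conv_conjugate[of "X $ _ $ _"])

lemma inner_mult_left: "X \<bullet> (P ** Y) = (conj_transpose P ** X) \<bullet> Y"
  for X Y :: "'a::real_or_complex^'n^'m"
  by (simp add: inner_matrix conj_transpose_mult matrix_mul_assoc)

lemma inner_mult_right: "X \<bullet> (Y ** P) = (X ** conj_transpose P) \<bullet> Y"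
  for X :: "'a::real_or_complex^'n^'m"
proof -
  have "X \<bullet> (Y ** P) = 1 \<bullet> trace ((conj_transpose X ** Y) ** P)"
    by (simp add: inner_matrix matrix_mul_assoc)
  also have "trace ((conj_transpose X ** Y) ** P) = trace (P ** (conj_transpose X ** Y))"
    by (rule trace_mul_sym)
  finally show ?thesis
    by (simp add: inner_matrix conj_transpose_mult matrix_mul_assoc)
qed

lemma inner_conj_transpose: "conj_transpose X \<bullet> conj_transpose Y = X \<bullet> Y"
  for X Y :: "'a::real_or_complex^'n^'m"
proof -
  have "X $ i $ j \<bullet> Y $ i $ j = conjugate (X $ i $ j) \<bullet> conjugate (Y $ i $ j)" for i j
    by (metis conjugate_id conjugate_mult inner_conv_conjugate inner_one_conjugate)
  then show ?thesis
    by (simp add: inner_vec_def sum.swap[of _ "UNIV :: 'n set"])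
qed

lemma norm_conj_transpose [simp]: "norm (conj_transpose X) = norm (X :: 'a::real_or_complex^'n^'m)"
  by (simp add: norm_eq_sqrt_inner inner_conj_transpose)

lemma norm_matrix_entry_le: "norm (A $ i $ j) \<le> norm (A :: 'a::real_normed_vector^'n^'m)"
  by (meson Finite_Cartesian_Product.norm_nth_le order_trans)

lemma norm_matrix_le_sum: "norm A \<le> (\<Sum>i\<in>UNIV. \<Sum>j\<in>UNIV. norm (A $ i $ j))"
  for A :: "'a::real_normed_vector^'n^'m"
proof -
  have "norm A \<le> (\<Sum>i\<in>UNIV. norm (A $ i))"
    unfolding norm_vec_def by (rule L2_set_le_sum) simp
  also have "\<dots> \<le> (\<Sum>i\<in>UNIV. \<Sum>j\<in>UNIV. norm (A $ i $ j))"
    unfolding norm_vec_def[of "A $ _"] by (intro sum_mono L2_set_le_sum) simp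
  finally show ?thesis .
qed

lemma norm_matrix_le_entries:
  fixes A :: "'a::real_normed_vector^'n^'m" and b :: real
  assumes "\<And>i j. norm (A $ i $ j) \<le> b"
  shows "norm A \<le> CARD('m) * CARD('n) * b"
proof -
  have "(\<Sum>i\<in>UNIV. \<Sum>j\<in>UNIV. norm (A $ i $ j)) \<le> (\<Sum>i\<in>(UNIV::'m set). \<Sum>j\<in>(UNIV::'n set). b)"
    by (intro sum_mono assms)
  then show ?thesis using norm_matrix_le_sum[of A] by simp
qed

text \<open>Each row of the product is a combination of the rows of \<open>B\<close>, so the
  triangle inequality and Cauchy-Schwarz bound it.\<close>

lemma norm_matrix_mult_le: "norm (A ** B) \<le> norm A * norm B"
  for A :: "'a::real_or_complex^'n^'m" and B :: "'a^'k^'n"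
proof -
  have row: "norm ((A ** B) $ i) \<le> norm (A $ i) * norm B" for i
  proof -
    have "(A ** B) $ i = (\<Sum>k\<in>UNIV. A $ i $ k *s B $ k)"
      by (simp add: vec_eq_iff matrix_matrix_mult_def)
    then have "norm ((A ** B) $ i) \<le> (\<Sum>k\<in>UNIV. norm (A $ i $ k *s B $ k))"
      by (simp add: norm_sum)
    also have "\<dots> = (\<Sum>k\<in>UNIV. norm (A $ i $ k) * norm (B $ k))"
      by (simp add: norm_vec_def norm_mult L2_set_right_distrib)
    also have "\<dots> \<le> norm (A $ i) * norm B"
      unfolding norm_vec_def[of "A $ i"] norm_vec_def[of B] 
      using L2_set_mult_ineq[of "\<lambda>k. norm (A $ i $ k)" "\<lambda>k. norm (B $ k)" UNIV] by simp
    finally show ?thesis .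
  qed
  have "norm (A ** B) \<le> L2_set (\<lambda>i. norm (A $ i) * norm B) UNIV"
    unfolding norm_vec_def[of "A ** B"] by (rule L2_set_mono) (use row in auto)
  also have "\<dots> = norm A * norm B"
    by (simp add: L2_set_left_distrib norm_vec_def[of A])
  finally show ?thesis .
qed

lemma bounded_bilinear_matrix_mult:
  "bounded_bilinear ((**) :: 'a::real_or_complex^'n^'m \<Rightarrow> 'a^'k^'n \<Rightarrow> 'a^'k^'m)"
proof
  show "\<exists>K. \<forall>(a::'a^'n^'m) (b::'a^'k^'n). norm (a ** b) \<le> norm a * norm b * K"
    by (rule exI[of _ 1]) (simp add: norm_matrix_mult_le)
qed (simp_all add: matrix_distribs)

lemma bounded_linear_conj_transpose:
  "bounded_linear (conj_transpose :: 'a::real_or_complex^'n^'m \<Rightarrow> 'a^'m^'n)"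
  by (rule bounded_linear_intro[of _ 1]) (auto simp: conj_transpose_add)

section \<open>Unitary matrices\<close>

lemma unitary_left: "U \<in> unitary_matrices \<Longrightarrow> conj_transpose U ** U = mat 1"
  and unitary_right: "U \<in> unitary_matrices \<Longrightarrow> U ** conj_transpose U = mat 1"
  by (auto simp: unitary_matrices_def)

lemma unitary_cancel:
  assumes "U \<in> unitary_matrices"
  shows "conj_transpose U ** (U ** A) = A" "U ** (conj_transpose U ** A) = A"
    "(B ** U) ** conj_transpose U = B" "(B ** conj_transpose U) ** U = B"
  by (metis assms matrix_mul_assoc matrix_mul_lid matrix_mul_rid unitary_left unitary_right)+

lemma unitary_conj_transpose [simp]: "conj_transpose U \<in> unitary_matrices \<longleftrightarrow> U \<in> unitary_matrices"
  by (auto simp: unitary_matrices_def)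

lemma unitary_mat_1 [simp]: "(mat 1 :: 'a::real_or_complex^'n^'n) \<in> unitary_matrices"
  by (simp add: unitary_matrices_def)

lemma unitary_mult:
  fixes U V :: "'a::real_or_complex^'n^'n"
  assumes "U \<in> unitary_matrices" "V \<in> unitary_matrices"
  shows "U ** V \<in> unitary_matrices"
  unfolding unitary_matrices_def conj_transpose_mult mem_Collect_eq
  by (metis assms matrix_mul_assoc matrix_mul_rid unitary_left unitary_right)

lemma inner_unitary_left:
  fixes X Y :: "'a::real_or_complex^'n^'m"
  assumes "U \<in> unitary_matrices" shows "(U ** X) \<bullet> (U ** Y) = X \<bullet> Y"
  by (metis assms inner_mult_left unitary_cancel(1))

lemma inner_unitary_right:
  fixes X Y :: "'a::real_or_complex^'n^'m"
  assumes "U \<in> unitary_matrices" shows "(X ** U) \<bullet> (Y ** U) = X \<bullet> Y"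
  by (metis assms inner_mult_right unitary_cancel(3))

lemma norm_unitary_left:
  fixes X :: "'a::real_or_complex^'n^'m"
  assumes "U \<in> unitary_matrices" shows "norm (U ** X) = norm X"
  by (simp add: norm_eq_sqrt_inner inner_unitary_left assms)

lemma norm_unitary_right:
  fixes X :: "'a::real_or_complex^'n^'m"
  assumes "U \<in> unitary_matrices" shows "norm (X ** U) = norm X"
  by (simp add: norm_eq_sqrt_inner inner_unitary_right assms)

lemma norm_unitary_eq:
  fixes U V :: "'a::real_or_complex^'n^'n"
  assumes "U \<in> unitary_matrices" "V \<in> unitary_matrices" shows "norm U = norm V"
  using norm_unitary_left[OF assms(1), of "mat 1"] norm_unitary_left[OF assms(2), of "mat 1"] by simp

lemma norm_unitary_entry_le:
  fixes U :: "'a::real_or_complex^'n^'n"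
  assumes "U \<in> unitary_matrices" shows "norm (U $ i $ j) \<le> 1"
proof -
  have "(\<Sum>k\<in>UNIV. conjugate (U $ k $ j) * U $ k $ j) = 1"
    using arg_cong[OF unitary_left[OF assms], of "\<lambda>A. A $ j $ j"]
    by (simp add: matrix_matrix_mult_def mat_def)
  then have "of_real (\<Sum>k\<in>UNIV. (norm (U $ k $ j))\<^sup>2) = (of_real 1 :: 'a)"
    by (simp add: conjugate_mult_self)
  then have "(\<Sum>k\<in>UNIV. (norm (U $ k $ j))\<^sup>2) = 1"
    unfolding of_real_eq_iff .
  moreover have "(norm (U $ i $ j))\<^sup>2 \<le> (\<Sum>k\<in>UNIV. (norm (U $ k $ j))\<^sup>2)"
    by (rule member_le_sum) auto
  ultimately show ?thesis by (simp add: power_le_one_iff)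
qed

text \<open>Compactness provides the maximiser in \<open>svd_maximal\<close>.\<close>

lemma compact_unitary: "compact (unitary_matrices :: ('a::real_or_complex^'n^'n) set)"
proof (rule compact_eq_bounded_closed[THEN iffD2], intro conjI)
  show "bounded (unitary_matrices :: ('a^'n^'n) set)"
    unfolding bounded_iff using norm_unitary_eq[OF _ unitary_mat_1] by (metis order_refl)
  have "continuous_on UNIV (\<lambda>U::'a^'n^'n. conj_transpose U ** U)"
    "continuous_on UNIV (\<lambda>U::'a^'n^'n. U ** conj_transpose U)"
    by (intro bounded_bilinear.continuous_on[OF bounded_bilinear_matrix_mult]
        bounded_linear.continuous_on[OF bounded_linear_conj_transpose] continuous_intros)+
  then have "closed {U::'a^'n^'n. conj_transpose U ** U = mat 1}" 
    "closed {U::'a^'n^'n. U ** conj_transpose U = mat 1}"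
    by (auto intro!: closed_Collect_eq continuous_on_const)
  then show "closed (unitary_matrices :: ('a^'n^'n) set)"
    unfolding unitary_matrices_def Collect_conj_eq by (rule closed_Int)
qed

text \<open>The curve is the Cayley transform \<open>(1 - tK/2)\<^bsup>-1\<^esup> (1 + tK/2)\<close>.\<close>

lemma unitary_curve_through_skew:
  fixes K :: "'a::real_or_complex^'n^'n"
  assumes skew: "conj_transpose K = - K"
  obtains P :: "real \<Rightarrow> 'a^'n^'n" where "\<And>t. P t \<in> unitary_matrices" "P 0 = mat 1"
    "(P has_vector_derivative K) (at 0)"
proof -
  have inner0: "X \<bullet> (K ** X) = 0" for X :: "'a^'n^'n"
    using inner_mult_left[of X K X] skew by (simp add: matrix_distribs inner_commute)
  define N where "N t = mat 1 - (t/2) *\<^sub>R K" for t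
  have "\<exists>B. B ** N t = mat 1" for t
    unfolding matrix_left_invertible_ker
  proof (intro allI impI)
    fix x assume "N t *v x = 0"
    \<comment> \<open>Repeating \<open>x\<close> in every column turns the kernel vector into a
      matrix, to which \<open>inner0\<close> applies.\<close>
    define X :: "'a^'n^'n" where "X = (\<chi> i j. x $ i)"
    have "(N t ** X) $ i $ j = (N t *v x) $ i" for i j
      by (simp add: matrix_matrix_mult_def matrix_vector_mult_def X_def)
    then have "N t ** X = 0" using \<open>N t *v x = 0\<close> by (simp add: vec_eq_iff)
    then have eq: "X = (t/2) *\<^sub>R (K ** X)" by (simp add: N_def matrix_distribs)
    have "X \<bullet> X = (t/2) * (X \<bullet> (K ** X))" by (metis eq inner_scaleR_right)
    then have "X = 0" by (simp add: inner0)
    then show "x = 0" by (simp add: vec_eq_iff X_def)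
  qed
  then obtain B where B: "\<And>t. B t ** N t = mat 1" by metis
  then have B': "\<And>t. N t ** B t = mat 1" by (simp add: matrix_left_right_inverse)
  define P where "P t = B t ** conj_transpose (N t)" for t
  have N': "conj_transpose (N t) = mat 1 + (t/2) *\<^sub>R K" for t
    by (simp add: N_def matrix_distribs skew)
  have comm: "conj_transpose (N t) ** N t = N t ** conj_transpose (N t)" for t
    unfolding N' by (simp add: N_def matrix_distribs scaleR_add_right scaleR_diff_right)
  have unit: "P t \<in> unitary_matrices" for t
  proof -
    have "P t ** conj_transpose (P t) = B t ** (conj_transpose (N t) ** N t) ** conj_transpose (B t)"
      by (simp add: P_def conj_transpose_mult matrix_mul_assoc)
    also have "\<dots> = (B t ** N t) ** conj_transpose (B t ** N t)"
      unfolding comm by (simp add: conj_transpose_mult matrix_mul_assoc)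
    finally have "P t ** conj_transpose (P t) = mat 1" using B by simp
    then show ?thesis using matrix_left_right_inverse unfolding unitary_matrices_def by blast
  qed
  \<comment> \<open>Since \<open>P t\<close> is unitary, this bounds the inverse \<open>B t\<close>
    uniformly in \<open>t\<close>, hence also the remainder in \<open>expand\<close>.\<close>
  have BP: "B t = (1/2) *\<^sub>R (P t + mat 1)" for t
  proof -
    have "P t + B t ** N t = B t ** (2 *\<^sub>R mat 1)"
      unfolding P_def N' matrix_add_ldistrib[symmetric] by (simp add: N_def scaleR_2)
    then show ?thesis by (simp add: B matrix_distribs)
  qed
  define c where "c = norm (mat 1 :: 'a^'n^'n)"
  have nB: "norm (B t) \<le> c" for t
    using norm_triangle_ineq[of "P t" "mat 1"] norm_unitary_eq[OF unit[of t] unitary_mat_1]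
    by (simp add: BP c_def)
  have expand: "P t - mat 1 - t *\<^sub>R K = (t\<^sup>2/2) *\<^sub>R (B t ** K ** K)" for t
  proof -
    have "P t - mat 1 = B t ** (conj_transpose (N t) - N t)" 
      by (simp add: P_def matrix_distribs B)
    also have "conj_transpose (N t) - N t = t *\<^sub>R K"
    proof -
      have "conj_transpose (N t) - N t = (t/2) *\<^sub>R K + (t/2) *\<^sub>R K"
        unfolding N' by (simp only: N_def add_diff_eq diff_diff_eq2 add.assoc diff_add_eq) simp
      also have "\<dots> = (t/2 + t/2) *\<^sub>R K" by (simp only: scaleR_add_left)
      finally show ?thesis by simp
    qed
    also have "B t ** (t *\<^sub>R K) = t *\<^sub>R (B t ** K)" by (rule matrix_mult_scaleR_right)
    finally have 1: "P t - mat 1 = t *\<^sub>R (B t ** K)" .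
    have "B t - mat 1 = (t/2) *\<^sub>R (B t ** K)"
    proof -
      have "B t - mat 1 = B t ** (mat 1 - N t)" by (simp add: matrix_distribs B)
      also have "\<dots> = (t/2) *\<^sub>R (B t ** K)" by (simp add: N_def matrix_distribs)
      finally show ?thesis .
    qed
    then have "(B t - mat 1) ** K = (t/2) *\<^sub>R (B t ** K ** K)"
      by (simp add: matrix_mult_scaleR_left)
    then have "B t ** K - K = (t/2) *\<^sub>R (B t ** K ** K)"
      by (simp add: matrix_mult_diff_left)
    then have "t *\<^sub>R (B t ** K) - t *\<^sub>R K = t *\<^sub>R ((t/2) *\<^sub>R (B t ** K ** K))"
      by (metis scaleR_diff_right)
    then show ?thesis by (simp add: 1 power2_eq_square)
  qed
  have P0: "P 0 = mat 1" using expand[of 0] by simp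
  have "norm (P t - mat 1 - t *\<^sub>R K) \<le> (c * norm K * norm K) * (norm t)\<^sup>2" for t
  proof -
    have "norm (B t ** K ** K) \<le> norm (B t ** K) * norm K" by (rule norm_matrix_mult_le)
    also have "\<dots> \<le> norm (B t) * norm K * norm K" by (intro mult_right_mono norm_matrix_mult_le) simp
    also have "\<dots> \<le> c * norm K * norm K" by (intro mult_right_mono nB) simp_all
    finally have "norm (B t ** K ** K) \<le> c * norm K * norm K" .
    then have "t\<^sup>2 / 2 * norm (B t ** K ** K) \<le> t\<^sup>2 * (c * norm K * norm K)"
      by (intro mult_mono) auto
    then show ?thesis unfolding expand by (simp add: mult.commute)
  qed
  note bound = this
  have "(P has_vector_derivative K) (at 0)"
    unfolding has_vector_derivative_def has_derivative_at
  proof (intro conjI bounded_linear_scaleR_left)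
    show "((\<lambda>h. norm (P (0 + h) - P 0 - h *\<^sub>R K) / norm h) \<longlongrightarrow> 0) (at 0)"
    proof (rule Lim_null_comparison)
      show "\<forall>\<^sub>F h in at 0. norm (norm (P (0 + h) - P 0 - h *\<^sub>R K) / norm h) \<le> (c * norm K * norm K) * norm h"
        using bound by (intro always_eventually)
          (auto simp: P0 divide_le_eq power2_eq_square mult.assoc)
      show "((\<lambda>h::real. c * norm K * norm K * norm h) \<longlongrightarrow> 0) (at 0)"
        by (rule tendsto_eq_intros refl)+ simp
    qed
  qed
  then show thesis using that unit P0 by blast
qed

section \<open>Rectangular diagonal matrices\<close>

type_synonym ('a, 'm, 'n) mtx = "(('a, 'n) vec, 'm) vec"

text \<open>\<open>e\<close> sends a row to the column at the same position, turning the cardinality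
  test in \<open>rect_diag\<close> into an equation. Columns outside its range form the zero block;
  the identity gives the square case.\<close>

locale diag_embedding =
  fixes e :: "'m::{finite,linorder} \<Rightarrow> 'n::{finite,linorder}"
  assumes card_eq_iff: "card {..<i} = card {..<j} \<longleftrightarrow> j = e i"

lemma inj_card_lessThan: "inj (\<lambda>i::'p::{finite,linorder}. card {..<i})"
proof (rule injI)
  fix x y :: 'p assume "card {..<x} = card {..<y}"
  moreover have "card {..<a} < card {..<b}" if "a < b" for a b :: 'p
    by (rule psubset_card_mono) (use that in auto)
  ultimately show "x = y" by (metis less_irrefl linorder_neqE)
qed

lemma range_card_lessThan: "range (\<lambda>i::'p::{finite,linorder}. card {..<i}) = {..<CARD('p)}"
proof (rule card_subset_eq)
  show "range (\<lambda>i::'p. card {..<i}) \<subseteq> {..<CARD('p)}"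
    by (auto intro!: psubset_card_mono)
  show "card (range (\<lambda>i::'p. card {..<i})) = card {..<CARD('p)}"
    by (simp add: card_image inj_card_lessThan)
qed simp

lemma diag_embedding_exists:
  assumes "CARD('m::{finite,linorder}) \<le> CARD('n::{finite,linorder})"
  shows "\<exists>e::'m \<Rightarrow> 'n. diag_embedding e"
proof -
  have "card {..<i::'m} \<in> range (\<lambda>j::'n. card {..<j})" for i
    using range_card_lessThan[where 'p='m] range_card_lessThan[where 'p='n] assms
    by (metis lessThan_iff order_less_le_trans rangeI)
  then have "\<forall>i::'m. \<exists>j::'n. card {..<i} = card {..<j}" by auto
  then obtain e :: "'m \<Rightarrow> 'n" where "\<And>i. card {..<i} = card {..<e i}" by metis
  then show ?thesis
    unfolding diag_embedding_def by (metis injD[OF inj_card_lessThan])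
qed

lemma diag_embedding_id: "diag_embedding (\<lambda>i::'m::{finite,linorder}. i)"
  unfolding diag_embedding_def by (metis injD[OF inj_card_lessThan])

lemma rect_diag_add: "rect_diag (x + y) = rect_diag x + rect_diag y"
  and rect_diag_diff: "rect_diag (x - y) = rect_diag x - rect_diag y"
  and rect_diag_scaleR: "rect_diag (r *\<^sub>R x) = r *\<^sub>R rect_diag x"
  by (auto simp: rect_diag_def vec_eq_iff of_real_def scaleR_add_left scaleR_diff_left)

definition signed_perm :: "('p \<Rightarrow> real) \<Rightarrow> ('p \<Rightarrow> 'p) \<Rightarrow> 'a::real_algebra_1^'p^'p"
  where "signed_perm \<epsilon> \<pi> = (\<chi> i k. if k = \<pi> i then of_real (\<epsilon> i) else 0)"

lemma signed_perm_unitary: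
  fixes \<epsilon> :: "'p::finite \<Rightarrow> real"
  assumes "bij \<pi>" "\<And>i. \<bar>\<epsilon> i\<bar> = 1"
  shows "(signed_perm \<epsilon> \<pi> :: 'a::real_or_complex^'p^'p) \<in> unitary_matrices"
proof -
  have sq: "of_real (\<epsilon> i) * of_real (\<epsilon> i) = (1 :: 'a)" for i
    using assms(2)[of i] by (metis abs_mult_self_eq mult_1 of_real_1 of_real_mult)
  have "(signed_perm \<epsilon> \<pi> ** conj_transpose (signed_perm \<epsilon> \<pi>) :: 'a^'p^'p) = mat 1"
    using bij_is_inj[OF assms(1)]
    by (auto simp: vec_eq_iff matrix_matrix_mult_def signed_perm_def mat_def sq inj_eq
        if_distrib[of conjugate] if_distrib[of "\<lambda>a. a * _"] cong: if_cong)
  then show ?thesis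
    using matrix_left_right_inverse unfolding unitary_matrices_def by blast
qed

lemma signed_permutation_matrix_signed_perm:
  assumes "bij \<pi>" "\<And>i. \<bar>\<epsilon> i\<bar> = 1"
  shows "signed_permutation_matrix (signed_perm \<epsilon> \<pi>)"
proof -
  have nz: "\<epsilon> i \<noteq> 0" "\<epsilon> i = 1 \<or> \<epsilon> i = - 1" for i using assms(2)[of i] by auto
  show ?thesis
    unfolding signed_permutation_matrix_def signed_perm_def
    using nz bij_is_inj[OF assms(1), unfolded inj_eq] bij_pointE[OF assms(1)] 
    by (auto) (metis)+
qed

lemma signed_perm_mult_vec: "signed_perm \<epsilon> \<pi> *v x = (\<chi> i. \<epsilon> i * x $ \<pi> i)"
  for x :: "real^'p"
  by (simp add: vec_eq_iff matrix_vector_mult_def signed_perm_def if_distrib[of "\<lambda>a. a * _"] cong: if_cong)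

context diag_embedding
begin

lemma inj_e: "inj e"
  by (metis card_eq_iff inj_card_lessThan injD injI)

lemma e_eq_iff [simp]: "e i = e j \<longleftrightarrow> i = j"
  using inj_e by (auto dest: injD)

lemma rect_diag_nth: "rect_diag x $ i $ j = (if j = e i then of_real (x $ i) else 0)"
  by (simp add: rect_diag_def card_eq_iff)

lemma rect_diag_mult_nth: "(rect_diag x ** A) $ i $ l = of_real (x $ i) * A $ e i $ l"
  by (simp add: matrix_matrix_mult_def rect_diag_nth if_distrib[of "\<lambda>a. a * _"] cong: if_cong)

lemma mult_rect_diag_nth:
  "((A :: 'a::real_algebra_1^_^_) ** rect_diag x) $ k $ l = (if l \<in> range e then A $ k $ inv e l * of_real (x $ inv e l) else 0)"
proof (cases "l \<in> range e")
  case True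
  then obtain j where "l = e j" by auto
  then show ?thesis
    by (simp add: inv_f_f inj_e matrix_matrix_mult_def rect_diag_nth if_distrib[of "\<lambda>a. _ * a"] cong: if_cong)
next
  case False
  then have "(rect_diag x :: ('a,'m,'n) mtx) $ k $ l = 0" for k
    by (auto simp: rect_diag_nth)
  then show ?thesis using False by (simp add: matrix_matrix_mult_def)
qed

lemma mult_rect_diag_nth_e [simp]: "(A ** rect_diag x) $ k $ e j = A $ k $ j * of_real (x $ j)"
  by (simp add: mult_rect_diag_nth inj_e)

lemma conj_rect_diag_mult_nth:
  "(conj_transpose (rect_diag x) ** A) $ e j $ l = of_real (x $ j) * (A $ j $ l :: 'a::real_or_complex)"
  "k \<notin> range e \<Longrightarrow> (conj_transpose (rect_diag x) ** A) $ k $ l = (0 :: 'a)"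
   by (auto simp: matrix_matrix_mult_def rect_diag_nth if_distrib[of conjugate] if_distrib[of "\<lambda>a. a * _"] cong: if_cong
       intro!: sum.neutral)

lemma mult_conj_rect_diag_nth:
  "(A ** conj_transpose (rect_diag x)) $ k $ j = A $ k $ e j * (of_real (x $ j) :: 'a::real_or_complex)"
   by (simp add: matrix_matrix_mult_def rect_diag_nth if_distrib[of conjugate] if_distrib[of "\<lambda>a. _ * a"] cong: if_cong)

lemma inner_rect_diag: "rect_diag w \<bullet> B = (\<Sum>i\<in>UNIV. w $ i * (1 \<bullet> B $ i $ e i))"
  for B :: "('a::real_or_complex,'m,'n) mtx"
proof -
  have "rect_diag w $ i \<bullet> B $ i = w $ i * (1 \<bullet> B $ i $ e i)" for i
    by (simp add: inner_vec_def[of "rect_diag w $ i"] rect_diag_nth if_distrib[of "\<lambda>a. a \<bullet> _"]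
        inner_of_real_left cong: if_cong)
  then show ?thesis by (simp add: inner_vec_def[of "rect_diag w"])
qed

lemma inner_rect_diag_rect_diag:
  "(rect_diag x :: ('a::real_or_complex,'m,'n) mtx) \<bullet> rect_diag y = x \<bullet> y"
  unfolding inner_rect_diag by (simp add: rect_diag_nth inner_vec_def)

lemma norm_rect_diag [simp]: "norm (rect_diag x :: ('a::real_or_complex,'m,'n) mtx) = norm x"
  by (simp add: norm_eq_sqrt_inner inner_rect_diag_rect_diag)

text \<open>The left factor carries signs and permutation, the right one the permutation transported
  by \<open>e\<close>, fixing the extra columns. The same pair serves every \<open>x\<close>, so it
  acts on a vector and on its image under \<open>g\<close> at once.\<close>

lemma rect_diag_signed_perm:
  assumes "bij \<pi>" "\<And>i. \<bar>\<epsilon> i\<bar> = 1"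
  obtains U :: "('a::real_or_complex,'m,'m) mtx" and V :: "('a,'n,'n) mtx"
  where "U \<in> unitary_matrices" "V \<in> unitary_matrices"
    "\<And>x. rect_diag (\<chi> i. \<epsilon> i * x $ \<pi> i) = U ** rect_diag x ** V"
proof
  define \<tau> where "\<tau> l = (if l \<in> range e then e (\<pi> (inv e l)) else l)" for l
  have \<tau>e [simp]: "\<tau> (e i) = e (\<pi> i)" for i by (simp add: \<tau>_def inj_e)
  have "inj \<tau>"
  proof (rule injI)
    fix k l assume "\<tau> k = \<tau> l"
    then show "k = l"
      by (auto simp: \<tau>_def inj_e inj_eq[OF bij_is_inj[OF assms(1)]] split: if_splits)
  qed
  then have "bij \<tau>" by (simp add: bij_def finite_UNIV_inj_surj)
  show "(signed_perm \<epsilon> \<pi> :: ('a,'m,'m) mtx) \<in> unitary_matrices" by (rule signed_perm_unitary[OF assms])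
  show "conj_transpose (signed_perm (\<lambda>_. 1) \<tau> :: ('a,'n,'n) mtx) \<in> unitary_matrices"
    using \<open>bij \<tau>\<close> by (simp add: signed_perm_unitary)
  fix x :: "(real,'m) vec"
  have 1: "(signed_perm \<epsilon> \<pi> ** rect_diag x :: ('a,'m,'n) mtx) $ i $ l
      = (if l = e (\<pi> i) then of_real (\<epsilon> i * x $ \<pi> i) else 0)" for i l
    by (simp add: matrix_matrix_mult_def signed_perm_def rect_diag_nth if_distrib[of "\<lambda>a. a * _"] cong: if_cong)
  have "\<tau> l = e (\<pi> i) \<longleftrightarrow> l = e i" for l i
    using inj_eq[OF \<open>inj \<tau>\<close>, of l "e i"] by simp
  then show "(rect_diag (\<chi> i. \<epsilon> i * x $ \<pi> i) :: ('a,'m,'n) mtx)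
      = signed_perm \<epsilon> \<pi> ** rect_diag x ** conj_transpose (signed_perm (\<lambda>_. 1) \<tau>)"
    unfolding vec_eq_iff matrix_matrix_mult_def[of "signed_perm \<epsilon> \<pi> ** rect_diag x"]
    by (simp add: 1 signed_perm_def[of "\<lambda>_. 1"] rect_diag_nth if_distrib[of "\<lambda>a. a * _"]
        eq_commute[of "e _" "\<tau> _"] cong: if_cong)
qed

end

section \<open>Sorting by signed permutations\<close>

definition sorted_nonneg :: "real^'m::{finite,linorder} \<Rightarrow> bool"
  where "sorted_nonneg s \<longleftrightarrow> (\<forall>i. 0 \<le> s $ i) \<and> (\<forall>i j. i \<le> j \<longrightarrow> s $ j \<le> s $ i)"

text \<open>Weights for which the rearrangement inequality is strict, so that a maximiser must be
  sorted.\<close>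

definition strictly_decreasing_pos :: "real^'m::{finite,linorder} \<Rightarrow> bool"
  where "strictly_decreasing_pos w \<longleftrightarrow> (\<forall>i. 0 < w $ i) \<and> (\<forall>i j. i < j \<longrightarrow> w $ j < w $ i)"

text \<open>The gaps are at least 1, so raising one coordinate by 1/2 keeps the order. Comparing the
  two weight vectors later isolates a single singular value.\<close>

definition rank_weights :: "real^'m::{finite,linorder}"
  where "rank_weights = (\<chi> i. 1 + real (card {i<..}))"

lemma rank_weights_gap:
  fixes i j :: "'m::{finite,linorder}"
  assumes "i < j" shows "rank_weights $ j + 1 \<le> rank_weights $ i"
proof -
  have "card {j<..} < card {i<..}" by (rule psubset_card_mono) (use assms in auto)
  then show ?thesis by (simp add: rank_weights_def)
qed

lemma strictly_decreasing_pos_rank_weights: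
  "strictly_decreasing_pos rank_weights"
  "strictly_decreasing_pos (rank_weights + axis k (1/2))"
  using rank_weights_gap
  by (force simp: strictly_decreasing_pos_def rank_weights_def axis_def)+

text \<open>Two test moves suffice: a sign flip at k lowers the sum by 2 w_k b_k, a swap of j and k
  lowers it by (w_j - w_k)(b_j - b_k), and neither amount can be negative.\<close>

lemma sorted_nonneg_if_maximal:
  assumes w: "strictly_decreasing_pos w"
    and max: "\<And>\<epsilon> \<pi>. bij \<pi> \<Longrightarrow> (\<And>i. \<bar>\<epsilon> i\<bar> = 1) \<Longrightarrow> (\<Sum>i\<in>UNIV. w $ i * (\<epsilon> i * b $ \<pi> i)) \<le> (\<Sum>i\<in>UNIV. w $ i * b $ i)"
  shows "sorted_nonneg b"
  unfolding sorted_nonneg_def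
proof (intro conjI allI impI)
  fix k
  have "(\<Sum>i\<in>UNIV. w $ i * ((if i = k then -1 else 1) * b $ id i)) \<le> (\<Sum>i\<in>UNIV. w $ i * b $ i)"
    by (rule max) (auto simp del: id_apply)
  then have "0 \<le> (\<Sum>i\<in>UNIV. w $ i * b $ i - w $ i * ((if i = k then -1 else 1) * b $ id i))"
    by (simp add: sum_subtractf)
  also have "\<dots> = (\<Sum>i\<in>UNIV. if i = k then 2 * (w $ k * b $ k) else 0)"
    by (rule sum.cong) auto
  finally show "0 \<le> b $ k"
    using w by (auto simp: strictly_decreasing_pos_def zero_le_mult_iff not_le[symmetric])
next
  fix j k :: 'a assume "j \<le> k"
  show "b $ k \<le> b $ j"
  proof (cases "j = k")
    case False
    with \<open>j \<le> k\<close> have "w $ k < w $ j" using w by (simp add: strictly_decreasing_pos_def)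
    have "(\<Sum>i\<in>UNIV. w $ i * (1 * b $ Transposition.transpose j k i)) \<le> (\<Sum>i\<in>UNIV. w $ i * b $ i)"
      by (rule max) auto
    then have "0 \<le> (\<Sum>i\<in>UNIV. w $ i * b $ i - w $ i * b $ Transposition.transpose j k i)"
      by (simp add: sum_subtractf)
    also have "\<dots> = (\<Sum>i\<in>{j,k}. w $ i * b $ i - w $ i * b $ Transposition.transpose j k i)"
      by (rule sum.mono_neutral_right) (auto simp: Transposition.transpose_def)
    also have "\<dots> = (w $ j - w $ k) * (b $ j - b $ k)"
      using False by (simp add: algebra_simps)
    finally show ?thesis using \<open>w $ k < w $ j\<close> by (simp add: zero_le_mult_iff)
  qed simp
qed

text \<open>Signed permutations form a finite group, so the weighted sum has a maximiser; composing
  with a further one stays in the group, so the previous lemma applies. Encoding signs as Booleans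
  makes finiteness evident.\<close>

lemma signed_sort_exists:
  fixes x :: "real^'m::{finite,linorder}"
  obtains \<epsilon> :: "'m \<Rightarrow> real" and \<pi> where "bij \<pi>" "\<And>i. \<bar>\<epsilon> i\<bar> = 1" "sorted_nonneg (\<chi> i. \<epsilon> i * x $ \<pi> i)"
proof -
  define sgnf :: "('m \<Rightarrow> bool) \<Rightarrow> 'm \<Rightarrow> real" where "sgnf c i = (if c i then 1 else - 1)" for c i
  define S where "S = (UNIV :: ('m \<Rightarrow> bool) set) \<times> {\<pi> :: 'm \<Rightarrow> 'm. bij \<pi>}"
  define F where "F p = (\<Sum>i\<in>UNIV. rank_weights $ i * (sgnf (fst p) i * x $ snd p i))" for p :: "('m \<Rightarrow> bool) \<times> ('m \<Rightarrow> 'm)"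
  have "finite S" "S \<noteq> {}" unfolding S_def by (auto intro: exI[of _ id])
  then have "Max (F ` S) \<in> F ` S" by (intro Max_in) auto
  then obtain c \<pi> where cp: "(c, \<pi>) \<in> S" "F (c, \<pi>) = Max (F ` S)" by auto
  have le: "F p \<le> F (c, \<pi>)" if "p \<in> S" for p
    unfolding cp(2) using that \<open>finite S\<close> by (intro Max_ge) auto
  have "sorted_nonneg (\<chi> i. sgnf c i * x $ \<pi> i)"
  proof (rule sorted_nonneg_if_maximal[OF strictly_decreasing_pos_rank_weights(1)])
    fix \<epsilon>' :: "'m \<Rightarrow> real" and \<pi>' :: "'m \<Rightarrow> 'm"
    assume p': "bij \<pi>'" "\<And>i. \<bar>\<epsilon>' i\<bar> = 1"
    define c' where "c' i \<longleftrightarrow> \<epsilon>' i * sgnf c (\<pi>' i) = 1" for i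
    have c': "sgnf c' i = \<epsilon>' i * sgnf c (\<pi>' i)" for i
      using p'(2)[of i] unfolding c'_def sgnf_def by (auto simp: abs_if split: if_splits)
    have "bij (\<pi> \<circ> \<pi>')" using cp(1) p'(1) by (auto simp: S_def bij_comp)
    then have "F (c', \<pi> \<circ> \<pi>') \<le> F (c, \<pi>)" by (intro le) (auto simp: S_def)
    then show "(\<Sum>i\<in>UNIV. rank_weights $ i * (\<epsilon>' i * (\<chi> i. sgnf c i * x $ \<pi> i) $ \<pi>' i))
        \<le> (\<Sum>i\<in>UNIV. rank_weights $ i * (\<chi> i. sgnf c i * x $ \<pi> i) $ i)"
      by (simp add: F_def c' mult.assoc)
  qed
  moreover have "bij \<pi>" using cp(1) by (auto simp: S_def)
  ultimately show thesis using that[of \<pi> "sgnf c"] by (auto simp: sgnf_def)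
qed

section \<open>The singular value decomposition\<close>

text \<open>First-order condition: with M = B W^H, moving along a unitary curve with velocity M^H -
  M has derivative <M - M^H, M>, which is half of |M^H - M|^2.\<close>

lemma self_adjoint_if_maximal_left:
  fixes W B :: "'a::real_or_complex^'n^'m"
  assumes max: "\<And>P. P \<in> unitary_matrices \<Longrightarrow> W \<bullet> (P ** B) \<le> W \<bullet> B"
  shows "conj_transpose (B ** conj_transpose W) = B ** conj_transpose W"
proof -
  define M where "M = B ** conj_transpose W"
  define K where "K = conj_transpose M - M"
  have skew: "conj_transpose K = - K" by (simp add: K_def matrix_distribs)
  obtain P where P: "\<And>t. P t \<in> unitary_matrices" "P 0 = mat 1" "(P has_vector_derivative K) (at 0)"
    using unitary_curve_through_skew[OF skew] by blast
  have bl: "bounded_linear (\<lambda>X::'a^'m^'m. W \<bullet> (X ** B))"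
    by (intro bounded_linear_compose[OF bounded_linear_inner_right]
        bounded_bilinear.bounded_linear_left[OF bounded_bilinear_matrix_mult])
  have "((\<lambda>t. W \<bullet> (P t ** B)) has_vector_derivative W \<bullet> (K ** B)) (at 0)"
    by (rule bounded_linear.has_vector_derivative[OF bl P(3)])
  then have "((\<lambda>t. W \<bullet> (P t ** B)) has_real_derivative W \<bullet> (K ** B)) (at 0)"
    by (simp add: has_real_derivative_iff_has_vector_derivative)
  then have "W \<bullet> (K ** B) = 0"
    by (rule DERIV_local_max[of _ _ _ 1]) (simp_all add: P max)
  moreover have "W \<bullet> (K ** B) = conj_transpose K \<bullet> M"
    using inner_mult_left[of W K B] inner_mult_right[of "conj_transpose K" B "conj_transpose W"]
    by (simp add: M_def)
  ultimately have "M \<bullet> M = conj_transpose M \<bullet> M"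
    by (simp add: K_def inner_diff_left matrix_distribs)
  moreover have "conj_transpose M \<bullet> conj_transpose M = M \<bullet> M" by (rule inner_conj_transpose)
  ultimately have "(conj_transpose M - M) \<bullet> (conj_transpose M - M) = 0"
    by (simp add: inner_diff_left inner_diff_right inner_commute)
  then show ?thesis by (simp add: M_def)
qed

lemma self_adjoint_if_maximal_right:
  fixes W B :: "'a::real_or_complex^'n^'m"
  assumes max: "\<And>Q. Q \<in> unitary_matrices \<Longrightarrow> W \<bullet> (B ** Q) \<le> W \<bullet> B"
  shows "conj_transpose (conj_transpose B ** W) = conj_transpose B ** W"
proof -
  have "conj_transpose W \<bullet> (Q ** conj_transpose B) \<le> conj_transpose W \<bullet> conj_transpose B"
    if "Q \<in> unitary_matrices" for Q
  proof -
    have "Q ** conj_transpose B = conj_transpose (B ** conj_transpose Q)"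
      by (simp add: conj_transpose_mult)
    then show ?thesis using max[of "conj_transpose Q"] that by (simp add: inner_conj_transpose)
  qed
  from self_adjoint_if_maximal_left[OF this] show ?thesis by simp
qed

context diag_embedding
begin

text \<open>Both B W^H and B^H W are Hermitian for W = D_w. Eliminating the transposed entry gives
  B_ij (w_i^2 - w_j^2) = 0, so distinct positive weights kill the off-diagonal entries; the diagonal
  ones are real. Signed permutations are among the competitors, so the diagonal is sorted.\<close>

lemma diagonal_if_maximal:
  fixes B :: "('a::real_or_complex,'m,'n) mtx"
  assumes w: "strictly_decreasing_pos w"
    and max: "\<And>P Q. P \<in> unitary_matrices \<Longrightarrow> Q \<in> unitary_matrices \<Longrightarrow>
      rect_diag w \<bullet> (P ** B ** Q) \<le> rect_diag w \<bullet> B"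
  obtains b where "sorted_nonneg b" "B = rect_diag b"
proof -
  have L: "conj_transpose (B ** conj_transpose (rect_diag w)) = B ** conj_transpose (rect_diag w)"
    using max[OF _ unitary_mat_1] by (intro self_adjoint_if_maximal_left) simp
  have R: "conj_transpose (conj_transpose B ** rect_diag w) = conj_transpose B ** rect_diag w"
    using max[OF unitary_mat_1] by (intro self_adjoint_if_maximal_right) simp
  have L': "conjugate (B $ j $ e i) * of_real (w $ i) = B $ i $ e j * of_real (w $ j)" for i j
    using arg_cong[OF L, of "\<lambda>A. A $ i $ j"] by (simp add: mult_conj_rect_diag_nth conjugate_mult)
  have R': "B $ i $ k * of_real (w $ i) = (if k \<in> range e then conjugate (B $ inv e k $ e i) * of_real (w $ inv e k) else 0)" for i k
    using arg_cong[OF R, of "\<lambda>A. conjugate (A $ k $ e i)"]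
    by (simp add: mult_rect_diag_nth conjugate_mult inv_f_f inj_e split: if_splits)
  have wpos: "w $ i > 0" for i using w by (simp add: strictly_decreasing_pos_def)
  define b where "b = (\<chi> i. 1 \<bullet> B $ i $ e i)"
  have Bb: "B = rect_diag b"
    unfolding vec_eq_iff
  proof (intro allI)
    fix i k
    consider "k \<notin> range e" | "k = e i" | j where "k = e j" "j \<noteq> i" by blast
    then show "B $ i $ k = rect_diag b $ i $ k"
    proof cases
      case 1
      then show ?thesis using R'[of i k] wpos[of i] by (auto simp: rect_diag_nth)
    next
      case 2
      have "conjugate (B $ i $ e i) = B $ i $ e i" using L'[of i i] wpos[of i] by simp
      then show ?thesis
        using self_adjoint_imp_of_real[of "B $ i $ e i"] by (simp add: 2 rect_diag_nth b_def)
    next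
      case 3
      have "B $ i $ k * of_real (w $ i) = conjugate (B $ j $ e i) * of_real (w $ j)"
        using R'[of i k] 3 by (simp add: inv_f_f inj_e)
      then have "B $ i $ k * of_real (w $ i) * of_real (w $ i) = conjugate (B $ j $ e i) * of_real (w $ i) * of_real (w $ j)"
        by simp
      also have "\<dots> = B $ i $ k * of_real (w $ j) * of_real (w $ j)" using L'[where i=i and j=j] 3 by simp
      finally have "B $ i $ k * of_real ((w $ i)\<^sup>2 - (w $ j)\<^sup>2) = 0"
        by (simp add: algebra_simps power2_eq_square)
      moreover have "w $ i \<noteq> w $ j" 
        using w \<open>j \<noteq> i\<close> by (metis less_irrefl linorder_neqE strictly_decreasing_pos_def)
      then have "(w $ i)\<^sup>2 \<noteq> (w $ j)\<^sup>2" using wpos[of i] wpos[of j] by (simp add: power2_eq_iff)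
      ultimately show ?thesis using 3 by (simp add: rect_diag_nth del: of_real_diff of_real_power)
    qed
  qed
  have "sorted_nonneg b"
  proof (rule sorted_nonneg_if_maximal[OF w])
    fix \<epsilon> :: "'m \<Rightarrow> real" and \<pi> :: "'m \<Rightarrow> 'm" assume "bij \<pi>" "\<And>i. \<bar>\<epsilon> i\<bar> = 1"
    then obtain U :: "('a,'m,'m) mtx" 
      and V :: "('a,'n,'n) mtx"
      where UV: "U \<in> unitary_matrices" "V \<in> unitary_matrices"
      "\<And>x. rect_diag (\<chi> i. \<epsilon> i * x $ \<pi> i) = U ** rect_diag x ** V"
      by (rule rect_diag_signed_perm[of \<pi> \<epsilon>]) auto
    have "rect_diag w \<bullet> (rect_diag (\<chi> i. \<epsilon> i * b $ \<pi> i) :: ('a,'m,'n) mtx) 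
      \<le> rect_diag w \<bullet> (rect_diag b :: ('a,'m,'n) mtx)"
      unfolding UV(3) using max[OF UV(1,2)] by (simp add: Bb)
    then show "(\<Sum>i\<in>UNIV. w $ i * (\<epsilon> i * b $ \<pi> i)) \<le> (\<Sum>i\<in>UNIV. w $ i * b $ i)"
      unfolding inner_rect_diag_rect_diag by (simp add: inner_vec_def)
  qed
  then show thesis using that Bb by blast
qed

text \<open>
  A maximiser of \<open>(U, V) \<mapsto> rect_diag w \<bullet> (U\<^sup>* Z V)\<close> diagonalises \<open>Z\<close>; that it is a maximiser makes
  weighted sums of singular values support functions, hence Lipschitz.
\<close>

lemma svd_maximal:
  fixes Z :: "('a::real_or_complex,'m,'n) mtx"
  assumes w: "strictly_decreasing_pos w"
  obtains U V b where "U \<in> unitary_matrices" "V \<in> unitary_matrices" "sorted_nonneg b"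
    "Z = U ** rect_diag b ** conj_transpose V"
    "\<And>P Q. P \<in> unitary_matrices \<Longrightarrow> Q \<in> unitary_matrices \<Longrightarrow> rect_diag w \<bullet> (P ** Z ** Q) \<le> w \<bullet> b"
proof -
  define F where "F p = rect_diag w \<bullet> (fst p ** Z ** snd p)"
    for p :: "(('a,'m,'m) mtx) \<times> (('a,'n,'n) mtx)"
  have cont: "continuous_on UNIV F" unfolding F_def
    by (intro continuous_intros bounded_bilinear.continuous_on[OF bounded_bilinear_matrix_mult])
  have "\<exists>p\<in>unitary_matrices \<times> unitary_matrices. \<forall>q\<in>unitary_matrices \<times> unitary_matrices. F q \<le> F p"
    by (rule continuous_attains_sup)
      (auto intro: compact_Times compact_unitary unitary_mat_1 continuous_on_subset[OF cont])
  then obtain P Q where PQ: "P \<in> unitary_matrices" "Q \<in> unitary_matrices"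
    and max: "\<And>P' Q'. P' \<in> unitary_matrices \<Longrightarrow> Q' \<in> unitary_matrices \<Longrightarrow>
      rect_diag w \<bullet> (P' ** Z ** Q') \<le> rect_diag w \<bullet> (P ** Z ** Q)"
    by (force simp: F_def)
  obtain b where b: "sorted_nonneg b" "P ** Z ** Q = rect_diag b"
  proof (rule diagonal_if_maximal[OF w])
    fix P' :: "('a,'m,'m) mtx" 
      and Q' :: "('a,'n,'n) mtx"
    assume "P' \<in> unitary_matrices" "Q' \<in> unitary_matrices"
    then show "rect_diag w \<bullet> (P' ** (P ** Z ** Q) ** Q') \<le> rect_diag w \<bullet> (P ** Z ** Q)"
      using max[OF unitary_mult unitary_mult, of P' P Q Q'] PQ by (simp add: matrix_mul_assoc)
  qed
  show thesis
  proof (rule that[of "conj_transpose P" Q b])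
    show "Z = conj_transpose P ** rect_diag b ** conj_transpose Q"
      using PQ by (simp add: b(2)[symmetric] unitary_cancel unitary_right flip: matrix_mul_assoc)
    show "rect_diag w \<bullet> (P' ** Z ** Q') \<le> w \<bullet> b"
      if "P' \<in> unitary_matrices" "Q' \<in> unitary_matrices" for P' Q'
      using max[OF that] unfolding b(2) inner_rect_diag_rect_diag .
  qed (use PQ b in auto)
qed

lemma det_characteristic:
  fixes U :: "('a::real_or_complex,'m,'m) mtx"
    and V :: "('a::real_or_complex,'n,'n) mtx"
  assumes U: "U \<in> unitary_matrices" and V: "V \<in> unitary_matrices"
    and Z: "Z = U ** rect_diag s ** conj_transpose V"
  shows "det (mat t - Z ** conj_transpose Z) = (\<Prod>i\<in>UNIV. t - of_real ((s $ i)\<^sup>2))"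
proof -
  define D where "D = rect_diag s ** conj_transpose (rect_diag s :: ('a,'m,'n) mtx)"
  have ZZ: "Z ** conj_transpose Z = U ** D ** conj_transpose U"
    using V by (simp add: Z D_def conj_transpose_mult matrix_mul_assoc unitary_cancel)
  have "U ** mat t ** conj_transpose U = mat t"
  proof -
    have "U ** mat t = mat t ** U"
      by (simp add: vec_eq_iff matrix_matrix_mult_def mat_def if_distrib[of "\<lambda>a. a * _"] if_distrib[of "\<lambda>a. _ * a"]
          mult.commute cong: if_cong)
    then show ?thesis using U by (simp add: unitary_cancel)
  qed
  then have "mat t - Z ** conj_transpose Z = U ** (mat t - D) ** conj_transpose U"
    by (simp add: ZZ matrix_distribs)
  then have "det (mat t - Z ** conj_transpose Z) = det (mat t - D) * (det U * det (conj_transpose U))"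
    by (simp add: det_mul)
  also have "det U * det (conj_transpose U) = 1"
    using U by (simp add: unitary_right flip: det_mul)
  also have "det (mat t - D) = (\<Prod>i\<in>UNIV. (mat t - D) $ i $ i)"
    by (rule det_diagonal) (auto simp: D_def mat_def rect_diag_mult_nth rect_diag_nth)
  finally show ?thesis
    by (simp add: D_def mat_def rect_diag_mult_nth rect_diag_nth power2_eq_square)
qed

end

section \<open>Uniqueness and Lipschitz continuity of singular values\<close>

text \<open>Equal polynomials have equal root multisets, and square roots recover the entries. What
  remains is that a nonincreasing vector is determined by the multiset of its entries.\<close>

lemma sorted_nonneg_unique:
  fixes s s' :: "real^'m::{finite,linorder}"
  assumes s: "sorted_nonneg s" and s': "sorted_nonneg s'"
    and eq: "\<And>t :: 'a::real_or_complex. (\<Prod>i\<in>UNIV. t - of_real ((s $ i)\<^sup>2)) = (\<Prod>i\<in>UNIV. t - of_real ((s' $ i)\<^sup>2))"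
  shows "s = s'"
proof -
  define p :: "real^'m::{finite,linorder} \<Rightarrow> 'a poly" where "p x = (\<Prod>i\<in>UNIV. [:- of_real ((x $ i)\<^sup>2), 1:])" for x
  have "poly (p s) = poly (p s')" using eq by (simp add: p_def poly_prod fun_eq_iff algebra_simps)
  then have "p s = p s'" by (simp only: poly_eq_poly_eq_iff)
  moreover have "proots (p x) = image_mset (\<lambda>i. of_real ((x $ i)\<^sup>2)) (mset_set UNIV)"
    for x :: "real^'m::{finite,linorder}"
    unfolding p_def by (subst proots_prod) (auto simp: sum_unfold_sum_mset)
  ultimately have "image_mset (\<lambda>i. of_real ((s $ i)\<^sup>2)) (mset_set UNIV)
      = (image_mset (\<lambda>i. of_real ((s' $ i)\<^sup>2)) (mset_set UNIV) :: 'a multiset)" by metis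
  then have "image_mset (\<lambda>a. sqrt (1 \<bullet> a)) (image_mset (\<lambda>i. of_real ((s $ i)\<^sup>2) :: 'a) (mset_set UNIV))
      = image_mset (\<lambda>a. sqrt (1 \<bullet> a)) (image_mset (\<lambda>i. of_real ((s' $ i)\<^sup>2) :: 'a) (mset_set UNIV))"
    by simp
  then have ms: "image_mset (\<lambda>i. s $ i) (mset_set UNIV) = image_mset (\<lambda>i. s' $ i) (mset_set UNIV)"
    using s s' by (simp add: multiset.map_comp comp_def sorted_nonneg_def del: of_real_power)
  have card: "card {i. c \<le> s $ i} = card {i. c \<le> s' $ i}" for c
  proof -
    have "size (filter_mset (\<lambda>y. c \<le> y) (image_mset (\<lambda>i. x $ i) (mset_set UNIV))) = card {i. c \<le> x $ i}"
      for x :: "real^'m::{finite,linorder}"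
      by (simp add: filter_mset_image_mset)
    then show ?thesis using ms by metis
  qed
  \<comment> \<open>Superlevel sets of nonincreasing vectors are initial segments, hence nested, and
    nested sets of equal size coincide.\<close>
  have sets: "{i. c \<le> s $ i} = {i. c \<le> s' $ i}" for c
  proof -
    have "{i. c \<le> s $ i} \<subseteq> {i. c \<le> s' $ i} \<or> {i. c \<le> s' $ i} \<subseteq> {i. c \<le> s $ i}"
      using s s' unfolding sorted_nonneg_def by (smt (verit) linorder_le_cases mem_Collect_eq subsetI)
    then show ?thesis using card_subset_eq[OF _ _ card] card_subset_eq[OF _ _ card[symmetric]] by auto
  qed
  then have "c \<le> s $ i \<longleftrightarrow> c \<le> s' $ i" for c i by blast
  then show ?thesis by (simp add: vec_eq_iff) (metis order_antisym order_refl)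
qed

context diag_embedding
begin

lemma singular_values_eq:
  fixes U :: "('a::real_or_complex,'m,'m) mtx"
    and V :: "('a::real_or_complex,'n,'n) mtx"
  assumes "U \<in> unitary_matrices" "V \<in> unitary_matrices" "sorted_nonneg s"
  shows "singular_values (U ** rect_diag s ** conj_transpose V) = s"
  unfolding singular_values_def
proof (rule the_equality)
  show "(\<forall>i. 0 \<le> s $ i) \<and> (\<forall>i j. i \<le> j \<longrightarrow> s $ j \<le> s $ i) \<and>
    (\<forall>t. det (mat t - (U ** rect_diag s ** conj_transpose V) ** conj_transpose (U ** rect_diag s ** conj_transpose V))
      = (\<Prod>i\<in>UNIV. t - of_real ((s $ i)\<^sup>2)))"
    using assms det_characteristic[OF assms(1,2) refl] by (simp add: sorted_nonneg_def)
next
  fix s' :: "(real,'m) vec"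
  assume "(\<forall>i. 0 \<le> s' $ i) \<and> (\<forall>i j. i \<le> j \<longrightarrow> s' $ j \<le> s' $ i) \<and>
    (\<forall>t. det (mat t - (U ** rect_diag s ** conj_transpose V) ** conj_transpose (U ** rect_diag s ** conj_transpose V))
      = (\<Prod>i\<in>UNIV. t - of_real ((s' $ i)\<^sup>2)))"
  then show "s' = s"
    using det_characteristic[OF assms(1,2) refl]
    by (intro sorted_nonneg_unique[where ?'a='a, OF _ assms(3)]) (auto simp: sorted_nonneg_def)
qed

lemma svd_exists:
  fixes Z :: "('a::real_or_complex,'m,'n) mtx"
  obtains U V where "U \<in> unitary_matrices" "V \<in> unitary_matrices"
    "Z = U ** rect_diag (singular_values Z) ** conj_transpose V"
  by (rule svd_maximal[OF strictly_decreasing_pos_rank_weights(1), of Z])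
    (simp add: singular_values_eq)

lemma sorted_nonneg_singular_values:
  "sorted_nonneg (singular_values (Z :: ('a::real_or_complex,'m,'n) mtx))"
  by (rule svd_maximal[OF strictly_decreasing_pos_rank_weights(1), of Z])
    (simp add: singular_values_eq)

text \<open>The singular vectors of \<open>X\<close> attain its weighted sum and are mere
  competitors for \<open>Y\<close>; Cauchy-Schwarz bounds what is left.\<close>

lemma weighted_singular_values_lipschitz:
  fixes X Y :: "('a::real_or_complex,'m,'n) mtx"
  assumes w: "strictly_decreasing_pos w"
  shows "w \<bullet> singular_values X - w \<bullet> singular_values Y \<le> norm w * norm (X - Y)"
proof -
  obtain U V b where U: "U \<in> unitary_matrices" "V \<in> unitary_matrices" "sorted_nonneg b"
    "X = U ** rect_diag b ** conj_transpose V"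
    by (rule svd_maximal[OF w, of X])
  obtain U' V' b' where Y: "U' \<in> unitary_matrices" "V' \<in> unitary_matrices" "sorted_nonneg b'"
    "Y = U' ** rect_diag b' ** conj_transpose V'"
    "\<And>P Q. P \<in> unitary_matrices \<Longrightarrow> Q \<in> unitary_matrices \<Longrightarrow> rect_diag w \<bullet> (P ** Y ** Q) \<le> w \<bullet> b'"
    by (rule svd_maximal[OF w, of Y]) blast
  have b: "singular_values X = b" "singular_values Y = b'"
    using U Y by (simp_all add: singular_values_eq)
  have "rect_diag b = conj_transpose U ** X ** V"
    using U by (simp add: unitary_cancel unitary_left flip: matrix_mul_assoc)
  then have "w \<bullet> b = rect_diag w \<bullet> (conj_transpose U ** X ** V)"
    by (metis inner_rect_diag_rect_diag)
  also have "\<dots> = rect_diag w \<bullet> (conj_transpose U ** Y ** V) + rect_diag w \<bullet> (conj_transpose U ** (X - Y) ** V)"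
    by (simp add: matrix_distribs inner_diff_right)
  also have "\<dots> \<le> w \<bullet> b' + norm w * norm (X - Y)"
  proof (rule add_mono)
    show "rect_diag w \<bullet> (conj_transpose U ** Y ** V) \<le> w \<bullet> b'" using U Y by simp
    have "rect_diag w \<bullet> (conj_transpose U ** (X - Y) ** V)
      \<le> norm (rect_diag w :: ('a,'m,'n) mtx) * norm (conj_transpose U ** (X - Y) ** V)"
      by (rule norm_cauchy_schwarz)
    then show "rect_diag w \<bullet> (conj_transpose U ** (X - Y) ** V) \<le> norm w * norm (X - Y)"
      using U by (simp add: norm_unitary_left norm_unitary_right)
  qed
  finally show ?thesis by (simp add: b)
qed

text \<open>The k-th singular value is twice the difference of the weighted sums for
  \<open>rank_weights + axis k (1/2)\<close> and for \<open>rank_weights\<close>; this is the origin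
  of \<open>d k\<close>.\<close>

lemma singular_values_lipschitz:
  obtains c where "c > 0"
    "\<And>X Y :: ('a::real_or_complex,'m,'n) mtx.
      norm (singular_values X - singular_values Y) \<le> c * norm (X - Y)"
proof -
  define d :: "'m \<Rightarrow> real" where
    "d k = 2 * (norm (rank_weights :: (real,'m) vec) + norm (rank_weights + axis k (1/2) :: (real,'m) vec))" for k
  have "singular_values X $ k - singular_values Y $ k \<le> d k * norm (X - Y)"
    for X Y :: "('a,'m,'n) mtx" and k
    using weighted_singular_values_lipschitz[OF strictly_decreasing_pos_rank_weights(2)[of k], of X Y]
      weighted_singular_values_lipschitz[OF strictly_decreasing_pos_rank_weights(1), of Y X]
    by (simp add: inner_add_left inner_axis' d_def norm_minus_commute[of Y X] algebra_simps)
  then have k: "\<bar>(singular_values X - singular_values Y) $ k\<bar> \<le> d k * norm (X - Y)"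
    for X Y :: "('a,'m,'n) mtx" and k
    by (metis abs_le_iff minus_diff_eq norm_minus_commute vector_minus_component)
  have "norm (singular_values X - singular_values Y) \<le> (\<Sum>k\<in>UNIV. d k) * norm (X - Y)"
    for X Y :: "('a,'m,'n) mtx"
  proof -
    have "norm (singular_values X - singular_values Y) \<le> (\<Sum>k\<in>UNIV. \<bar>(singular_values X - singular_values Y) $ k\<bar>)"
      by (rule norm_le_l1_cart)
    also have "\<dots> \<le> (\<Sum>k\<in>UNIV. d k * norm (X - Y))" by (intro sum_mono k)
    finally show ?thesis by (simp add: sum_distrib_right)
  qed
  moreover have "(\<Sum>k\<in>UNIV. d k) \<ge> 0" by (intro sum_nonneg) (simp add: d_def)
  ultimately show thesis using that[of "(\<Sum>k\<in>UNIV. d k) + 1"]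
    by (smt (verit) mult_right_mono norm_ge_zero)
qed

end

section \<open>Signed permutation equivariance\<close>

text \<open>Absolute symmetry localised to a point: images of a point of \<open>D\<close> under
  signed permutations need not lie in \<open>D\<close>.\<close>

definition signed_equivariant_at :: "(real^'m \<Rightarrow> real^'m) \<Rightarrow> real^'m \<Rightarrow> bool"
  where "signed_equivariant_at g x \<longleftrightarrow> (\<forall>\<epsilon> \<pi>. bij \<pi> \<longrightarrow> (\<forall>i. \<bar>\<epsilon> i\<bar> = 1) \<longrightarrow>
    g (\<chi> i. \<epsilon> i * x $ \<pi> i) = (\<chi> i. \<epsilon> i * g x $ \<pi> i))"

lemma signed_equivariant_atD:
  "signed_equivariant_at g x \<Longrightarrow> bij \<pi> \<Longrightarrow> (\<And>i. \<bar>\<epsilon> i\<bar> = 1) \<Longrightarrow>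
    g (\<chi> i. \<epsilon> i * x $ \<pi> i) = (\<chi> i. \<epsilon> i * g x $ \<pi> i)"
  by (auto simp: signed_equivariant_at_def)

lemma absolutely_symmetric_on_imp_equivariant:
  assumes "absolutely_symmetric_on D g" "x \<in> D"
  shows "signed_equivariant_at g x"
  unfolding signed_equivariant_at_def
  using assms signed_permutation_matrix_signed_perm
  unfolding absolutely_symmetric_on_def signed_perm_mult_vec[symmetric] by blast

text \<open>Signed permutations compose, so equivariance spreads along the whole orbit, even where
  the orbit leaves the symmetry set.\<close>

lemma signed_equivariant_at_signed_perm:
  fixes x :: "real^'m"
  assumes g: "signed_equivariant_at g x" and p: "bij \<pi>" "\<And>i. \<bar>\<epsilon> i\<bar> = 1"
  shows "signed_equivariant_at g (\<chi> i. \<epsilon> i * x $ \<pi> i)"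
  unfolding signed_equivariant_at_def
proof (intro allI impI)
  fix \<epsilon>' :: "'m \<Rightarrow> real" and \<pi>' :: "'m \<Rightarrow> 'm" assume p': "bij \<pi>'" "\<forall>i. \<bar>\<epsilon>' i\<bar> = 1"
  have "g (\<chi> i. (\<epsilon>' i * \<epsilon> (\<pi>' i)) * x $ (\<pi> \<circ> \<pi>') i) = (\<chi> i. (\<epsilon>' i * \<epsilon> (\<pi>' i)) * g x $ (\<pi> \<circ> \<pi>') i)"
    using p p' by (intro signed_equivariant_atD[OF g] bij_comp) (auto simp: abs_mult)
  then show "g (\<chi> i. \<epsilon>' i * (\<chi> i. \<epsilon> i * x $ \<pi> i) $ \<pi>' i) = (\<chi> i. \<epsilon>' i * g (\<chi> i. \<epsilon> i * x $ \<pi> i) $ \<pi>' i)"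
    by (simp add: signed_equivariant_atD[OF g p] mult.assoc)
qed

text \<open>For \<open>i = j\<close> and sign -1 this is the sign flip of one coordinate, so one
  notion covers equal coordinates and zero coordinates.\<close>

definition signed_swap :: "real \<Rightarrow> 'm \<Rightarrow> 'm \<Rightarrow> real^'m \<Rightarrow> real^'m"
  where "signed_swap \<epsilon> i j x =
    (\<chi> k. (if k = i \<or> k = j then \<epsilon> else 1) * x $ Transposition.transpose i j k)"

lemma signed_swap_nth:
  "signed_swap \<epsilon> i j x $ k = (if k = i then \<epsilon> * x $ j else if k = j then \<epsilon> * x $ i else x $ k)"
  by (auto simp: signed_swap_def Transposition.transpose_def)

lemma signed_equivariant_at_signed_swap:
  assumes "signed_equivariant_at g x" "\<bar>\<epsilon>\<bar> = 1"
  shows "g (signed_swap \<epsilon> i j x) = signed_swap \<epsilon> i j (g x)"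
  unfolding signed_swap_def using assms by (intro signed_equivariant_atD) auto

lemma signed_swap_fix:
  assumes "\<bar>\<epsilon>\<bar> = 1" "s $ i = \<epsilon> * s $ j"
  shows "signed_swap \<epsilon> i j s = s"
  using assms by (auto simp: vec_eq_iff signed_swap_nth abs_if split: if_splits)

lemma norm_signed_perm:
  fixes z :: "real^'m"
  assumes "bij \<pi>" "\<And>i. \<bar>\<epsilon> i\<bar> = 1"
  shows "norm (\<chi> i. \<epsilon> i * z $ \<pi> i) = norm z"
proof -
  have "(\<Sum>i\<in>UNIV. (\<epsilon> i * z $ \<pi> i)\<^sup>2) = (\<Sum>i\<in>UNIV. (z $ \<pi> i)\<^sup>2)"
  proof (rule sum.cong[OF refl])
    fix i
    have "(\<epsilon> i)\<^sup>2 = 1" using assms(2)[of i] by (metis power2_abs power_one)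
    then show "(\<epsilon> i * z $ \<pi> i)\<^sup>2 = (z $ \<pi> i)\<^sup>2" by (simp add: power_mult_distrib)
  qed
  also have "\<dots> = (\<Sum>i\<in>UNIV. (z $ i)\<^sup>2)" by (rule sum.reindex_bij_betw[OF assms(1)])
  finally show ?thesis by (simp add: norm_vec_def L2_set_def)
qed

lemma signed_swap_diff: "signed_swap \<epsilon> i j x - signed_swap \<epsilon> i j y = signed_swap \<epsilon> i j (x - y)"
  by (simp add: vec_eq_iff signed_swap_nth algebra_simps)

lemma norm_signed_swap: "\<bar>\<epsilon>\<bar> = 1 \<Longrightarrow> norm (signed_swap \<epsilon> i j x) = norm x"
  unfolding signed_swap_def by (intro norm_signed_perm) auto

lemma norm_signed_swap_defect:
  fixes x :: "real^'m"
  assumes "\<bar>\<epsilon>\<bar> = 1"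
  shows "norm (x - signed_swap \<epsilon> i j x) \<le> 2 * \<bar>x $ i - \<epsilon> * x $ j\<bar>"
proof -
  have eq: "\<bar>x $ j - \<epsilon> * x $ i\<bar> = \<bar>x $ i - \<epsilon> * x $ j\<bar>"
    using assms by (auto simp: abs_if split: if_splits)
  have "norm (x - signed_swap \<epsilon> i j x) \<le> (\<Sum>k\<in>UNIV. \<bar>(x - signed_swap \<epsilon> i j x) $ k\<bar>)"
    by (rule norm_le_l1_cart)
  also have "\<dots> = (\<Sum>k\<in>{i,j}. \<bar>(x - signed_swap \<epsilon> i j x) $ k\<bar>)"
    by (rule sum.mono_neutral_right) (auto simp: signed_swap_nth)
  also have "\<dots> \<le> 2 * \<bar>x $ i - \<epsilon> * x $ j\<bar>"
    using eq by (cases "i = j") (auto simp: signed_swap_nth)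
  finally show ?thesis .
qed

text \<open>A signed swap that fixes \<open>s\<close> must fix \<open>g s\<close>.\<close>

lemma signed_equivariant_at_compatible:
  assumes "signed_equivariant_at g s"
  shows "s $ i = s $ j \<Longrightarrow> g s $ i = g s $ j" "s $ i = 0 \<Longrightarrow> g s $ i = 0"
proof -
  show "g s $ i = g s $ j" if "s $ i = s $ j"
  proof -
    have "g s = signed_swap 1 i j (g s)"
      using signed_equivariant_at_signed_swap[OF assms, of 1 i j] signed_swap_fix[of 1 s i j] that by simp
    from arg_cong[OF this, of "\<lambda>z. z $ i"] show ?thesis by (simp add: signed_swap_nth)
  qed
  show "g s $ i = 0" if "s $ i = 0"
  proof -
    have "g s = signed_swap (-1) i i (g s)"
      using signed_equivariant_at_signed_swap[OF assms, of "-1" i i] signed_swap_fix[of "-1" s i i] that by simp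
    from arg_cong[OF this, of "\<lambda>z. z $ i"] show ?thesis by (simp add: signed_swap_nth)
  qed
qed

lemma finite_pos_lower_bound:
  assumes "finite A" "\<And>a::real. a \<in> A \<Longrightarrow> 0 < a"
  obtains \<eta> where "\<eta> > 0" "\<And>a. a \<in> A \<Longrightarrow> \<eta> \<le> a"
  using assms by (intro that[of "Min (insert 1 A)"]) auto

text \<open>
  If two coordinates of \<open>s\<close> agree up to the sign \<open>\<epsilon>\<close>, then swapping them maps a ball about \<open>s\<close> to
  itself, and the Lipschitz constant applies; otherwise they stay separated near \<open>s\<close>.
\<close>

lemma equivariant_lipschitz_coordinates:
  fixes s :: "real^'m"
  assumes W: "open W" "s \<in> W" and lip: "L-lipschitz_on W g"
    and eqv: "\<And>x. x \<in> W \<Longrightarrow> signed_equivariant_at g x"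
  obtains C r where "C \<ge> 0" "r > 0" "ball s r \<subseteq> W"
    "\<forall>x\<in>ball s r. \<forall>y\<in>ball s r. \<forall>i j. \<bar>g x $ i - g y $ j\<bar> \<le> C * \<bar>x $ i - y $ j\<bar> + C * norm (x - y)"
    "\<forall>x\<in>ball s r. \<forall>y\<in>ball s r. \<forall>i j. \<bar>g x $ i + g y $ j\<bar> \<le> C * \<bar>x $ i + y $ j\<bar> + C * norm (x - y)"
    "\<forall>x\<in>ball s r. \<forall>i. \<bar>g x $ i\<bar> \<le> C * \<bar>x $ i\<bar>"
proof -
  have L: "L \<ge> 0" using lip lipschitz_on_nonneg by blast
  obtain r0 where r0: "r0 > 0" "ball s r0 \<subseteq> W" using W openE by blast
  \<comment> \<open>The nonzero gaps between coordinates up to sign; there are finitely many, so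
    they have a positive lower bound.\<close>
  define A where "A = (\<lambda>(i,j,\<epsilon>). \<bar>s $ i - \<epsilon> * s $ j\<bar>) ` (UNIV \<times> UNIV \<times> {1,-1}) - {0}"
  obtain \<eta> where \<eta>: "\<eta> > 0" "\<And>a. a \<in> A \<Longrightarrow> \<eta> \<le> a"
    by (rule finite_pos_lower_bound[of A]) (auto simp: A_def)
  have \<eta>': "\<eta> \<le> \<bar>s $ i - \<epsilon> * s $ j\<bar>" if "\<bar>\<epsilon>\<bar> = 1" "s $ i \<noteq> \<epsilon> * s $ j" for i j \<epsilon>
  proof (rule \<eta>(2))
    have "\<epsilon> = 1 \<or> \<epsilon> = -1" using that(1) by (auto simp: abs_if split: if_splits)
    then show "\<bar>s $ i - \<epsilon> * s $ j\<bar> \<in> A" using that(2) unfolding A_def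
      by (auto intro!: image_eqI[of _ _ "(i,j,\<epsilon>)"])
  qed
  \<comment> \<open>Two coordinates moving by at most \<open>\<eta> / 4\<close> each leave a nonzero
    gap of at least \<open>\<eta> / 2\<close>.\<close>
  define r where "r = min r0 (\<eta> / 4)"
  have r: "r > 0" "r \<le> \<eta> / 4" "ball s r \<subseteq> W" using r0 \<eta>(1) by (auto simp: r_def)
  define M where "M = norm (g s) + L * r"
  have M: "\<bar>g x $ i\<bar> \<le> M" if "x \<in> ball s r" for x i
  proof -
    have "norm (g x - g s) \<le> L * dist x s"
      using lipschitz_onD[OF lip, of x s] that r W by (auto simp: dist_norm)
    also have "\<dots> \<le> L * r" using that L by (intro mult_left_mono) (auto simp: dist_commute)
    finally have "norm (g x) \<le> M" unfolding M_def
      using norm_triangle_ineq[of "g x - g s" "g s"] by simp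
    then show ?thesis using component_le_norm_cart[of "g x" i] by simp
  qed
  have M0: "M \<ge> 0" unfolding M_def using L r by simp
  \<comment> \<open>\<open>2 * L\<close> serves coordinates that agree at \<open>s\<close> (the 2 is
    the swap defect). \<open>4 * M / \<eta>\<close> serves separated ones: a numerator of at most
    \<open>2 * M\<close> against a gap of at least \<open>\<eta> / 2\<close>.\<close>
  define C0 where "C0 = 2 * L + 4 * M / \<eta>"
  have C0: "C0 \<ge> 0" using L M0 \<eta>(1) by (simp add: C0_def)
  have same: "\<bar>g x $ i - \<epsilon> * g x $ j\<bar> \<le> C0 * \<bar>x $ i - \<epsilon> * x $ j\<bar>"
    if x: "x \<in> ball s r" and \<epsilon>: "\<bar>\<epsilon>\<bar> = 1" for x \<epsilon> i j
  proof (cases "s $ i = \<epsilon> * s $ j")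
    case True
    have "signed_swap \<epsilon> i j x - s = signed_swap \<epsilon> i j (x - s)"
      using signed_swap_fix[OF \<epsilon> True] signed_swap_diff by metis
    then have "norm (signed_swap \<epsilon> i j x - s) = norm (x - s)" by (simp add: norm_signed_swap \<epsilon>)
    then have swap: "signed_swap \<epsilon> i j x \<in> ball s r" using x by (simp add: dist_norm norm_minus_commute)
    have "g (signed_swap \<epsilon> i j x) $ i = \<epsilon> * g x $ j"
      using signed_equivariant_at_signed_swap[OF eqv \<epsilon>, of x i j] x r by (auto simp: signed_swap_nth)
    then have "\<bar>g x $ i - \<epsilon> * g x $ j\<bar> \<le> norm (g x - g (signed_swap \<epsilon> i j x))"
      using component_le_norm_cart[of "g x - g (signed_swap \<epsilon> i j x)" i] by simp
    also have "\<dots> \<le> L * norm (x - signed_swap \<epsilon> i j x)"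
      using lipschitz_onD[OF lip subsetD[OF r(3) x] subsetD[OF r(3) swap]] by (simp add: dist_norm)
    also have "\<dots> \<le> L * (2 * \<bar>x $ i - \<epsilon> * x $ j\<bar>)"
      by (intro mult_left_mono norm_signed_swap_defect \<epsilon> L)
    also have "\<dots> \<le> C0 * \<bar>x $ i - \<epsilon> * x $ j\<bar>"
      using M0 \<eta>(1) by (simp add: C0_def distrib_right)
    finally show ?thesis .
  next
    case False
    have k: "\<bar>x $ k - s $ k\<bar> \<le> \<eta> / 4" for k
      using component_le_norm_cart[of "x - s" k] x r by (simp add: dist_norm norm_minus_commute)
    have "\<bar>\<epsilon> * x $ j - \<epsilon> * s $ j\<bar> \<le> \<eta> / 4"
      using k[of j] \<epsilon> by (simp add: abs_mult flip: right_diff_distrib)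
    then have "\<eta> / 2 \<le> \<bar>x $ i - \<epsilon> * x $ j\<bar>" using \<eta>'[OF \<epsilon> False] k[of i] by linarith
    then have "4 * M / \<eta> * (\<eta> / 2) \<le> 4 * M / \<eta> * \<bar>x $ i - \<epsilon> * x $ j\<bar>"
      using M0 \<eta>(1) by (intro mult_left_mono) auto
    also have "4 * M / \<eta> * (\<eta> / 2) = 2 * M" using \<eta>(1) by simp
    also have "4 * M / \<eta> * \<bar>x $ i - \<epsilon> * x $ j\<bar> \<le> C0 * \<bar>x $ i - \<epsilon> * x $ j\<bar>"
      using L by (intro mult_right_mono) (auto simp: C0_def)
    finally have "2 * M \<le> C0 * \<bar>x $ i - \<epsilon> * x $ j\<bar>" .
    moreover have "\<bar>\<epsilon> * g x $ j\<bar> \<le> M" using M[OF x, of j] \<epsilon> by (simp add: abs_mult)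
    ultimately show ?thesis using M[OF x, of i] by linarith
  qed
  have diff: "\<bar>g x $ i - \<epsilon> * g y $ j\<bar> \<le> (C0 + L) * \<bar>x $ i - \<epsilon> * y $ j\<bar> + (C0 + L) * norm (x - y)"
    if x: "x \<in> ball s r" and y: "y \<in> ball s r" and \<epsilon>: "\<bar>\<epsilon>\<bar> = 1" for x y \<epsilon> i j
  proof -
    have "\<bar>g x $ j - g y $ j\<bar> \<le> norm (g x - g y)"
      using component_le_norm_cart[of "g x - g y" j] by simp
    also have "\<dots> \<le> L * norm (x - y)"
      using lipschitz_onD[OF lip subsetD[OF r(3) x] subsetD[OF r(3) y]] by (simp add: dist_norm)
    finally have 1: "\<bar>\<epsilon> * g x $ j - \<epsilon> * g y $ j\<bar> \<le> L * norm (x - y)"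
      using \<epsilon> by (simp add: abs_mult flip: right_diff_distrib)
    have "\<bar>\<epsilon> * x $ j - \<epsilon> * y $ j\<bar> \<le> norm (x - y)"
      using \<epsilon> component_le_norm_cart[of "x - y" j] by (simp add: abs_mult flip: right_diff_distrib)
    then have "\<bar>x $ i - \<epsilon> * x $ j\<bar> \<le> \<bar>x $ i - \<epsilon> * y $ j\<bar> + norm (x - y)" by linarith
    then have "C0 * \<bar>x $ i - \<epsilon> * x $ j\<bar> \<le> C0 * \<bar>x $ i - \<epsilon> * y $ j\<bar> + C0 * norm (x - y)"
      using C0 by (metis distrib_left mult_left_mono)
    moreover have "0 \<le> L * \<bar>x $ i - \<epsilon> * y $ j\<bar>" using L by simp
    ultimately show ?thesis using 1 same[OF x \<epsilon>, of i j] by (simp add: distrib_right)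
  qed
  show thesis
  proof
    show "0 \<le> C0 + L" "r > 0" "ball s r \<subseteq> W" using C0 L r by auto
    show "\<forall>x\<in>ball s r. \<forall>i. \<bar>g x $ i\<bar> \<le> (C0 + L) * \<bar>x $ i\<bar>"
    proof (intro ballI allI)
      fix x i assume x: "x \<in> ball s r"
      \<comment> \<open>With sign -1 and equal indices, \<open>same\<close> compares twice the
        coordinate of \<open>g x\<close> with twice that of \<open>x\<close>.\<close>
      have "C0 * \<bar>x $ i\<bar> \<le> (C0 + L) * \<bar>x $ i\<bar>" using L by (intro mult_right_mono) auto
      then show "\<bar>g x $ i\<bar> \<le> (C0 + L) * \<bar>x $ i\<bar>" using same[OF x, of "-1" i i] by simp
    qed
    show "\<forall>x\<in>ball s r. \<forall>y\<in>ball s r. \<forall>i j. \<bar>g x $ i - g y $ j\<bar> \<le> (C0 + L) * \<bar>x $ i - y $ j\<bar> + (C0 + L) * norm (x - y)"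
      using diff[where \<epsilon>=1] by simp
    show "\<forall>x\<in>ball s r. \<forall>y\<in>ball s r. \<forall>i j. \<bar>g x $ i + g y $ j\<bar> \<le> (C0 + L) * \<bar>x $ i + y $ j\<bar> + (C0 + L) * norm (x - y)"
      using diff[where \<epsilon>="-1"] by simp
  qed
qed

section \<open>The spectral operator\<close>

context diag_embedding
begin

text \<open>The defect D_x Q - P D_y has a companion D_x^H P - Q D_y^H of equal norm, obtained by
  multiplying with P^H and Q^H and transposing. Together they give two relations between each entry
  of \<open>P\<close> and its counterpart in \<open>Q\<close>.\<close>

lemma diag_defect_entries:
  fixes P :: "('a::real_or_complex,'m,'m) mtx"
    and Q :: "('a::real_or_complex,'n,'n) mtx"
    and x y :: "(real,'m) vec"
  assumes P: "P \<in> unitary_matrices" and Q: "Q \<in> unitary_matrices"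
  defines "r \<equiv> norm (rect_diag x ** Q - P ** rect_diag y)"
  shows "norm (x $ i *\<^sub>R Q $ e i $ e j - y $ j *\<^sub>R P $ i $ j) \<le> r"
    and "norm (x $ i *\<^sub>R P $ i $ j - y $ j *\<^sub>R Q $ e i $ e j) \<le> r"
    and "l \<notin> range e \<Longrightarrow> norm (x $ i *\<^sub>R Q $ e i $ l) \<le> r"
    and "l \<notin> range e \<Longrightarrow> norm (y $ j *\<^sub>R Q $ l $ e j) \<le> r"
proof -
  define R where "R = rect_diag x ** Q - P ** rect_diag y"
  define S where "S = conj_transpose (rect_diag x) ** P - Q ** conj_transpose (rect_diag y)"
  have "S = conj_transpose (conj_transpose P ** (R ** conj_transpose Q))"
    using P Q by (simp add: R_def S_def matrix_distribs unitary_cancel unitary_left unitary_right flip: matrix_mul_assoc)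
  then have "norm S = r"
    using P Q by (simp add: norm_unitary_left norm_unitary_right r_def R_def)
  moreover have "norm R = r" by (simp add: R_def r_def)
  ultimately have le: "norm (R $ i $ l) \<le> r" "norm (S $ l $ i) \<le> r" for i l
    using norm_matrix_entry_le by metis+
  show "norm (x $ i *\<^sub>R Q $ e i $ e j - y $ j *\<^sub>R P $ i $ j) \<le> r"
    using le(1)[of i "e j"] by (simp add: R_def rect_diag_mult_nth scaleR_conv_of_real mult.commute)
  show "norm (x $ i *\<^sub>R P $ i $ j - y $ j *\<^sub>R Q $ e i $ e j) \<le> r"
    using le(2)[of "e i" j]
    by (simp add: S_def conj_rect_diag_mult_nth mult_conj_rect_diag_nth scaleR_conv_of_real mult.commute)
  show "norm (x $ i *\<^sub>R Q $ e i $ l) \<le> r" if "l \<notin> range e"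
    using le(1)[of i l] that
    by (simp add: R_def rect_diag_mult_nth mult_rect_diag_nth scaleR_conv_of_real)
  show "norm (y $ j *\<^sub>R Q $ l $ e j) \<le> r" if "l \<notin> range e"
    using le(2)[of l j] that
    by (simp add: S_def conj_rect_diag_mult_nth mult_conj_rect_diag_nth scaleR_conv_of_real mult.commute)
qed

text \<open>Unitary invariance turns the distance of two decompositions into an intertwining defect
  of their relative factors.\<close>

lemma norm_svd_diff:
  fixes U U' :: "('a::real_or_complex,'m,'m) mtx"
    and V V' :: "('a::real_or_complex,'n,'n) mtx"
  assumes "U \<in> unitary_matrices" "V \<in> unitary_matrices" "U' \<in> unitary_matrices" "V' \<in> unitary_matrices"
  shows "norm (U ** A ** conj_transpose V - U' ** B ** conj_transpose V')
    = norm (A ** (conj_transpose V ** V') - (conj_transpose U ** U') ** B)"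
proof -
  have "A ** (conj_transpose V ** V') - (conj_transpose U ** U') ** B
    = conj_transpose U ** ((U ** A ** conj_transpose V - U' ** B ** conj_transpose V') ** V')"
    using assms by (simp add: matrix_distribs unitary_cancel unitary_left flip: matrix_mul_assoc)
  then show ?thesis using assms by (simp add: norm_unitary_left norm_unitary_right)
qed

text \<open>
  With \<open>a\<close>, \<open>b\<close> matching entries of the two unitary factors,
  \<open>2 (u\<^sub>i a - v\<^sub>j b) = (u\<^sub>i - v\<^sub>j) (a + b) + (u\<^sub>i + v\<^sub>j) (a - b)\<close>.
\<close>

lemma svd_diff_le:
  fixes U U' :: "('a::real_or_complex,'m,'m) mtx"
    and V V' :: "('a::real_or_complex,'n,'n) mtx"
  assumes unit: "U \<in> unitary_matrices" "V \<in> unitary_matrices" "U' \<in> unitary_matrices" "V' \<in> unitary_matrices"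
    and C: "C \<ge> 0" and E: "E \<ge> 0"
    and minus: "\<And>i j. \<bar>u $ i - v $ j\<bar> \<le> C * \<bar>x $ i - y $ j\<bar> + E"
    and plus: "\<And>i j. \<bar>u $ i + v $ j\<bar> \<le> C * \<bar>x $ i + y $ j\<bar> + E"
    and single: "\<And>i. \<bar>u $ i\<bar> \<le> C * \<bar>x $ i\<bar> + E"
  shows "norm (U ** rect_diag u ** conj_transpose V - U' ** rect_diag v ** conj_transpose V')
    \<le> CARD('m) * CARD('n) * (2 * C * norm (U ** rect_diag x ** conj_transpose V - U' ** rect_diag y ** conj_transpose V') + 2 * E)"
proof -
  define P where "P = conj_transpose U ** U'"
  define Q where "Q = conj_transpose V ** V'"
  have P: "P \<in> unitary_matrices" and Q: "Q \<in> unitary_matrices"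
    unfolding P_def Q_def using unit by (simp_all add: unitary_mult)
  define r where "r = norm (rect_diag x ** Q - P ** rect_diag y)"
  have r: "r \<ge> 0" by (simp add: r_def)
  note entries = diag_defect_entries[OF P Q, where x=x and y=y, folded r_def]
  have "norm ((rect_diag u ** Q - P ** rect_diag v) $ i $ l) \<le> 2 * C * r + 2 * E" for i l
  proof (cases "l \<in> range e")
    case True
    then obtain j where l: "l = e j" by auto
    define a where "a = Q $ e i $ e j"
    define b where "b = P $ i $ j"
    have ab: "norm a \<le> 1" "norm b \<le> 1" using norm_unitary_entry_le P Q by (auto simp: a_def b_def)
    \<comment> \<open>Adding the two entry relations isolates a + b with factor x_i - y_j;
      subtracting them isolates a - b with factor x_i + y_j.\<close>
    have 1: "\<bar>x $ i - y $ j\<bar> * norm (a + b) \<le> 2 * r"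
    proof -
      have "(x $ i - y $ j) *\<^sub>R (a + b) = (x $ i *\<^sub>R a - y $ j *\<^sub>R b) + (x $ i *\<^sub>R b - y $ j *\<^sub>R a)"
        by (simp add: algebra_simps)
      then have "\<bar>x $ i - y $ j\<bar> * norm (a + b) = norm ((x $ i *\<^sub>R a - y $ j *\<^sub>R b) + (x $ i *\<^sub>R b - y $ j *\<^sub>R a))"
        by (metis norm_scaleR)
      also have "\<dots> \<le> r + r" unfolding a_def b_def by (intro norm_triangle_mono entries)
      finally show ?thesis by simp
    qed
    have 2: "\<bar>x $ i + y $ j\<bar> * norm (a - b) \<le> 2 * r"
    proof -
      have "(x $ i + y $ j) *\<^sub>R (a - b) = (x $ i *\<^sub>R a - y $ j *\<^sub>R b) - (x $ i *\<^sub>R b - y $ j *\<^sub>R a)"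
        by (simp add: algebra_simps)
      then have "\<bar>x $ i + y $ j\<bar> * norm (a - b) = norm ((x $ i *\<^sub>R a - y $ j *\<^sub>R b) - (x $ i *\<^sub>R b - y $ j *\<^sub>R a))"
        by (metis norm_scaleR)
      also have "\<dots> \<le> norm (x $ i *\<^sub>R a - y $ j *\<^sub>R b) + norm (x $ i *\<^sub>R b - y $ j *\<^sub>R a)" by (rule norm_triangle_ineq4)
      also have "\<dots> \<le> r + r" unfolding a_def b_def by (intro add_mono entries)
      finally show ?thesis by simp
    qed
    have ab2: "norm (a + b) \<le> 2" "norm (a - b) \<le> 2"
      using norm_triangle_ineq[of a b] norm_triangle_ineq4[of a b] ab by linarith+
    have "\<bar>u $ i - v $ j\<bar> * norm (a + b) \<le> (C * \<bar>x $ i - y $ j\<bar> + E) * norm (a + b)"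
      by (intro mult_right_mono minus) simp
    also have "\<dots> = C * (\<bar>x $ i - y $ j\<bar> * norm (a + b)) + E * norm (a + b)" by (simp add: algebra_simps)
    also have "\<dots> \<le> C * (2 * r) + E * 2" by (intro add_mono mult_left_mono 1 ab2 C E)
    finally have 3: "\<bar>u $ i - v $ j\<bar> * norm (a + b) \<le> C * (2 * r) + E * 2" .
    have "\<bar>u $ i + v $ j\<bar> * norm (a - b) \<le> (C * \<bar>x $ i + y $ j\<bar> + E) * norm (a - b)"
      by (intro mult_right_mono plus) simp
    also have "\<dots> = C * (\<bar>x $ i + y $ j\<bar> * norm (a - b)) + E * norm (a - b)" by (simp add: algebra_simps)
    also have "\<dots> \<le> C * (2 * r) + E * 2" by (intro add_mono mult_left_mono 2 ab2 C E)
    finally have 4: "\<bar>u $ i + v $ j\<bar> * norm (a - b) \<le> C * (2 * r) + E * 2" .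
    have "2 *\<^sub>R (u $ i *\<^sub>R a - v $ j *\<^sub>R b) = (u $ i - v $ j) *\<^sub>R (a + b) + (u $ i + v $ j) *\<^sub>R (a - b)"
      unfolding scaleR_2 by (simp add: scaleR_add_left scaleR_diff_left scaleR_add_right scaleR_diff_right)
    then have "2 * norm (u $ i *\<^sub>R a - v $ j *\<^sub>R b) = norm ((u $ i - v $ j) *\<^sub>R (a + b) + (u $ i + v $ j) *\<^sub>R (a - b))"
      by (metis abs_numeral norm_scaleR)
    also have "\<dots> \<le> \<bar>u $ i - v $ j\<bar> * norm (a + b) + \<bar>u $ i + v $ j\<bar> * norm (a - b)"
      by (rule norm_triangle_le) simp
    also have "\<dots> \<le> 2 * (2 * C * r + 2 * E)" using 3 4 by (simp add: algebra_simps)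
    finally have "norm (u $ i *\<^sub>R a - v $ j *\<^sub>R b) \<le> 2 * C * r + 2 * E" by simp
    then show ?thesis
      by (simp add: l rect_diag_mult_nth a_def b_def scaleR_conv_of_real mult.commute[of "P $ _ $ _"])
  next
    case False
    have "norm (Q $ e i $ l) \<le> 1" by (rule norm_unitary_entry_le[OF Q])
    have "\<bar>u $ i\<bar> * norm (Q $ e i $ l) \<le> (C * \<bar>x $ i\<bar> + E) * norm (Q $ e i $ l)"
      by (intro mult_right_mono single) simp
    also have "\<dots> = C * (\<bar>x $ i\<bar> * norm (Q $ e i $ l)) + E * norm (Q $ e i $ l)" by (simp add: algebra_simps)
    also have "\<dots> \<le> C * r + E * 1"
      using entries(3)[OF False, of i] by (intro add_mono mult_left_mono C E norm_unitary_entry_le[OF Q]) simp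
    also have "\<dots> \<le> 2 * C * r + 2 * E" using C E r by (simp add: mult_right_mono)
    finally show ?thesis using False
      by (simp add: rect_diag_mult_nth mult_rect_diag_nth norm_mult)
  qed
  then have "norm (rect_diag u ** Q - P ** rect_diag v) \<le> CARD('m) * CARD('n) * (2 * C * r + 2 * E)"
    by (rule norm_matrix_le_entries)
  then show ?thesis unfolding norm_svd_diff[OF unit] r_def P_def Q_def .
qed

section \<open>Well-definedness and local Lipschitz continuity of the spectral operator\<close>

lemma svd_pairsI:
  fixes U :: "('a::real_or_complex,'m,'m) mtx"
    and V :: "('a::real_or_complex,'n,'n) mtx"
  assumes "U \<in> unitary_matrices" "V \<in> unitary_matrices" "sorted_nonneg s"
  shows "(U, V) \<in> svd_pairs (U ** rect_diag s ** conj_transpose V)"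
  using assms by (simp add: svd_pairs_def singular_values_eq)

text \<open>Independence of the chosen singular vectors: \<open>svd_diff_le\<close> with zero error,
  applied to two decompositions of the same matrix, has right-hand side 0.\<close>

lemma spectral_operator_sorted:
  fixes U :: "('a::real_or_complex,'m,'m) mtx"
    and V :: "('a::real_or_complex,'n,'n) mtx"
  assumes U: "U \<in> unitary_matrices" and V: "V \<in> unitary_matrices" and s: "sorted_nonneg s"
    and g: "signed_equivariant_at g s"
  shows "spectral_operator g (U ** rect_diag s ** conj_transpose V) = U ** rect_diag (g s) ** conj_transpose V"
proof -
  define X where "X = U ** rect_diag s ** conj_transpose V"
  have sX: "singular_values X = s" unfolding X_def by (rule singular_values_eq[OF U V s])
  \<comment> \<open>Dominates all quotients of \<open>g s\<close> over \<open>s\<close>. Where a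
    denominator vanishes the quotient is 0 by convention, but there equivariance makes the numerator
    vanish too.\<close>
  define C where "C = (\<Sum>i\<in>UNIV. \<Sum>j\<in>UNIV. \<bar>g s $ i - g s $ j\<bar> / \<bar>s $ i - s $ j\<bar>
    + \<bar>g s $ i + g s $ j\<bar> / \<bar>s $ i + s $ j\<bar> + \<bar>g s $ i\<bar> / \<bar>s $ i\<bar>)"
  have "\<bar>g s $ i - g s $ j\<bar> / \<bar>s $ i - s $ j\<bar> + \<bar>g s $ i + g s $ j\<bar> / \<bar>s $ i + s $ j\<bar> + \<bar>g s $ i\<bar> / \<bar>s $ i\<bar> \<le> C"
    for i j
  proof -
    have "\<bar>g s $ i - g s $ j\<bar> / \<bar>s $ i - s $ j\<bar> + \<bar>g s $ i + g s $ j\<bar> / \<bar>s $ i + s $ j\<bar> + \<bar>g s $ i\<bar> / \<bar>s $ i\<bar>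
      \<le> (\<Sum>j\<in>UNIV. \<bar>g s $ i - g s $ j\<bar> / \<bar>s $ i - s $ j\<bar> + \<bar>g s $ i + g s $ j\<bar> / \<bar>s $ i + s $ j\<bar> + \<bar>g s $ i\<bar> / \<bar>s $ i\<bar>)"
      by (rule member_le_sum) auto
    also have "\<dots> \<le> C" unfolding C_def by (rule member_le_sum) (auto intro!: sum_nonneg)
    finally show ?thesis .
  qed
  note sum_le = this
  have nonneg: "0 \<le> \<bar>g s $ i - g s $ j\<bar> / \<bar>s $ i - s $ j\<bar>" "0 \<le> \<bar>g s $ i + g s $ j\<bar> / \<bar>s $ i + s $ j\<bar>"
     "0 \<le> \<bar>g s $ i\<bar> / \<bar>s $ i\<bar>" for i j by auto
  have quot: "\<bar>g s $ i - g s $ j\<bar> / \<bar>s $ i - s $ j\<bar> \<le> C" "\<bar>g s $ i + g s $ j\<bar> / \<bar>s $ i + s $ j\<bar> \<le> C"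
    "\<bar>g s $ i\<bar> / \<bar>s $ i\<bar> \<le> C" for i j
    using sum_le[of i j] nonneg(1,2)[of i j] nonneg(3)[of i] by linarith+
  have C: "C \<ge> 0" using quot(3) nonneg(3) order_trans by blast
  have C1: "\<bar>g s $ i - g s $ j\<bar> \<le> C * \<bar>s $ i - s $ j\<bar> + 0" for i j
    using quot(1)[of i j] signed_equivariant_at_compatible(1)[OF g, of i j]
    by (cases "s $ i = s $ j") (auto simp: divide_le_eq)
  have C3: "\<bar>g s $ i\<bar> \<le> C * \<bar>s $ i\<bar> + 0" for i
    using quot(3)[of i] signed_equivariant_at_compatible(2)[OF g, of i]
    by (cases "s $ i = 0") (auto simp: divide_le_eq)
  have C2: "\<bar>g s $ i + g s $ j\<bar> \<le> C * \<bar>s $ i + s $ j\<bar> + 0" for i j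
  proof (cases "s $ i + s $ j = 0")
    case True
    then have "s $ i = 0" "s $ j = 0" using s unfolding sorted_nonneg_def by (smt (verit))+
    then show ?thesis using signed_equivariant_at_compatible(2)[OF g] by simp
  next
    case False
    then show ?thesis using quot(2)[of i j] by (auto simp: divide_le_eq)
  qed
  have "\<exists>Y. \<exists>(U, V)\<in>svd_pairs X. Y = U ** rect_diag (g (singular_values X)) ** conj_transpose V"
    using svd_pairsI[OF U V s] by (auto simp: X_def)
  then have "\<exists>(U, V)\<in>svd_pairs X. spectral_operator g X = U ** rect_diag (g (singular_values X)) ** conj_transpose V"
    unfolding spectral_operator_def by (rule someI_ex)
  then obtain U' V' where UV': "U' \<in> unitary_matrices" "V' \<in> unitary_matrices"
    "X = U' ** rect_diag s ** conj_transpose V'"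
    "spectral_operator g X = U' ** rect_diag (g s) ** conj_transpose V'"
    by (auto simp: svd_pairs_def sX)
  have "norm (U ** rect_diag (g s) ** conj_transpose V - U' ** rect_diag (g s) ** conj_transpose V')
    \<le> CARD('m) * CARD('n) * (2 * C * norm (U ** rect_diag s ** conj_transpose V - U' ** rect_diag s ** conj_transpose V') + 2 * 0)"
    by (rule svd_diff_le[OF U V UV'(1,2) C order_refl C1 C2 C3])
  then show ?thesis using UV'(3,4) by (simp add: X_def)
qed

text \<open>A signed permutation sorting \<open>x\<close> moves into the unitary factors, and by
  equivariance the same factors undo it on \<open>g x\<close>. This allows diagonals to be varied
  freely near \<open>x\<close> without keeping them sorted.\<close>

lemma spectral_operator_rect_diag:
  fixes U :: "('a::real_or_complex,'m,'m) mtx"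
    and V :: "('a::real_or_complex,'n,'n) mtx"
  assumes U: "U \<in> unitary_matrices" and V: "V \<in> unitary_matrices" and g: "signed_equivariant_at g x"
  shows "spectral_operator g (U ** rect_diag x ** conj_transpose V) = U ** rect_diag (g x) ** conj_transpose V"
proof -
  obtain \<epsilon> :: "'m \<Rightarrow> real" and \<pi> :: "'m \<Rightarrow> 'm" where p: "bij \<pi>" "\<And>i. \<bar>\<epsilon> i\<bar> = 1" and s: "sorted_nonneg (\<chi> i. \<epsilon> i * x $ \<pi> i)"
    by (rule signed_sort_exists[of x]) blast
  obtain U0 :: "('a,'m,'m) mtx" 
      and V0 :: "('a,'n,'n) mtx"
      where UV0: "U0 \<in> unitary_matrices" "V0 \<in> unitary_matrices"
      and eq: "\<And>x. rect_diag (\<chi> i. \<epsilon> i * x $ \<pi> i) = U0 ** rect_diag x ** V0"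
    by (rule rect_diag_signed_perm[of \<pi> \<epsilon>, OF p(1)]) (use p(2) in blast)+
  have "U ** rect_diag z ** conj_transpose V
      = (U ** conj_transpose U0) ** rect_diag (\<chi> i. \<epsilon> i * z $ \<pi> i) ** conj_transpose (V ** V0)" for z
    using UV0 by (simp add: eq conj_transpose_mult unitary_cancel flip: matrix_mul_assoc)
  note conv = this
  have "spectral_operator g ((U ** conj_transpose U0) ** rect_diag (\<chi> i. \<epsilon> i * x $ \<pi> i) ** conj_transpose (V ** V0))
      = (U ** conj_transpose U0) ** rect_diag (g (\<chi> i. \<epsilon> i * x $ \<pi> i)) ** conj_transpose (V ** V0)"
    using U V UV0 by (intro spectral_operator_sorted unitary_mult s signed_equivariant_at_signed_perm[OF g p]) auto
  then show ?thesis
    by (simp only: signed_equivariant_atD[OF g p] conv[of x, symmetric] conv[of "g x", symmetric])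
qed

text \<open>The coordinate estimates for \<open>g\<close> feed \<open>svd_diff_le\<close>; its error
  term is a multiple of the distance of the singular values, itself Lipschitz in the
  matrices.\<close>

lemma spectral_operator_lipschitz_near:
  fixes X :: "('a::real_or_complex,'m,'n) mtx"
  assumes W: "open W" "singular_values X \<in> W" and lip: "L-lipschitz_on W g"
    and eqv: "\<And>x. x \<in> W \<Longrightarrow> signed_equivariant_at g x"
  shows "lipschitz_near (spectral_operator g) X"
proof -
  obtain C r where C: "C \<ge> 0" and r: "r > 0" and sub: "ball (singular_values X) r \<subseteq> W"
    and b: "\<forall>x\<in>ball (singular_values X) r. \<forall>y\<in>ball (singular_values X) r. \<forall>i j.
        \<bar>g x $ i - g y $ j\<bar> \<le> C * \<bar>x $ i - y $ j\<bar> + C * norm (x - y)"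
      "\<forall>x\<in>ball (singular_values X) r. \<forall>y\<in>ball (singular_values X) r. \<forall>i j.
        \<bar>g x $ i + g y $ j\<bar> \<le> C * \<bar>x $ i + y $ j\<bar> + C * norm (x - y)"
      "\<forall>x\<in>ball (singular_values X) r. \<forall>i. \<bar>g x $ i\<bar> \<le> C * \<bar>x $ i\<bar>"
    by (rule equivariant_lipschitz_coordinates[OF W lip eqv])
  obtain c where c: "c > 0"
    "\<And>X Y :: ('a,'m,'n) mtx. norm (singular_values X - singular_values Y) \<le> c * norm (X - Y)"
    by (rule singular_values_lipschitz) blast
  define K where "K = CARD('m) * CARD('n) * (2 * C + 2 * (C * c))"
  have near: "singular_values Y \<in> ball (singular_values X) r" if "Y \<in> ball X (r / c)" for Y :: "('a,'m,'n) mtx"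
  proof -
    have "norm (singular_values X - singular_values Y) \<le> c * norm (X - Y)" by (rule c)
    also have "\<dots> < r" using that c(1) by (simp add: dist_norm field_simps)
    finally show ?thesis by (simp add: dist_norm)
  qed
  have "K-lipschitz_on (ball X (r / c)) (spectral_operator g)"
  proof (rule lipschitz_onI)
    show "0 \<le> K" using C c by (simp add: K_def)
    fix Y Z :: "('a,'m,'n) mtx"
    assume YZ: "Y \<in> ball X (r / c)" "Z \<in> ball X (r / c)"
    define y where "y = singular_values Y"
    define z where "z = singular_values Z"
    have yz: "y \<in> ball (singular_values X) r" "z \<in> ball (singular_values X) r"
      using near YZ by (auto simp: y_def z_def)
    obtain U V where U: "U \<in> unitary_matrices" "V \<in> unitary_matrices" "Y = U ** rect_diag y ** conj_transpose V"
      unfolding y_def by (rule svd_exists)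
    obtain U' V' where U': "U' \<in> unitary_matrices" "V' \<in> unitary_matrices" "Z = U' ** rect_diag z ** conj_transpose V'"
      unfolding z_def by (rule svd_exists)
    have G: "spectral_operator g Y = U ** rect_diag (g y) ** conj_transpose V"
      "spectral_operator g Z = U' ** rect_diag (g z) ** conj_transpose V'"
      using U U' yz sub eqv spectral_operator_rect_diag by blast+
    have "norm (spectral_operator g Y - spectral_operator g Z)
      \<le> CARD('m) * CARD('n) * (2 * C * norm (Y - Z) + 2 * (C * norm (y - z)))"
      unfolding G unfolding U(3) U'(3)
      using b(1)[rule_format, OF yz] b(2)[rule_format, OF yz] b(3)[rule_format, OF yz(1)] C
      by (intro svd_diff_le U U') (auto intro: add_increasing2)
    also have "\<dots> \<le> CARD('m) * CARD('n) * (2 * C * norm (Y - Z) + 2 * (C * (c * norm (Y - Z))))"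
      unfolding y_def z_def by (intro mult_left_mono add_left_mono c C) auto
    also have "\<dots> = K * norm (Y - Z)" by (simp add: K_def algebra_simps)
    finally show "dist (spectral_operator g Y) (spectral_operator g Z) \<le> K * dist Y Z"
      by (simp add: dist_norm)
  qed
  then show ?thesis unfolding lipschitz_near_def
    using r c by (intro exI[of _ K] exI[of _ "ball X (r / c)"]) auto
qed

end

section \<open>Approximately intertwining unitary matrices\<close>

lemma square_diag_mult:
  "(rect_diag x :: 'a::real_or_complex^'m::{finite,linorder}^'m::{finite,linorder}) ** rect_diag y
    = (rect_diag (\<chi> i. x $ i * y $ i) :: 'a^'m::{finite,linorder}^'m::{finite,linorder})"
  by (simp add: vec_eq_iff diag_embedding.rect_diag_mult_nth[OF diag_embedding_id]
      diag_embedding.rect_diag_nth[OF diag_embedding_id])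

lemma conj_transpose_square_diag:
  "conj_transpose (rect_diag x :: 'a::real_or_complex^'m::{finite,linorder}^'m::{finite,linorder}) = rect_diag x"
  by (simp add: vec_eq_iff diag_embedding.rect_diag_nth[OF diag_embedding_id])

lemma square_diag_1: "(rect_diag 1 :: 'a::real_or_complex^'m::{finite,linorder}^'m::{finite,linorder}) = mat 1"
  by (simp add: vec_eq_iff diag_embedding.rect_diag_nth[OF diag_embedding_id] mat_def)

lemma norm_square_diag:
  "norm (rect_diag x :: 'a::real_or_complex^'m::{finite,linorder}^'m::{finite,linorder}) = norm x"
  by (rule diag_embedding.norm_rect_diag[OF diag_embedding_id])

text \<open>W X^H is the unitary polar factor. Distances reduce to singular values, where |b - 1|
  \<le> |b - 1| (b + 1) = |b^2 - 1|; a zero singular value would make the right side 1, above the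
  allowed 1/2.\<close>

lemma polar_near_isometry:
  fixes B :: "'a::real_or_complex^'m::{finite,linorder}^'m::{finite,linorder}"
  assumes small: "norm (conj_transpose B ** B - mat 1) \<le> 1/2"
  obtains W X b where "W \<in> unitary_matrices" "X \<in> unitary_matrices" "\<And>i. 0 < b $ i"
    "B = W ** rect_diag b ** conj_transpose X"
    "norm (B - W ** conj_transpose X) \<le> norm (conj_transpose B ** B - mat 1)"
proof -
  define b where "b = singular_values B"
  obtain W X where WX: "W \<in> unitary_matrices" "X \<in> unitary_matrices" "B = W ** rect_diag b ** conj_transpose X"
    unfolding b_def by (rule diag_embedding.svd_exists[OF diag_embedding_id])
  have b0: "0 \<le> b $ i" for i
    using diag_embedding.sorted_nonneg_singular_values[OF diag_embedding_id, of B] by (simp add: b_def sorted_nonneg_def)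
  define q :: "real^'m::{finite,linorder}" where "q = (\<chi> i. b $ i * b $ i - 1)"
  have "conj_transpose B ** B - mat 1 = X ** rect_diag q ** conj_transpose X"
  proof -
    have "conj_transpose B ** B = X ** rect_diag (\<chi> i. b $ i * b $ i) ** conj_transpose X"
      using WX by (simp add: conj_transpose_mult unitary_cancel conj_transpose_square_diag flip: matrix_mul_assoc square_diag_mult)
    moreover have "mat 1 = X ** rect_diag 1 ** conj_transpose X"
      using WX by (simp add: square_diag_1 unitary_right)
    moreover have "q = (\<chi> i. b $ i * b $ i) - 1" by (simp add: q_def vec_eq_iff)
    ultimately show ?thesis by (simp add: rect_diag_diff matrix_distribs)
  qed
  then have nq: "norm (conj_transpose B ** B - mat 1) = norm q"
    using WX by (simp add: norm_unitary_left norm_unitary_right norm_square_diag)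
  have "B - W ** conj_transpose X = W ** rect_diag (b - 1) ** conj_transpose X"
    by (simp add: WX(3) rect_diag_diff matrix_distribs square_diag_1)
  then have nb: "norm (B - W ** conj_transpose X) = norm (b - 1)"
    using WX by (simp add: norm_unitary_left norm_unitary_right norm_square_diag)
  have "norm (b - 1) \<le> norm q"
  proof (rule norm_le_componentwise_cart)
    fix i
    have "\<bar>b $ i - 1\<bar> * 1 \<le> \<bar>b $ i - 1\<bar> * (b $ i + 1)" using b0[of i] by (intro mult_left_mono) auto
    also have "\<dots> = \<bar>(b $ i - 1) * (b $ i + 1)\<bar>" using b0[of i] by (simp add: abs_mult)
    finally show "norm ((b - 1) $ i) \<le> norm (q $ i)" by (simp add: q_def algebra_simps)
  qed
  moreover have "0 < b $ i" for i
  proof (rule ccontr)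
    assume "\<not> 0 < b $ i"
    then have "\<bar>q $ i\<bar> = 1" using b0[of i] by (simp add: q_def)
    then show False using component_le_norm_cart[of q i] small nq by simp
  qed
  ultimately show thesis using that WX nb nq by metis
qed

text \<open>
  The unitary polar factor of \<open>B\<^sub>1\<close> is a function of \<open>B\<^sub>1\<close> and \<open>B\<^sub>1\<^sup>* B\<^sub>1\<close>, so it inherits
  the intertwining relation.
\<close>

lemma polar_intertwining:
  fixes B1 :: "'a::real_or_complex^'m::{finite,linorder}^'m::{finite,linorder}"
    and B2 :: "'a::real_or_complex^'n::{finite,linorder}^'n::{finite,linorder}"
    and S :: "'a::real_or_complex^'n::{finite,linorder}^'m::{finite,linorder}"
  assumes S: "B1 ** S = S ** B2" "conj_transpose B1 ** S = S ** conj_transpose B2"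
    and small: "norm (conj_transpose B1 ** B1 - mat 1) \<le> 1/2" "norm (conj_transpose B2 ** B2 - mat 1) \<le> 1/2"
  obtains P Q where "P \<in> unitary_matrices" "Q \<in> unitary_matrices" "P ** S = S ** Q"
    "norm (B1 - P) \<le> norm (conj_transpose B1 ** B1 - mat 1)"
    "norm (B2 - Q) \<le> norm (conj_transpose B2 ** B2 - mat 1)"
proof -
  obtain W X b where 1: "W \<in> unitary_matrices" "X \<in> unitary_matrices" "\<And>i. 0 < b $ i"
    "B1 = W ** rect_diag b ** conj_transpose X"
    "norm (B1 - W ** conj_transpose X) \<le> norm (conj_transpose B1 ** B1 - mat 1)"
    by (rule polar_near_isometry[OF small(1)]) blast
  obtain Y Z d where 2: "Y \<in> unitary_matrices" "Z \<in> unitary_matrices" "\<And>i. 0 < d $ i"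
    "B2 = Y ** rect_diag d ** conj_transpose Z"
    "norm (B2 - Y ** conj_transpose Z) \<le> norm (conj_transpose B2 ** B2 - mat 1)"
    by (rule polar_near_isometry[OF small(2)]) blast
  define M where "M = conj_transpose X ** S ** Z"
  have SM: "S ** Z = X ** M" "conj_transpose X ** S = M ** conj_transpose Z"
    using 1 2 by (simp_all add: M_def unitary_cancel unitary_right flip: matrix_mul_assoc)
  have "conj_transpose B1 ** B1 ** S = S ** conj_transpose B2 ** B2"
    by (metis S matrix_mul_assoc)
  then have "conj_transpose X ** (conj_transpose B1 ** B1 ** S) ** Z = conj_transpose X ** (S ** conj_transpose B2 ** B2) ** Z"
    by simp
  moreover have "conj_transpose X ** (conj_transpose B1 ** B1 ** S) ** Z = rect_diag (\<chi> i. b $ i * b $ i) ** M"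
    using 1 by (simp add: conj_transpose_mult unitary_cancel M_def conj_transpose_square_diag flip: matrix_mul_assoc square_diag_mult)
  moreover have "conj_transpose X ** (S ** conj_transpose B2 ** B2) ** Z = M ** rect_diag (\<chi> i. d $ i * d $ i)"
    using 2 by (simp add: conj_transpose_mult unitary_cancel unitary_left M_def conj_transpose_square_diag flip: matrix_mul_assoc square_diag_mult)
  ultimately have sq: "rect_diag (\<chi> i. b $ i * b $ i) ** M = M ** rect_diag (\<chi> i. d $ i * d $ i)" by simp
  note sqD = diag_embedding.rect_diag_mult_nth[OF diag_embedding_id] diag_embedding.mult_rect_diag_nth_e[OF diag_embedding_id]
  have "rect_diag b ** M = M ** (rect_diag d :: 'a^'n::{finite,linorder}^'n::{finite,linorder})"
    unfolding vec_eq_iff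
  proof (intro allI)
    fix i j
    have "M $ i $ j * of_real (b $ i * b $ i - d $ j * d $ j) = 0"
      using arg_cong[OF sq, of "\<lambda>A. A $ i $ j"] by (simp add: sqD algebra_simps)
    \<comment> \<open>\<open>M\<close> intertwines the squares of \<open>b\<close> and
      \<open>d\<close>. Since b_i + d_j > 0, a nonzero entry forces b_i = d_j, so it intertwines
      \<open>b\<close> and \<open>d\<close> as well.\<close>
    then have "M $ i $ j = 0 \<or> (b $ i - d $ j) * (b $ i + d $ j) = 0"
      unfolding mult_eq_0_iff of_real_eq_0_iff by (simp add: square_diff_square_factored mult.commute)
    moreover have "b $ i + d $ j \<noteq> 0" using 1(3)[of i] 2(3)[of j] by simp
    ultimately show "(rect_diag b ** M) $ i $ j = (M ** rect_diag d) $ i $ j" by (auto simp: sqD)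
  qed
  then have "W ** (M ** rect_diag d) ** conj_transpose Z = W ** (rect_diag b ** M) ** conj_transpose Z" by simp
  then have "W ** M ** rect_diag d ** conj_transpose Z = W ** rect_diag b ** (M ** conj_transpose Z)"
    by (simp only: matrix_mul_assoc[symmetric])
  also have "\<dots> = B1 ** S" by (simp add: 1(4) flip: SM(2) matrix_mul_assoc)
  also have "\<dots> = S ** Y ** rect_diag d ** conj_transpose Z" by (simp add: S(1) 2(4) matrix_mul_assoc)
  finally have "W ** M ** (rect_diag d :: 'a^'n::{finite,linorder}^'n::{finite,linorder}) ** conj_transpose Z ** Z = S ** Y ** rect_diag d ** conj_transpose Z ** Z"
    by simp
  then have eq: "W ** M ** (rect_diag d :: 'a^'n::{finite,linorder}^'n::{finite,linorder}) = S ** Y ** rect_diag d"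
    unfolding unitary_cancel(4)[OF 2(2)] .
  \<comment> \<open>The positive diagonal factor \<open>d\<close> cancels from the right.\<close>
  have "(W ** M) $ i $ j = (S ** Y) $ i $ j" for i j
    using arg_cong[OF eq, of "\<lambda>A. A $ i $ j"] 2(3)[of j] by (simp add: sqD)
  then have "W ** M = S ** Y" by (simp add: vec_eq_iff)
  then have "(W ** M) ** conj_transpose Z = (S ** Y) ** conj_transpose Z" by simp
  then have "(W ** conj_transpose X) ** S = S ** (Y ** conj_transpose Z)"
    by (simp only: matrix_mul_assoc[symmetric] SM(2))
  then show thesis
    by (intro that[OF _ _ _ 1(5) 2(5)] unitary_mult) (simp_all add: 1(1,2) 2(1,2))
qed

text \<open>Telescoping: B^H B - 1 = B^H (B - U) + (B - U)^H U.\<close>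

lemma near_unitary_defect:
  fixes U B :: "'a::real_or_complex^'m^'m"
  assumes U: "U \<in> unitary_matrices" and le: "norm (U - B) \<le> d" "d \<le> 1"
  shows "norm (conj_transpose B ** B - mat 1) \<le> d * (2 * norm (mat 1 :: 'a^'m^'m) + 1)"
proof -
  have U1: "norm U = norm (mat 1 :: 'a^'m^'m)" by (rule norm_unitary_eq[OF U unitary_mat_1])
  have B: "norm B \<le> norm U + d" using norm_triangle_ineq2[of B U] le by (simp add: norm_minus_commute)
  have d: "d \<ge> 0" using le(1) norm_ge_zero[of "U - B"] by linarith
  have "conj_transpose B ** B - mat 1 = conj_transpose B ** (B - U) + conj_transpose (B - U) ** U"
    using U by (simp add: matrix_distribs unitary_left)
  then have "norm (conj_transpose B ** B - mat 1) \<le> norm (conj_transpose B ** (B - U)) + norm (conj_transpose (B - U) ** U)"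
    by (simp only: norm_triangle_ineq)
  also have "\<dots> \<le> norm (conj_transpose B) * norm (B - U) + norm (conj_transpose (B - U)) * norm U"
    by (intro add_mono norm_matrix_mult_le)
  also have "\<dots> = norm (U - B) * (norm B + norm U)" by (simp add: norm_minus_commute algebra_simps)
  also have "\<dots> \<le> d * (2 * norm U + 1)" using B le d by (intro mult_mono) auto
  finally show ?thesis by (simp add: U1)
qed

section \<open>Rounding an approximate stabilizer to an exact one\<close>

context diag_embedding
begin

text \<open>
  Entries of \<open>U\<close> and \<open>V\<close> that link different values of \<open>s\<close> are small. Zeroing them, and copying the blocks
  of \<open>U\<close> with \<open>s > 0\<close> to \<open>V\<close>, gives an exactly intertwining, nearly unitary pair.
\<close>

lemma near_stabilizer:
  fixes s :: "(real,'m) vec"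
  assumes s: "\<And>i. 0 \<le> s $ i"
  obtains C \<delta> where "C \<ge> 0" "\<delta> > 0"
    "\<And>(U :: ('a::real_or_complex,'m,'m) mtx) (V :: ('a,'n,'n) mtx).
      U \<in> unitary_matrices \<Longrightarrow> V \<in> unitary_matrices \<Longrightarrow> norm (rect_diag s ** V - U ** rect_diag s) \<le> \<delta> \<Longrightarrow>
      \<exists>P\<in>unitary_matrices. \<exists>Q\<in>unitary_matrices. P ** rect_diag s = rect_diag s ** Q \<and>
        norm (U - P) \<le> C * norm (rect_diag s ** V - U ** rect_diag s) \<and>
        norm (V - Q) \<le> C * norm (rect_diag s ** V - U ** rect_diag s)"
proof -
  \<comment> \<open>Nonzero gaps and nonzero values of \<open>s\<close>: their lower bound lets a
    small weighted entry be divided by its weight.\<close>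
  define A where "A = (range (\<lambda>(i,j). \<bar>s $ i - s $ j\<bar>) \<union> range (\<lambda>i. s $ i)) - {0}"
  obtain \<eta> where \<eta>: "\<eta> > 0" "\<And>a. a \<in> A \<Longrightarrow> \<eta> \<le> a"
    using s by (rule_tac finite_pos_lower_bound[of A]) (auto simp: A_def less_le)
  have \<eta>d: "\<eta> \<le> \<bar>s $ i - s $ j\<bar>" if "s $ i \<noteq> s $ j" for i j
    by (rule \<eta>(2)) (use that in \<open>auto simp: A_def intro!: image_eqI[of _ _ "(i,j)"]\<close>)
  have \<eta>s: "\<eta> \<le> s $ i" if "s $ i \<noteq> 0" for i
    by (rule \<eta>(2)) (use that in \<open>auto simp: A_def\<close>)
  define c where "c = (real CARD('m) * CARD('m) + real CARD('n) * CARD('n)) * (2 / \<eta>)"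
  have c: "c \<ge> 0" using \<eta> by (simp add: c_def)
  define n1 where "n1 = norm (mat 1 :: ('a,'m,'m) mtx) + norm (mat 1 :: ('a,'n,'n) mtx)"
  define K where "K = c * (2 * n1 + 1)"
  have K: "K \<ge> 0" using c by (simp add: K_def n1_def)
  \<comment> \<open>\<open>c * r\<close> bounds the distance to the truncated matrices and
    \<open>K * r\<close> their failure to be unitary. The two terms ensure
    \<open>c * r \<le> 1\<close> for \<open>near_unitary_defect\<close> and
    \<open>K * r \<le> 1/2\<close> for the polar factors.\<close>
  define \<delta> where "\<delta> = min (1 / (c + 1)) (1 / (2 * (K + 1)))"
  have \<delta>: "\<delta> > 0" using c K by (simp add: \<delta>_def)
  show thesis
  proof (rule that[of "c + K" \<delta>])
    show "0 \<le> c + K" "\<delta> > 0" using c K \<delta> by auto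
    fix U :: "('a,'m,'m) mtx" and V :: "('a,'n,'n) mtx"
    assume U: "U \<in> unitary_matrices" and V: "V \<in> unitary_matrices"
      and le: "norm (rect_diag s ** V - U ** rect_diag s) \<le> \<delta>"
    define r where "r = norm (rect_diag s ** V - U ** rect_diag s)"
    have r: "r \<ge> 0" "r \<le> \<delta>" using le by (auto simp: r_def)
    have "c * r \<le> c * (1 / (c + 1))" using r c by (intro mult_left_mono) (auto simp: \<delta>_def)
    also have "\<dots> \<le> 1" using c by (simp add: divide_le_eq)
    finally have cr: "c * r \<le> 1" .
    have "K * r \<le> K * (1 / (2 * (K + 1)))" using r K by (intro mult_left_mono) (auto simp: \<delta>_def)
    also have "\<dots> \<le> 1/2" using K by (simp add: divide_le_eq)
    finally have Kr: "K * r \<le> 1/2" .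
    note entries = diag_defect_entries[OF U V, where x=s and y=s, folded r_def]
    have off: "norm (U $ i $ j) \<le> 2 / \<eta> * r" "norm (V $ e i $ e j) \<le> 2 / \<eta> * r" if "s $ i \<noteq> s $ j" for i j
    proof -
      define a where "a = V $ e i $ e j"
      define b where "b = U $ i $ j"
      have sum2: "norm (s $ i *\<^sub>R a - s $ j *\<^sub>R b) + norm (s $ i *\<^sub>R b - s $ j *\<^sub>R a) \<le> 2 * r"
        using entries(1)[of i j] entries(2)[of i j] by (simp add: a_def b_def)
      have "\<bar>s $ i - s $ j\<bar> * norm (a + b) = norm ((s $ i *\<^sub>R a - s $ j *\<^sub>R b) + (s $ i *\<^sub>R b - s $ j *\<^sub>R a))"
        unfolding norm_scaleR[symmetric]
        by (intro arg_cong[where f=norm]) (simp add: scaleR_diff_left scaleR_add_right)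
      also have "\<dots> \<le> 2 * r" using sum2 norm_triangle_ineq order_trans by blast
      finally have 1: "\<bar>s $ i - s $ j\<bar> * norm (a + b) \<le> 2 * r" .
      have "\<bar>s $ i + s $ j\<bar> * norm (a - b) = norm ((s $ i *\<^sub>R a - s $ j *\<^sub>R b) - (s $ i *\<^sub>R b - s $ j *\<^sub>R a))"
        unfolding norm_scaleR[symmetric]
        by (intro arg_cong[where f=norm]) (simp add: scaleR_add_left scaleR_diff_right)
      also have "\<dots> \<le> 2 * r" using sum2 norm_triangle_ineq4 order_trans by blast
      finally have 2: "\<bar>s $ i + s $ j\<bar> * norm (a - b) \<le> 2 * r" .
      have "\<eta> * norm (a + b) \<le> \<bar>s $ i - s $ j\<bar> * norm (a + b)" using \<eta>d[OF that] by (intro mult_right_mono) auto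
      moreover have "\<eta> * norm (a - b) \<le> \<bar>s $ i + s $ j\<bar> * norm (a - b)"
        using \<eta>d[OF that] s[of i] s[of j] by (intro mult_right_mono) auto
      ultimately have "\<eta> * norm (a + b) \<le> 2 * r" "\<eta> * norm (a - b) \<le> 2 * r" using 1 2 by linarith+
      then have ab: "norm (a + b) \<le> 2 / \<eta> * r" "norm (a - b) \<le> 2 / \<eta> * r" using \<eta> by (simp_all add: field_simps)
      have "norm ((a + b) + (a - b)) \<le> norm (a + b) + norm (a - b)" "norm ((a + b) - (a - b)) \<le> norm (a + b) + norm (a - b)"
        by (rule norm_triangle_ineq norm_triangle_ineq4)+
      moreover have "(a + b) + (a - b) = 2 *\<^sub>R a" "(a + b) - (a - b) = 2 *\<^sub>R b" by (simp_all add: scaleR_2)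
      ultimately have "2 * norm a \<le> norm (a + b) + norm (a - b)" "2 * norm b \<le> norm (a + b) + norm (a - b)"
        by simp_all
      then show "norm (U $ i $ j) \<le> 2 / \<eta> * r" "norm (V $ e i $ e j) \<le> 2 / \<eta> * r"
        using ab unfolding a_def b_def by linarith+
    qed
    have scale: "norm z \<le> 2 / \<eta> * r" if "norm (s $ i *\<^sub>R z) \<le> r" "s $ i \<noteq> 0" for z :: 'a and i
    proof -
      have "\<eta> * norm z \<le> s $ i * norm z" using \<eta>s[OF that(2)] by (intro mult_right_mono) auto
      also have "\<dots> \<le> 2 * r" using that(1) s[of i] r by simp
      finally show ?thesis using \<eta> by (simp add: field_simps)
    qed
    define B1 where "B1 = (\<chi> i j. if s $ i = s $ j then U $ i $ j else 0)"
    \<comment> \<open>Columns outside the range of \<open>e\<close> count as additional zero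
      singular values.\<close>
    define t where "t k = (if k \<in> range e then s $ inv e k else 0)" for k
    have te [simp]: "t (e i) = s $ i" for i by (simp add: t_def inj_e)
    have t0: "l \<notin> range e \<Longrightarrow> t l = 0" for l by (simp add: t_def)
    \<comment> \<open>Exact intertwining forces agreement with \<open>U\<close> on blocks of
      positive value. On the zero block the diagonal annihilates both factors, so the entries of
      \<open>V\<close> may be kept.\<close>
    define B2 where "B2 = (\<chi> k l. if t k = t l then (if t k > 0 then U $ inv e k $ inv e l else V $ k $ l) else 0)"
    have "norm ((U - B1) $ i $ j) \<le> 2 / \<eta> * r" for i j
      using off(1)[of i j] r \<eta> by (simp add: B1_def)
    then have "norm (U - B1) \<le> real CARD('m) * CARD('m) * (2 / \<eta> * r)"
      using norm_matrix_le_entries[of "U - B1" "2 / \<eta> * r"] by simp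
    also have "\<dots> \<le> c * r" using r \<eta> by (simp add: c_def field_simps)
    finally have UB: "norm (U - B1) \<le> c * r" .
    have "norm ((V - B2) $ k $ l) \<le> 2 / \<eta> * r" for k l
    proof -
      have nonneg: "0 \<le> 2 / \<eta> * r" using r \<eta> by simp
      consider i j where "k = e i" "l = e j" | i where "k = e i" "l \<notin> range e" | j where "l = e j" "k \<notin> range e"
        | "k \<notin> range e" "l \<notin> range e" by blast
      then show ?thesis
      proof cases
        case 1
        show ?thesis
        proof (cases "s $ i = s $ j \<and> s $ i \<noteq> 0")
          case True
          then have "norm (V $ e i $ e j - U $ i $ j) \<le> 2 / \<eta> * r"
            using entries(1)[of i j] by (intro scale[of i]) (auto simp: scaleR_diff_right)
          then show ?thesis using True s[of i] by (simp add: 1 B2_def inj_e less_le)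
        next
          case False
          then show ?thesis using off(2)[of i j] nonneg by (auto simp: 1 B2_def)
        qed
      next
        case 2
        then show ?thesis using entries(3)[of l i] scale[of i "V $ k $ l"] nonneg s[of i] by (auto simp: B2_def t0)
      next
        case 3
        then show ?thesis using entries(4)[of k j] scale[of j "V $ k $ l"] nonneg s[of j] by (auto simp: B2_def t0)
      next
        case 4
        then show ?thesis using nonneg by (simp add: B2_def t0)
      qed
    qed
    then have "norm (V - B2) \<le> real CARD('n) * CARD('n) * (2 / \<eta> * r)"
      using norm_matrix_le_entries[of "V - B2" "2 / \<eta> * r"] by simp
    also have "\<dots> \<le> c * r" using r \<eta> by (simp add: c_def field_simps)
    finally have VB: "norm (V - B2) \<le> c * r" .
    have "norm (conj_transpose B1 ** B1 - mat 1) \<le> c * r * (2 * norm (mat 1 :: ('a,'m,'m) mtx) + 1)"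
      by (rule near_unitary_defect[OF U UB cr])
    also have "\<dots> \<le> c * r * (2 * n1 + 1)" using c r by (intro mult_left_mono) (auto simp: n1_def)
    also have "\<dots> = K * r" by (simp add: K_def)
    finally have d1: "norm (conj_transpose B1 ** B1 - mat 1) \<le> K * r" .
    have "norm (conj_transpose B2 ** B2 - mat 1) \<le> c * r * (2 * norm (mat 1 :: ('a,'n,'n) mtx) + 1)"
      by (rule near_unitary_defect[OF V VB cr])
    also have "\<dots> \<le> c * r * (2 * n1 + 1)" using c r by (intro mult_left_mono) (auto simp: n1_def)
    also have "\<dots> = K * r" by (simp add: K_def)
    finally have d2: "norm (conj_transpose B2 ** B2 - mat 1) \<le> K * r" .
    have pos: "0 < s $ i \<longleftrightarrow> s $ i \<noteq> 0" for i using s[of i] by auto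
    have I1: "B1 ** rect_diag s = rect_diag s ** B2"
      unfolding vec_eq_iff
    proof (intro allI)
      fix i l show "(B1 ** rect_diag s) $ i $ l = (rect_diag s ** B2) $ i $ l"
        by (cases "l \<in> range e")
          (auto simp: mult_rect_diag_nth rect_diag_mult_nth B1_def B2_def inj_e pos t0 mult.commute)
    qed
    have I2: "conj_transpose B1 ** rect_diag s = rect_diag s ** conj_transpose B2"
      unfolding vec_eq_iff
    proof (intro allI)
      fix i l show "(conj_transpose B1 ** rect_diag s) $ i $ l = (rect_diag s ** conj_transpose B2) $ i $ l"
        by (cases "l \<in> range e")
          (auto simp: mult_rect_diag_nth rect_diag_mult_nth B1_def B2_def inj_e pos t0 mult.commute)
    qed
    obtain P Q where PQ: "P \<in> unitary_matrices" "Q \<in> unitary_matrices" "P ** rect_diag s = rect_diag s ** Q"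
      "norm (B1 - P) \<le> norm (conj_transpose B1 ** B1 - mat 1)"
      "norm (B2 - Q) \<le> norm (conj_transpose B2 ** B2 - mat 1)"
      by (rule polar_intertwining[OF I1 I2]) (use d1 d2 Kr in auto)
    have "norm (U - P) \<le> norm (U - B1) + norm (B1 - P)" using norm_triangle_ineq[of "U - B1" "B1 - P"] by simp
    then have "norm (U - P) \<le> (c + K) * r" using UB PQ(4) d1 by (simp add: distrib_right)
    moreover have "norm (V - Q) \<le> norm (V - B2) + norm (B2 - Q)" using norm_triangle_ineq[of "V - B2" "B2 - Q"] by simp
    then have "norm (V - Q) \<le> (c + K) * r" using VB PQ(5) d2 by (simp add: distrib_right)
    ultimately show "\<exists>P\<in>unitary_matrices. \<exists>Q\<in>unitary_matrices. P ** rect_diag s = rect_diag s ** Q \<and>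
        norm (U - P) \<le> (c + K) * norm (rect_diag s ** V - U ** rect_diag s) \<and>
        norm (V - Q) \<le> (c + K) * norm (rect_diag s ** V - U ** rect_diag s)"
      using PQ(1-3) unfolding r_def by blast
  qed
qed

end

section \<open>Second-order expansion of unitary orbits\<close>

text \<open>Removing the skew part from U - 1 leaves its Hermitian part, which for unitary
  \<open>U\<close> equals -1/2 (U - 1)(U - 1)^H and is therefore quadratic.\<close>

lemma skew_part_bound:
  fixes U :: "'a::real_or_complex^'m^'m"
  assumes U: "U \<in> unitary_matrices" and le: "norm (U - mat 1) \<le> d"
  defines "K \<equiv> (1/2) *\<^sub>R (U - conj_transpose U)"
  shows "conj_transpose K = - K" "norm K \<le> d" "norm (U - mat 1 - K) \<le> d\<^sup>2 / 2"
    "norm (conj_transpose U - mat 1 + K) \<le> d\<^sup>2 / 2"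
proof -
  show skew: "conj_transpose K = - K" by (simp add: K_def matrix_distribs scaleR_diff_right)
  have "K = (1/2) *\<^sub>R ((U - mat 1) - conj_transpose (U - mat 1))" by (simp add: K_def matrix_distribs)
  then have "norm K = norm ((U - mat 1) - conj_transpose (U - mat 1)) / 2" by simp
  also have "\<dots> \<le> (norm (U - mat 1) + norm (conj_transpose (U - mat 1))) / 2"
    by (intro divide_right_mono norm_triangle_ineq4) simp
  finally show "norm K \<le> d" using le by simp
  have "(U - mat 1) ** conj_transpose (U - mat 1) = 2 *\<^sub>R mat 1 - U - conj_transpose U"
    using U by (simp add: matrix_distribs unitary_right scaleR_2)
  moreover have "U - mat 1 - K = - (1/2) *\<^sub>R (2 *\<^sub>R mat 1 - U - conj_transpose U)"
  proof -
    have "U = (1/2) *\<^sub>R U + (1/2) *\<^sub>R U" by (simp flip: scaleR_add_left)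
    then show ?thesis by (simp add: K_def scaleR_diff_right)
  qed
  ultimately have eq: "U - mat 1 - K = - (1/2) *\<^sub>R ((U - mat 1) ** conj_transpose (U - mat 1))" by simp
  have "norm ((U - mat 1) ** conj_transpose (U - mat 1)) \<le> norm (U - mat 1) * norm (U - mat 1)"
    using norm_matrix_mult_le[of "U - mat 1" "conj_transpose (U - mat 1)"] by simp
  also have "\<dots> \<le> d * d" using le by (intro mult_mono) (auto intro: order_trans[OF norm_ge_zero])
  finally show n: "norm (U - mat 1 - K) \<le> d\<^sup>2 / 2" unfolding eq by (simp add: power2_eq_square)
  have "conj_transpose U - mat 1 + K = conj_transpose (U - mat 1 - K)" using skew by (simp add: matrix_distribs)
  then show "norm (conj_transpose U - mat 1 + K) \<le> d\<^sup>2 / 2" using n by simp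
qed

text \<open>The first-order term sits at \<open>M0\<close> instead of \<open>M\<close>: derivatives
  are known along the orbit of one diagonal, while the matrix being moved is a nearby one. The
  change of base point costs \<open>2 * d * norm (M - M0)\<close>.\<close>

lemma unitary_expansion:
  fixes U :: "'a::real_or_complex^'m^'m" and V :: "'a^'n^'n" and M M0 :: "'a^'n^'m"
  assumes U: "U \<in> unitary_matrices" "norm (U - mat 1) \<le> d" and V: "V \<in> unitary_matrices" "norm (V - mat 1) \<le> d"
  defines "K \<equiv> (1/2) *\<^sub>R (U - conj_transpose U)" and "L \<equiv> (1/2) *\<^sub>R (V - conj_transpose V)"
  shows "norm (U ** M ** conj_transpose V - M - (K ** M0 - M0 ** L)) \<le> 2 * d\<^sup>2 * norm M + 2 * d * norm (M - M0)"
proof -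
  note K = skew_part_bound[OF U, folded K_def] and L = skew_part_bound[OF V, folded L_def]
  have d: "d \<ge> 0" using U(2) norm_ge_zero[of "U - mat 1"] by linarith
  have "U ** M ** conj_transpose V - M - (K ** M0 - M0 ** L)
    = (U - mat 1 - K) ** M + M ** (conj_transpose V - mat 1 + L) + K ** (M - M0) + - ((M - M0) ** L)
      + (U - mat 1) ** M ** (conj_transpose V - mat 1)"
    by (simp add: matrix_distribs)
  moreover have "norm (a + b + c + d + f) \<le> norm a + norm b + norm c + norm d + norm f" for a b c d f :: "'a^'n^'m"
    by (intro norm_triangle_le add_right_mono order_refl)
  ultimately have "norm (U ** M ** conj_transpose V - M - (K ** M0 - M0 ** L))
    \<le> norm ((U - mat 1 - K) ** M) + norm (M ** (conj_transpose V - mat 1 + L)) + norm (K ** (M - M0)) + norm ((M - M0) ** L)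
      + norm ((U - mat 1) ** M ** (conj_transpose V - mat 1))"
    by (metis norm_minus_cancel)
  also have "\<dots> \<le> d\<^sup>2 / 2 * norm M + norm M * (d\<^sup>2 / 2) + d * norm (M - M0) + norm (M - M0) * d + d * norm M * d"
  proof (intro add_mono)
    show "norm ((U - mat 1 - K) ** M) \<le> d\<^sup>2 / 2 * norm M"
      by (intro norm_matrix_mult_le[THEN order_trans] mult_right_mono K) simp
    show "norm (M ** (conj_transpose V - mat 1 + L)) \<le> norm M * (d\<^sup>2 / 2)"
      by (intro norm_matrix_mult_le[THEN order_trans] mult_left_mono L) simp
    show "norm (K ** (M - M0)) \<le> d * norm (M - M0)"
      by (intro norm_matrix_mult_le[THEN order_trans] mult_right_mono K) simp
    show "norm ((M - M0) ** L) \<le> norm (M - M0) * d"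
      by (intro norm_matrix_mult_le[THEN order_trans] mult_left_mono L) simp
    have "conj_transpose V - mat 1 = conj_transpose (V - mat 1)" by (simp add: matrix_distribs)
    then have "norm (conj_transpose V - mat 1) \<le> d" using V by simp
    moreover have "norm ((U - mat 1) ** M) \<le> d * norm M"
      by (intro norm_matrix_mult_le[THEN order_trans] mult_right_mono U) simp
    ultimately have "norm ((U - mat 1) ** M) * norm (conj_transpose V - mat 1) \<le> d * norm M * d"
      using d by (intro mult_mono) auto
    then show "norm ((U - mat 1) ** M ** (conj_transpose V - mat 1)) \<le> d * norm M * d"
      using norm_matrix_mult_le order_trans by blast
  qed
  also have "\<dots> = 2 * d\<^sup>2 * norm M + 2 * d * norm (M - M0)" by (simp add: power2_eq_square algebra_simps)
  finally show ?thesis .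
qed

section \<open>Semismoothness at points of differentiability\<close>

text \<open>Keeps a derivative applied to a quadratic remainder quadratic, with a constant
  independent of the base point.\<close>

lemma has_derivative_norm_le_lipschitz:
  fixes F :: "'a::euclidean_space \<Rightarrow> 'b::euclidean_space"
  assumes W: "open W" "y \<in> W" and lip: "L-lipschitz_on W F" and der: "(F has_derivative A) (at y)"
  shows "norm (A h) \<le> L * norm h"
proof (rule field_le_epsilon)
  fix \<epsilon> :: real assume \<epsilon>: "\<epsilon> > 0"
  have h0: "norm h \<ge> 0" by simp
  have lin: "linear A" using der has_derivative_linear by blast
  define e where "e = \<epsilon> / (norm h + 1)"
  have e: "e > 0" using \<epsilon> by (simp add: e_def add_nonneg_pos)
  obtain d where d: "d > 0" "\<And>x. norm (x - y) < d \<Longrightarrow> norm (F x - F y - A (x - y)) \<le> e * norm (x - y)"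
    using der e unfolding has_derivative_at_alt by blast
  obtain r where r: "r > 0" "ball y r \<subseteq> W" using W openE by blast
  define t where "t = min d r / (norm h + 1)"
  have t: "t > 0" using d r by (simp add: t_def add_nonneg_pos)
  have "t * norm h < t * (norm h + 1)" using t by simp
  also have "\<dots> = min d r" using h0 add_nonneg_pos[OF h0 zero_less_one] by (simp add: t_def)
  finally have th: "norm (t *\<^sub>R h) < d" "norm (t *\<^sub>R h) < r" using t by auto
  have "norm (A (t *\<^sub>R h)) \<le> norm (F (y + t *\<^sub>R h) - F y) + norm (F (y + t *\<^sub>R h) - F y - A (t *\<^sub>R h))"
    using norm_triangle_sub[of "A (t *\<^sub>R h)" "F (y + t *\<^sub>R h) - F y"] by (simp add: norm_minus_commute)
  also have "\<dots> \<le> L * norm (t *\<^sub>R h) + e * norm (t *\<^sub>R h)"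
    using d(2)[of "y + t *\<^sub>R h"] th lipschitz_onD[OF lip, of "y + t *\<^sub>R h" y] r W
    by (intro add_mono) (auto simp: dist_norm subset_iff)
  finally have "t * norm (A h) \<le> t * ((L + e) * norm h)"
    using t lin by (simp add: linear_scale algebra_simps)
  then have "norm (A h) \<le> (L + e) * norm h" using t by simp
  moreover have "e * norm h \<le> \<epsilon>" using \<epsilon> h0 by (simp add: e_def divide_le_eq add_nonneg_pos)
  ultimately show "norm (A h) \<le> L * norm h + \<epsilon>" by (simp add: distrib_right)
qed

text \<open>
  The estimate is a convex and closed condition on the pair of the base point and the linear map, so it
  passes from derivatives to limits of derivatives and to their convex hull.
\<close>

lemma G_semismooth_at_iff:
  fixes F :: "'a::euclidean_space \<Rightarrow> 'b::euclidean_space"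
  assumes D: "open D" "z \<in> D" and lip: "lipschitz_near F z" and \<rho>: "\<rho> > 0"
  shows "G_semismooth_at D \<rho> F z \<longleftrightarrow>
    (\<exists>C. \<forall>\<^sub>F y in nhds z. \<forall>A. (F has_derivative A) (at y) \<longrightarrow>
      norm (F y - F z - A (y - z)) \<le> C * norm (y - z) powr (1 + \<rho>))"
proof
  assume "G_semismooth_at D \<rho> F z"
  then obtain S C where S: "open S" "z \<in> S"
    and C: "\<forall>\<^sub>F y in nhds z. \<forall>A\<in>clarke_jacobian S F y.
       norm (F y - F z - blinfun_apply A (y - z)) \<le> C * norm (y - z) powr (1 + \<rho>)"
    unfolding G_semismooth_at_def G_semismooth_on_def by blast
  have "\<forall>\<^sub>F y in nhds z. y \<in> S" using S eventually_nhds by blast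
  with C have "\<forall>\<^sub>F y in nhds z. \<forall>A. (F has_derivative A) (at y) \<longrightarrow>
      norm (F y - F z - A (y - z)) \<le> C * norm (y - z) powr (1 + \<rho>)"
  proof eventually_elim
    case (elim y)
    show ?case
    proof (intro allI impI)
      fix A assume der: "(F has_derivative A) (at y)"
      then have "bounded_linear A" by (rule has_derivative_bounded_linear)
      then have A: "blinfun_apply (Blinfun A) = A" by (rule bounded_linear_Blinfun_apply)
      \<comment> \<open>Constant sequences put a derivative at \<open>y\<close> into the
        B-subdifferential there.\<close>
      have "Blinfun A \<in> B_subdifferential S F y"
        unfolding B_subdifferential_def using elim(2) der
        by (auto simp: A intro!: exI[of _ "\<lambda>_. y"] exI[of _ "\<lambda>_. Blinfun A"])
      then have "Blinfun A \<in> clarke_jacobian S F y" unfolding clarke_jacobian_def by (rule hull_inc)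
      then show "norm (F y - F z - A (y - z)) \<le> C * norm (y - z) powr (1 + \<rho>)"
        using elim(1) A by metis
    qed
  qed
  then show "\<exists>C. \<forall>\<^sub>F y in nhds z. \<forall>A. (F has_derivative A) (at y) \<longrightarrow>
      norm (F y - F z - A (y - z)) \<le> C * norm (y - z) powr (1 + \<rho>)" by blast
next
  assume "\<exists>C. \<forall>\<^sub>F y in nhds z. \<forall>A. (F has_derivative A) (at y) \<longrightarrow>
      norm (F y - F z - A (y - z)) \<le> C * norm (y - z) powr (1 + \<rho>)"
  then obtain C T where T: "open T" "z \<in> T"
    and C: "\<And>y A. y \<in> T \<Longrightarrow> (F has_derivative A) (at y) \<Longrightarrow> norm (F y - F z - A (y - z)) \<le> C * norm (y - z) powr (1 + \<rho>)"
    unfolding eventually_nhds by blast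
  obtain L W where W: "open W" "z \<in> W" "L-lipschitz_on W F" using lip unfolding lipschitz_near_def by blast
  have cont: "isCont F y" if "y \<in> W" for y
    using lipschitz_on_continuous_on[OF W(3)] continuous_on_eq_continuous_at[OF W(1)] that by blast
  have main: "norm (F y - F z - blinfun_apply A (y - z)) \<le> C * norm (y - z) powr (1 + \<rho>)"
    if y: "y \<in> T \<inter> W" and A: "A \<in> clarke_jacobian (W \<inter> D) F y" for y A
  proof -
    define H where "H = (\<lambda>A. blinfun_apply A (y - z)) -` cball (F y - F z) (C * norm (y - z) powr (1 + \<rho>))"
    have "convex H" unfolding H_def
      by (intro convex_linear_vimage bounded_linear.linear blinfun.bounded_linear_left convex_cball)
    moreover have "B_subdifferential (W \<inter> D) F y \<subseteq> H"
    proof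
      fix A assume "A \<in> B_subdifferential (W \<inter> D) F y"
      then obtain x A' where x: "\<And>k. (F has_derivative blinfun_apply (A' k)) (at (x k))"
        "x \<longlonglongrightarrow> y" "A' \<longlonglongrightarrow> A"
        unfolding B_subdifferential_def by blast
      have "\<forall>\<^sub>F k in sequentially. x k \<in> T" using x(2) T(1) y by (auto intro: topological_tendstoD)
      then have ev: "\<forall>\<^sub>F k in sequentially. norm (F (x k) - F z - blinfun_apply (A' k) (x k - z)) \<le> C * norm (x k - z) powr (1 + \<rho>)"
        by eventually_elim (rule C[OF _ x(1)])
      have l1: "(\<lambda>k. norm (F (x k) - F z - blinfun_apply (A' k) (x k - z))) \<longlonglongrightarrow> norm (F y - F z - blinfun_apply A (y - z))"
        using y by (intro tendsto_intros x isCont_tendsto_compose[OF cont]) auto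
      have l2: "(\<lambda>k. C * norm (x k - z) powr (1 + \<rho>)) \<longlonglongrightarrow> C * norm (y - z) powr (1 + \<rho>)"
        using \<rho> by (intro tendsto_intros tendsto_powr' x) auto
      show "A \<in> H" using tendsto_le[OF _ l2 l1 ev] by (simp add: H_def dist_norm)
    qed
    ultimately have "clarke_jacobian (W \<inter> D) F y \<subseteq> H" unfolding clarke_jacobian_def by (simp add: subset_hull)
    then show ?thesis using A by (auto simp: H_def dist_norm)
  qed
  have "G_semismooth_on (W \<inter> D) \<rho> F z"
    unfolding G_semismooth_on_def
  proof (intro conjI exI[of _ C] ballI)
    show "open (W \<inter> D)" "z \<in> W \<inter> D" using W D by auto
    show "lipschitz_near F x" if "x \<in> W \<inter> D" for x using that W unfolding lipschitz_near_def by blast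
    have "\<forall>\<^sub>F y in nhds z. y \<in> T \<inter> W" using T W by (intro eventually_nhds_in_open) auto
    then show "\<forall>\<^sub>F y in nhds z. \<forall>A\<in>clarke_jacobian (W \<inter> D) F y.
       norm (F y - F z - blinfun_apply A (y - z)) \<le> C * norm (y - z) powr (1 + \<rho>)"
      by eventually_elim (use main in blast)
  qed
  then show "G_semismooth_at D \<rho> F z" unfolding G_semismooth_at_def by blast
qed

section \<open>Derivatives of the spectral operator\<close>

lemma bounded_linear_sandwich:
  fixes U :: "'a::real_or_complex^'m^'k" and V :: "'a^'l^'n"
  shows "bounded_linear (\<lambda>X. U ** X ** V)"
  by (intro bounded_linear_compose[OF bounded_bilinear.bounded_linear_left[OF bounded_bilinear_matrix_mult]]
      bounded_bilinear.bounded_linear_right[OF bounded_bilinear_matrix_mult])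

lemma bounded_linear_rect_diag:
  "bounded_linear (rect_diag :: real^'m::{finite,linorder} \<Rightarrow> 'a::real_or_complex^'n::{finite,linorder}^'m::{finite,linorder})"
  by (intro linear_conv_bounded_linear[THEN iffD1] linearI) (simp_all add: rect_diag_add rect_diag_scaleR)

lemma unitary_orbit_derivative:
  fixes U :: "'a::real_or_complex^'m^'m" and V :: "'a^'n^'n" and M :: "'a^'n^'m"
  assumes P: "(P has_vector_derivative K) (at 0)" "P 0 = mat 1"
    and Q: "(Q has_vector_derivative L) (at 0)" "Q 0 = mat 1" and skew: "conj_transpose L = - L"
  shows "((\<lambda>t. (U ** P t) ** M ** conj_transpose (V ** Q t)) has_vector_derivative U ** (K ** M - M ** L) ** conj_transpose V) (at 0)"
proof -
  have "((\<lambda>t. conj_transpose (V ** Q t)) has_vector_derivative conj_transpose (V ** L)) (at 0)"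
    by (intro bounded_linear.has_vector_derivative[OF bounded_linear_conj_transpose]
        bounded_linear.has_vector_derivative[OF bounded_bilinear.bounded_linear_right[OF bounded_bilinear_matrix_mult]] Q)
  moreover have "((\<lambda>t. (U ** P t) ** M) has_vector_derivative (U ** K) ** M) (at 0)"
    by (rule bounded_linear.has_vector_derivative[OF bounded_linear_compose[OF
        bounded_bilinear.bounded_linear_left[OF bounded_bilinear_matrix_mult] 
        bounded_bilinear.bounded_linear_right[OF bounded_bilinear_matrix_mult]] P(1)])
  ultimately have "((\<lambda>t. (U ** P t) ** M ** conj_transpose (V ** Q t)) has_vector_derivative
    (U ** P 0) ** M ** conj_transpose (V ** L) + (U ** K) ** M ** conj_transpose (V ** Q 0)) (at 0)"
    using bounded_bilinear.has_vector_derivative[OF bounded_bilinear_matrix_mult] by blast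
  moreover have "(U ** P 0) ** M ** conj_transpose (V ** L) + (U ** K) ** M ** conj_transpose (V ** Q 0)
    = U ** (K ** M - M ** L) ** conj_transpose V"
    by (simp add: P(2) Q(2) skew matrix_distribs matrix_mul_assoc)
  ultimately show ?thesis by simp
qed

context diag_embedding
begin

text \<open>A linear left inverse of \<open>rect_diag\<close>, for recovering \<open>g\<close> from
  \<open>G\<close> on diagonals.\<close>

definition diag_part :: "('a::real_or_complex,'m,'n) mtx \<Rightarrow> (real,'m) vec"
  where "diag_part M = (\<chi> i. 1 \<bullet> M $ i $ e i)"

lemma diag_part_rect_diag [simp]: "diag_part (rect_diag x :: ('a::real_or_complex,'m,'n) mtx) = x"
  by (simp add: diag_part_def vec_eq_iff rect_diag_nth)

lemma bounded_linear_diag_part: "bounded_linear (diag_part :: ('a::real_or_complex,'m,'n) mtx \<Rightarrow> _)"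
  by (intro linear_conv_bounded_linear[THEN iffD1] linearI) (simp_all add: diag_part_def vec_eq_iff inner_add_right)

text \<open>Near \<open>x\<close> the operator maps the slice of matrices U D_y V^H to itself and
  acts there as \<open>g\<close>. A linear left inverse of the slice embedding makes
  \<open>g\<close> differentiable at \<open>x\<close>, and uniqueness of derivatives keeps
  \<open>G'\<close> inside the slice.\<close>

lemma spectral_derivative_diag:
  fixes U :: "('a::real_or_complex,'m,'m) mtx"
    and V :: "('a,'n,'n) mtx"
  assumes U: "U \<in> unitary_matrices" and V: "V \<in> unitary_matrices"
    and W: "open W" "x \<in> W" "\<And>y. y \<in> W \<Longrightarrow> signed_equivariant_at g y"
    and der: "(spectral_operator g has_derivative G') (at (U ** rect_diag x ** conj_transpose V))"
  obtains A where "(g has_derivative A) (at x)"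
    "\<And>h. G' (U ** rect_diag h ** conj_transpose V) = U ** rect_diag (A h) ** conj_transpose V"
proof -
  define \<Phi> where "\<Phi> h = U ** rect_diag h ** conj_transpose V" for h
  have \<Phi>: "bounded_linear \<Phi>"
    unfolding \<Phi>_def by (rule bounded_linear_compose[OF bounded_linear_sandwich bounded_linear_rect_diag])
  define \<Psi> where "\<Psi> M = conj_transpose U ** M ** V" for M
  have \<Psi>: "bounded_linear \<Psi>" unfolding \<Psi>_def by (rule bounded_linear_sandwich)
  have \<Psi>\<Phi>: "\<Psi> (\<Phi> h) = rect_diag h" for h
    using U V by (simp add: \<Psi>_def \<Phi>_def unitary_cancel unitary_left flip: matrix_mul_assoc)
  have G: "spectral_operator g (\<Phi> y) = \<Phi> (g y)" if "y \<in> W" for y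
    unfolding \<Phi>_def by (rule spectral_operator_rect_diag[OF U V W(3)[OF that]])
  have "(spectral_operator g has_derivative G') (at (\<Phi> x))" using der by (simp add: \<Phi>_def)
  then have comp: "((\<lambda>y. spectral_operator g (\<Phi> y)) has_derivative (\<lambda>h. G' (\<Phi> h))) (at x)"
    using has_derivative_compose[OF bounded_linear_imp_has_derivative[OF \<Phi>]] by blast
  have "((\<lambda>y. \<Psi> (spectral_operator g (\<Phi> y))) has_derivative (\<lambda>h. \<Psi> (G' (\<Phi> h)))) (at x)"
    by (rule bounded_linear.has_derivative[OF \<Psi> comp])
  then have rd: "((\<lambda>y. rect_diag (g y)) has_derivative (\<lambda>h. \<Psi> (G' (\<Phi> h)))) (at x)"
    by (rule has_derivative_transform_within_open[OF _ W(1,2)]) (simp add: G \<Psi>\<Phi>)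
  define A where "A h = diag_part (\<Psi> (G' (\<Phi> h)))" for h
  have A: "(g has_derivative A) (at x)"
    using bounded_linear.has_derivative[OF bounded_linear_diag_part rd] unfolding A_def by simp
  have "(\<lambda>h. G' (\<Phi> h)) = (\<lambda>h. \<Phi> (A h))"
  proof (rule has_derivative_unique)
    show "((\<lambda>y. spectral_operator g (\<Phi> y)) has_derivative (\<lambda>h. G' (\<Phi> h))) (at x)" by (rule comp)
    have "((\<lambda>y. \<Phi> (g y)) has_derivative (\<lambda>h. \<Phi> (A h))) (at x)"
      by (rule bounded_linear.has_derivative[OF \<Phi> A])
    then show "((\<lambda>y. spectral_operator g (\<Phi> y)) has_derivative (\<lambda>h. \<Phi> (A h))) (at x)"
      by (rule has_derivative_transform_within_open[OF _ W(1,2)]) (simp add: G)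
  qed
  then show thesis using that[OF A] unfolding \<Phi>_def by metis
qed

text \<open>Moving the unitary factors along curves with velocities \<open>K\<close> and
  \<open>L\<close>, the value of \<open>G\<close> is the same orbit applied to D_(g x); compare
  velocities at 0.\<close>

lemma spectral_derivative_tangent:
  fixes U :: "('a::real_or_complex,'m,'m) mtx"
    and V :: "('a,'n,'n) mtx"
  assumes U: "U \<in> unitary_matrices" and V: "V \<in> unitary_matrices"
    and g: "signed_equivariant_at g x"
    and der: "(spectral_operator g has_derivative G') (at (U ** rect_diag x ** conj_transpose V))"
    and skew: "conj_transpose K = - K" "conj_transpose L = - L"
  shows "G' (U ** (K ** rect_diag x - rect_diag x ** L) ** conj_transpose V)
    = U ** (K ** rect_diag (g x) - rect_diag (g x) ** L) ** conj_transpose V"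
proof -
  obtain P where P: "\<And>t. P t \<in> unitary_matrices" "P 0 = mat 1" "(P has_vector_derivative K) (at 0)"
    using unitary_curve_through_skew[OF skew(1)] by blast
  obtain Q where Q: "\<And>t. Q t \<in> unitary_matrices" "Q 0 = mat 1" "(Q has_vector_derivative L) (at 0)"
    using unitary_curve_through_skew[OF skew(2)] by blast
  define \<gamma> where "\<gamma> z t = (U ** P t) ** rect_diag z ** conj_transpose (V ** Q t)" for z t
  have d: "(\<gamma> z has_vector_derivative U ** (K ** rect_diag z - rect_diag z ** L) ** conj_transpose V) (at 0)" for z
    unfolding \<gamma>_def by (rule unitary_orbit_derivative[OF P(3,2) Q(3,2) skew(2)])
  have "\<gamma> x 0 = U ** rect_diag x ** conj_transpose V" by (simp add: \<gamma>_def P Q)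
  then have "(spectral_operator g has_derivative G') (at (\<gamma> x 0) within range (\<gamma> x))"
    using der has_derivative_at_withinI by simp
  from vector_derivative_diff_chain_within[OF d this]
  have "(spectral_operator g \<circ> \<gamma> x has_vector_derivative G' (U ** (K ** rect_diag x - rect_diag x ** L) ** conj_transpose V)) (at 0)"
    by simp
  moreover have "spectral_operator g \<circ> \<gamma> x = \<gamma> (g x)"
    unfolding \<gamma>_def fun_eq_iff comp_def
    using spectral_operator_rect_diag[OF unitary_mult[OF U P(1)] unitary_mult[OF V Q(1)] g] by blast
  ultimately show ?thesis using d vector_derivative_unique_at by metis
qed

lemma spectral_semismooth_estimate:
  fixes Xbar :: "('a::real_or_complex,'m,'n) mtx"
  defines "s \<equiv> singular_values Xbar"
  assumes W: "open W" "s \<in> W" and lip: "L-lipschitz_on W g"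
    and eqv: "\<And>x. x \<in> W \<Longrightarrow> signed_equivariant_at g x"
    and \<rho>: "0 < \<rho>" "\<rho> \<le> 1"
    and est: "\<forall>\<^sub>F y in nhds s. \<forall>A. (g has_derivative A) (at y) \<longrightarrow>
      norm (g y - g s - A (y - s)) \<le> C0 * norm (y - s) powr (1 + \<rho>)"
  shows "\<exists>C. \<forall>\<^sub>F X in nhds Xbar. \<forall>G'. (spectral_operator g has_derivative G') (at X) \<longrightarrow>
      norm (spectral_operator g X - spectral_operator g Xbar - G' (X - Xbar)) \<le> C * norm (X - Xbar) powr (1 + \<rho>)"
proof -
  have L: "L \<ge> 0" using lip lipschitz_on_nonneg by blast
  obtain c where c: "c > 0"
    "\<forall>X Y :: ('a,'m,'n) mtx. norm (singular_values X - singular_values Y) \<le> c * norm (X - Y)"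
    by (rule singular_values_lipschitz) blast
  have s0: "0 \<le> s $ i" for i using sorted_nonneg_singular_values[of Xbar] by (simp add: s_def sorted_nonneg_def)
  obtain C1 \<delta> where C1: "C1 \<ge> 0" and \<delta>: "\<delta> > 0" and stab: "\<And>(U :: ('a,'m,'m) mtx) (V :: ('a,'n,'n) mtx).
      U \<in> unitary_matrices \<Longrightarrow> V \<in> unitary_matrices \<Longrightarrow> norm (rect_diag s ** V - U ** rect_diag s) \<le> \<delta> \<Longrightarrow>
      \<exists>P\<in>unitary_matrices. \<exists>Q\<in>unitary_matrices. P ** rect_diag s = rect_diag s ** Q \<and>
        norm (U - P) \<le> C1 * norm (rect_diag s ** V - U ** rect_diag s) \<and>
        norm (V - Q) \<le> C1 * norm (rect_diag s ** V - U ** rect_diag s)"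
    by (rule near_stabilizer[where ?'a='a, OF s0]) blast
  obtain LG W' where W': "open W'" "Xbar \<in> W'" "LG-lipschitz_on W' (spectral_operator g)"
    using spectral_operator_lipschitz_near[OF W(1) W(2)[unfolded s_def] lip eqv] unfolding lipschitz_near_def by blast
  have LG: "LG \<ge> 0" using W' lipschitz_on_nonneg by blast
  obtain T where T: "open T" "s \<in> T" "\<And>y A. y \<in> T \<Longrightarrow> (g has_derivative A) (at y) \<Longrightarrow>
      norm (g y - g s - A (y - s)) \<le> C0 * norm (y - s) powr (1 + \<rho>)"
    using est unfolding eventually_nhds by blast
  obtain U0 V0 where UV0: "U0 \<in> unitary_matrices" "V0 \<in> unitary_matrices" "Xbar = U0 ** rect_diag s ** conj_transpose V0"
    unfolding s_def by (rule svd_exists)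
  define k where "k = C1 * (1 + c)"
  have k: "k \<ge> 0" using C1 c by (simp add: k_def)
  \<comment> \<open>The summands account for the linearisation error of \<open>g\<close>, for the
    remainder \<open>R2\<close> of the values, and for \<open>G'\<close> applied to the remainder
    \<open>R1\<close> of the arguments.\<close>
  define C where "C = \<bar>C0\<bar> * c powr (1 + \<rho>) + (2 * k\<^sup>2 * norm (g s) + 2 * k * (L * c)) + LG * (2 * k\<^sup>2 * norm s + 2 * k * c)"
  have main: "norm (spectral_operator g X - spectral_operator g Xbar - G' (X - Xbar)) \<le> C * norm (X - Xbar) powr (1 + \<rho>)"
    if X: "X \<in> W'" "singular_values X \<in> T \<inter> W" and small: "norm (X - Xbar) \<le> 1" "(1 + c) * norm (X - Xbar) \<le> \<delta>"
      and der: "(spectral_operator g has_derivative G') (at X)" for X G'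
  proof -
    define x where "x = singular_values X"
    define \<epsilon> where "\<epsilon> = norm (X - Xbar)"
    have \<epsilon>: "\<epsilon> \<ge> 0" "\<epsilon> \<le> 1" using small by (auto simp: \<epsilon>_def)
    have xW: "x \<in> W" and xT: "x \<in> T" using X by (auto simp: x_def)
    have xs: "norm (x - s) \<le> c * \<epsilon>" using c(2) by (simp add: x_def s_def \<epsilon>_def)
    obtain U V where UV: "U \<in> unitary_matrices" "V \<in> unitary_matrices" "X = U ** rect_diag x ** conj_transpose V"
      unfolding x_def by (rule svd_exists)
    \<comment> \<open>The defect of the relative singular vectors equals the distance from
      \<open>Xbar\<close> to U D_s V^H, which is controlled by the movement of the matrix and of its
      singular values.\<close>
    define r where "r = norm (rect_diag s ** (conj_transpose V0 ** V) - (conj_transpose U0 ** U) ** rect_diag s)"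
    have "r = norm (Xbar - U ** rect_diag s ** conj_transpose V)"
      unfolding r_def UV0(3) by (rule norm_svd_diff[OF UV0(1,2) UV(1,2), symmetric])
    also have "Xbar - U ** rect_diag s ** conj_transpose V = (Xbar - X) + U ** rect_diag (x - s) ** conj_transpose V"
      by (simp add: UV(3) rect_diag_diff matrix_distribs)
    also have "norm \<dots> \<le> norm (Xbar - X) + norm (x - s)"
      using UV by (intro norm_triangle_le) (simp add: norm_unitary_left norm_unitary_right)
    also have "\<dots> \<le> (1 + c) * \<epsilon>" using xs by (simp add: \<epsilon>_def norm_minus_commute distrib_right)
    finally have r: "r \<le> (1 + c) * \<epsilon>" .
    then have "r \<le> \<delta>" using small by (simp add: \<epsilon>_def)
    then obtain P Q where PQ: "P \<in> unitary_matrices" "Q \<in> unitary_matrices" "P ** rect_diag s = rect_diag s ** Q"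
      "norm (conj_transpose U0 ** U - P) \<le> C1 * r" "norm (conj_transpose V0 ** V - Q) \<le> C1 * r"
      using stab[of "conj_transpose U0 ** U" "conj_transpose V0 ** V"] UV0 UV unfolding r_def by (auto simp: unitary_mult)
    define d where "d = k * \<epsilon>"
    have d: "d \<ge> 0" using k \<epsilon> by (simp add: d_def)
    have rd: "C1 * r \<le> d" using mult_left_mono[OF r C1] by (simp add: d_def k_def mult.assoc)
    \<comment> \<open>U U1 = U0 P and V V1 = V0 Q: rotating the singular vectors of
      \<open>Xbar\<close> by the stabilizer pair leaves \<open>Xbar\<close> unchanged and brings
      them within \<open>d\<close> of those of \<open>X\<close>.\<close>
    define U1 where "U1 = conj_transpose U ** U0 ** P"
    define V1 where "V1 = conj_transpose V ** V0 ** Q"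
    have U1: "U1 \<in> unitary_matrices" "norm (U1 - mat 1) \<le> d"
    proof -
      show "U1 \<in> unitary_matrices" using UV UV0 PQ by (simp add: U1_def unitary_mult)
      have "U1 - mat 1 = conj_transpose U ** (U0 ** (P - conj_transpose U0 ** U))"
        using UV UV0 by (simp add: U1_def matrix_distribs unitary_cancel unitary_left flip: matrix_mul_assoc)
      then show "norm (U1 - mat 1) \<le> d"
        using UV UV0 PQ(4) rd by (simp add: norm_unitary_left norm_minus_commute)
    qed
    have V1: "V1 \<in> unitary_matrices" "norm (V1 - mat 1) \<le> d"
    proof -
      show "V1 \<in> unitary_matrices" using UV UV0 PQ by (simp add: V1_def unitary_mult)
      have "V1 - mat 1 = conj_transpose V ** (V0 ** (Q - conj_transpose V0 ** V))"
        using UV UV0 by (simp add: V1_def matrix_distribs unitary_cancel unitary_left flip: matrix_mul_assoc)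
      then show "norm (V1 - mat 1) \<le> d"
        using UV UV0 PQ(5) rd by (simp add: norm_unitary_left norm_minus_commute)
    qed
    have UU: "U ** U1 = U0 ** P" "V ** V1 = V0 ** Q"
      using UV by (simp_all add: U1_def V1_def unitary_cancel flip: matrix_mul_assoc)
    have "U0 ** P ** rect_diag s ** conj_transpose (V0 ** Q) = U0 ** (P ** rect_diag s) ** conj_transpose Q ** conj_transpose V0"
      by (simp add: conj_transpose_mult matrix_mul_assoc)
    also have "\<dots> = Xbar" unfolding PQ(3) using PQ(2) by (simp add: UV0(3) unitary_right flip: matrix_mul_assoc)
    finally have Xbar: "Xbar = (U ** U1) ** rect_diag s ** conj_transpose (V ** V1)" unfolding UU by simp
    have GXbar: "spectral_operator g Xbar = (U ** U1) ** rect_diag (g s) ** conj_transpose (V ** V1)"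
      unfolding Xbar using UV U1 V1 W by (intro spectral_operator_rect_diag unitary_mult eqv) auto
    have GX: "spectral_operator g X = U ** rect_diag (g x) ** conj_transpose V"
      unfolding UV(3) using UV xW by (intro spectral_operator_rect_diag eqv)
    define K where "K = (1/2) *\<^sub>R (U1 - conj_transpose U1)"
    define M where "M = (1/2) *\<^sub>R (V1 - conj_transpose V1)"
    have skew: "conj_transpose K = - K" "conj_transpose M = - M"
      using skew_part_bound(1)[OF U1] skew_part_bound(1)[OF V1] by (simp_all add: K_def M_def)
    \<comment> \<open>The tangent terms are based at \<open>x\<close>, where \<open>G'\<close> is
      known. After subtracting these remainders, both X - Xbar and the increment of \<open>G\<close>
      consist of a diagonal and a tangent part matched by \<open>G'\<close>.\<close>
    define R1 where "R1 = U1 ** rect_diag s ** conj_transpose V1 - rect_diag s - (K ** rect_diag x - rect_diag x ** M)"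
    define R2 where "R2 = U1 ** rect_diag (g s) ** conj_transpose V1 - rect_diag (g s) - (K ** rect_diag (g x) - rect_diag (g x) ** M)"
    have R1: "norm R1 \<le> 2 * d\<^sup>2 * norm s + 2 * d * norm (s - x)"
      using unitary_expansion[OF U1 V1, of "rect_diag s" "rect_diag x"]
      by (simp add: R1_def K_def M_def flip: rect_diag_diff)
    have R2: "norm R2 \<le> 2 * d\<^sup>2 * norm (g s) + 2 * d * norm (g s - g x)"
      using unitary_expansion[OF U1 V1, of "rect_diag (g s)" "rect_diag (g x)"]
      by (simp add: R2_def K_def M_def flip: rect_diag_diff)
    obtain A where A: "(g has_derivative A) (at x)"
      "\<forall>h. G' (U ** rect_diag h ** conj_transpose V) = U ** rect_diag (A h) ** conj_transpose V"
      by (rule spectral_derivative_diag[OF UV(1,2) W(1) xW eqv der[unfolded UV(3)]]) blast+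
    have tangent: "G' (U ** (K ** rect_diag x - rect_diag x ** M) ** conj_transpose V)
      = U ** (K ** rect_diag (g x) - rect_diag (g x) ** M) ** conj_transpose V"
      by (rule spectral_derivative_tangent[OF UV(1,2) eqv[OF xW] der[unfolded UV(3)] skew])
    have lin: "linear G'" using der has_derivative_linear by blast
    have "X - Xbar = U ** rect_diag (x - s) ** conj_transpose V
        - U ** (K ** rect_diag x - rect_diag x ** M) ** conj_transpose V - U ** R1 ** conj_transpose V"
      by (simp add: UV(3) Xbar R1_def rect_diag_diff matrix_distribs matrix_mul_assoc)
    then have G'X: "G' (X - Xbar) = U ** rect_diag (A (x - s)) ** conj_transpose V
        - U ** (K ** rect_diag (g x) - rect_diag (g x) ** M) ** conj_transpose V - G' (U ** R1 ** conj_transpose V)"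
      by (simp only: linear_diff[OF lin] A(2)[rule_format] tangent)
    have "spectral_operator g X - spectral_operator g Xbar = U ** rect_diag (g x - g s) ** conj_transpose V
        - U ** (K ** rect_diag (g x) - rect_diag (g x) ** M) ** conj_transpose V - U ** R2 ** conj_transpose V"
      by (simp add: GX GXbar R2_def rect_diag_diff matrix_distribs matrix_mul_assoc)
    then have "spectral_operator g X - spectral_operator g Xbar - G' (X - Xbar)
      = U ** rect_diag (g x - g s - A (x - s)) ** conj_transpose V - U ** R2 ** conj_transpose V + G' (U ** R1 ** conj_transpose V)"
      by (simp add: G'X rect_diag_diff matrix_distribs)
    also have "norm \<dots> \<le> norm (U ** rect_diag (g x - g s - A (x - s)) ** conj_transpose V) + norm (U ** R2 ** conj_transpose V)
        + norm (G' (U ** R1 ** conj_transpose V))"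
      by (intro norm_triangle_le add_right_mono norm_triangle_ineq4)
    also have "\<dots> \<le> norm (g x - g s - A (x - s)) + norm R2 + LG * norm R1"
      using has_derivative_norm_le_lipschitz[OF W'(1) X(1) W'(3) der, of "U ** R1 ** conj_transpose V"] UV
      by (simp add: norm_unitary_left norm_unitary_right)
    also have "\<dots> \<le> \<bar>C0\<bar> * c powr (1 + \<rho>) * \<epsilon> powr (1 + \<rho>)
        + (2 * k\<^sup>2 * norm (g s) + 2 * k * (L * c)) * \<epsilon> powr (1 + \<rho>)
        + LG * ((2 * k\<^sup>2 * norm s + 2 * k * c) * \<epsilon> powr (1 + \<rho>))"
    proof (intro add_mono mult_left_mono LG)
      have "norm (g x - g s - A (x - s)) \<le> C0 * norm (x - s) powr (1 + \<rho>)" by (rule T(3)[OF xT A(1)])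
      also have "\<dots> \<le> \<bar>C0\<bar> * norm (x - s) powr (1 + \<rho>)" by (intro mult_right_mono) auto
      also have "\<dots> \<le> \<bar>C0\<bar> * (c * \<epsilon>) powr (1 + \<rho>)" using \<rho> xs by (intro mult_left_mono powr_mono2) auto
      also have "\<dots> = \<bar>C0\<bar> * c powr (1 + \<rho>) * \<epsilon> powr (1 + \<rho>)" using c \<epsilon> by (simp add: powr_mult)
      finally show "norm (g x - g s - A (x - s)) \<le> \<bar>C0\<bar> * c powr (1 + \<rho>) * \<epsilon> powr (1 + \<rho>)" .
      \<comment> \<open>Both \<open>\<epsilon> \<le> 1\<close> and \<open>\<rho> \<le> 1\<close>
        enter here, to absorb the quadratic remainders.\<close>
      have sq: "\<epsilon>\<^sup>2 \<le> \<epsilon> powr (1 + \<rho>)"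
      proof (cases "\<epsilon> = 0")
        case False
        then have "\<epsilon>\<^sup>2 = \<epsilon> powr 2" using \<epsilon> by (simp add: powr_numeral)
        also have "\<dots> \<le> \<epsilon> powr (1 + \<rho>)" using \<epsilon> False \<rho> by (intro powr_mono') auto
        finally show ?thesis .
      qed simp
      have "2 * d\<^sup>2 * norm s + 2 * d * norm (s - x) \<le> 2 * d\<^sup>2 * norm s + 2 * d * (c * \<epsilon>)"
        using xs d by (intro add_left_mono mult_left_mono) (auto simp: norm_minus_commute)
      also have "\<dots> = (2 * k\<^sup>2 * norm s + 2 * k * c) * \<epsilon>\<^sup>2" by (simp add: d_def power2_eq_square algebra_simps)
      also have "\<dots> \<le> (2 * k\<^sup>2 * norm s + 2 * k * c) * \<epsilon> powr (1 + \<rho>)" using k c sq by (intro mult_left_mono) auto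
      finally show "norm R1 \<le> (2 * k\<^sup>2 * norm s + 2 * k * c) * \<epsilon> powr (1 + \<rho>)" using R1 by simp
      have "norm (g s - g x) \<le> L * norm (s - x)" using lipschitz_onD[OF lip W(2) xW] by (simp add: dist_norm)
      also have "\<dots> \<le> L * (c * \<epsilon>)" using xs L by (intro mult_left_mono) (auto simp: norm_minus_commute)
      finally have "2 * d\<^sup>2 * norm (g s) + 2 * d * norm (g s - g x) \<le> 2 * d\<^sup>2 * norm (g s) + 2 * d * (L * (c * \<epsilon>))"
        using d by (intro add_left_mono mult_left_mono) auto
      also have "\<dots> = (2 * k\<^sup>2 * norm (g s) + 2 * k * (L * c)) * \<epsilon>\<^sup>2" by (simp add: d_def power2_eq_square algebra_simps)
      also have "\<dots> \<le> (2 * k\<^sup>2 * norm (g s) + 2 * k * (L * c)) * \<epsilon> powr (1 + \<rho>)" using k c L sq by (intro mult_left_mono) auto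
      finally show "norm R2 \<le> (2 * k\<^sup>2 * norm (g s) + 2 * k * (L * c)) * \<epsilon> powr (1 + \<rho>)" using R2 by simp
    qed
    also have "\<dots> = C * \<epsilon> powr (1 + \<rho>)" by (simp add: C_def algebra_simps)
    finally show ?thesis by (simp add: \<epsilon>_def)
  qed
  obtain rT where rT: "rT > 0" "ball s rT \<subseteq> T \<inter> W" using T W by (metis IntI open_Int openE)
  define \<eta> where "\<eta> = min 1 (min (\<delta> / (1 + c)) (rT / c))"
  have "\<eta> > 0" using \<delta> c rT by (simp add: \<eta>_def)
  then have "\<forall>\<^sub>F X in nhds Xbar. X \<in> ball Xbar \<eta>" by (intro eventually_nhds_in_open) auto
  moreover have "\<forall>\<^sub>F X in nhds Xbar. X \<in> W'" using W' by (intro eventually_nhds_in_open) auto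
  ultimately have "\<forall>\<^sub>F X in nhds Xbar. \<forall>G'. (spectral_operator g has_derivative G') (at X) \<longrightarrow>
      norm (spectral_operator g X - spectral_operator g Xbar - G' (X - Xbar)) \<le> C * norm (X - Xbar) powr (1 + \<rho>)"
  proof eventually_elim
    case (elim X)
    then have le: "norm (X - Xbar) < 1" "norm (X - Xbar) < \<delta> / (1 + c)" "norm (X - Xbar) < rT / c"
      by (auto simp: \<eta>_def dist_norm norm_minus_commute)
    have "norm (singular_values X - s) \<le> c * norm (X - Xbar)" using c(2) by (simp add: s_def)
    also have "\<dots> < rT" using le(3) c(1) by (simp add: field_simps)
    finally have "singular_values X \<in> T \<inter> W" using rT(2) by (auto simp: dist_norm norm_minus_commute)
    moreover have "(1 + c) * norm (X - Xbar) \<le> \<delta>" using le(2) c(1) by (simp add: field_simps)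
    ultimately show ?case using main elim(2) le(1) by simp
  qed
  then show ?thesis by blast
qed

end

section \<open>Differentiability of the spectral operator\<close>

lemma bounded_linear_signed_perm: "bounded_linear (\<lambda>x :: real^'m. (\<chi> i. \<epsilon> i * x $ \<pi> i))"
  by (intro linear_conv_bounded_linear[THEN iffD1] linearI) (simp_all add: vec_eq_iff distrib_left)

text \<open>Differentiate the equivariance relation at a fixed point of the swap.\<close>

lemma equivariant_derivative_swap:
  fixes s :: "real^'m"
  assumes W: "open W" "s \<in> W" and eqv: "\<And>x. x \<in> W \<Longrightarrow> signed_equivariant_at g x"
    and A: "(g has_derivative A) (at s)" and fixp: "signed_swap \<epsilon> i j s = s" and \<epsilon>: "\<bar>\<epsilon>\<bar> = 1"
  shows "A (signed_swap \<epsilon> i j h) = signed_swap \<epsilon> i j (A h)"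
proof -
  have bl: "bounded_linear (signed_swap \<epsilon> i j)" unfolding signed_swap_def by (rule bounded_linear_signed_perm)
  have "(g has_derivative A) (at (signed_swap \<epsilon> i j s))" using A fixp by simp
  then have 1: "((\<lambda>y. g (signed_swap \<epsilon> i j y)) has_derivative (\<lambda>h. A (signed_swap \<epsilon> i j h))) (at s)"
    using has_derivative_compose[OF bounded_linear_imp_has_derivative[OF bl]] by blast
  have "((\<lambda>y. signed_swap \<epsilon> i j (g y)) has_derivative (\<lambda>h. signed_swap \<epsilon> i j (A h))) (at s)"
    by (rule bounded_linear.has_derivative[OF bl A])
  then have "((\<lambda>y. g (signed_swap \<epsilon> i j y)) has_derivative (\<lambda>h. signed_swap \<epsilon> i j (A h))) (at s)"
    by (rule has_derivative_transform_within_open[OF _ W]) (simp add: signed_equivariant_at_signed_swap eqv \<epsilon>)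
  from has_derivative_unique[OF 1 this] show ?thesis by (rule fun_cong)
qed

text \<open>
  Off-diagonal entries of the Jacobian depend only on the blocks of equal coordinates of \<open>s\<close> in which
  their row and column lie; \<open>c\<close> extends them to the diagonal and \<open>\<alpha>\<close> is the remaining diagonal part.
\<close>

lemma equivariant_derivative_structure:
  fixes s :: "real^'m"
  assumes W: "open W" "s \<in> W" and eqv: "\<And>x. x \<in> W \<Longrightarrow> signed_equivariant_at g x"
    and A: "(g has_derivative A) (at s)"
  obtains \<alpha> c where "\<forall>h i. A h $ i = \<alpha> i * h $ i + (\<Sum>l\<in>UNIV. c i l * h $ l)"
    "\<forall>i j. s $ i = s $ j \<longrightarrow> \<alpha> i = \<alpha> j"
    "\<forall>i j l. s $ i = s $ j \<longrightarrow> c i l = c j l"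
    "\<forall>i k l. s $ k = s $ l \<longrightarrow> c i k = c i l"
    "\<forall>i l. s $ i = 0 \<or> s $ l = 0 \<longrightarrow> c i l = (0::real)"
proof -
  define a where "a k l = A (axis l 1) $ k" for k l
  have lin: "linear A" using A has_derivative_linear by blast
  have Aa: "A h $ i = (\<Sum>l\<in>UNIV. a i l * h $ l)" for h i
  proof -
    have "A h = matrix A *v h" using matrix_works[of A h] lin by (simp add: linear_linear)
    then show ?thesis by (simp add: a_def matrix_def matrix_vector_mult_def)
  qed
  have swap: "a k l = a (Transposition.transpose i j k) (Transposition.transpose i j l)" if "s $ i = s $ j" for i j k l
  proof -
    let ?\<tau> = "Transposition.transpose i j"
    have nth: "signed_swap 1 i j h $ k = h $ ?\<tau> k" for h k by (simp add: signed_swap_def)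
    have inv: "(?\<tau> k = l) = (k = ?\<tau> l)" for k l by (metis transpose_involutory)
    have ax: "signed_swap 1 i j (axis (?\<tau> l) 1) = axis l (1::real)"
      by (simp add: vec_eq_iff nth axis_def inv)
    have "A (signed_swap 1 i j (axis (?\<tau> l) 1)) = signed_swap 1 i j (A (axis (?\<tau> l) 1))"
      using that by (intro equivariant_derivative_swap[OF W eqv A]) (auto intro: signed_swap_fix)
    from arg_cong[OF this, of "\<lambda>z. z $ k"] show ?thesis by (simp add: a_def nth ax)
  qed
  \<comment> \<open>Commuting with the sign flip at a zero coordinate annihilates the off-diagonal
    entries in its row and column.\<close>
  have flip: "a k i = 0" "a i k = 0" if "s $ i = 0" "k \<noteq> i" for i k
  proof -
    have comm: "A (signed_swap (-1) i i h) = signed_swap (-1) i i (A h)" for h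
      using that by (intro equivariant_derivative_swap[OF W eqv A] signed_swap_fix) auto
    have "signed_swap (-1) i i (axis i 1) = - axis i (1::real)" by (auto simp: vec_eq_iff signed_swap_nth axis_def)
    then have "- A (axis i 1) = signed_swap (-1) i i (A (axis i 1))" using comm[of "axis i 1"] linear_neg[OF lin] by metis
    from arg_cong[OF this, of "\<lambda>z. z $ k"] that(2) show "a k i = 0" by (simp add: a_def signed_swap_nth)
    have "signed_swap (-1) i i (axis k 1) = axis k (1::real)" using that by (auto simp: vec_eq_iff signed_swap_nth axis_def)
    then have "A (axis k 1) = signed_swap (-1) i i (A (axis k 1))" using comm[of "axis k 1"] by metis
    from arg_cong[OF this, of "\<lambda>z. z $ i"] show "a i k = 0" by (simp add: a_def signed_swap_nth)
  qed
  \<comment> \<open>Subtract any off-diagonal entry of the same block from the diagonal one; by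
    \<open>swap\<close> every choice gives the same value. In a singleton block all of
    \<open>a i i\<close> goes into \<open>\<alpha>\<close>, so that \<open>c i i = 0\<close>, as the
    condition at zero coordinates demands.\<close>
  define \<alpha> where "\<alpha> i = a i i - (if \<exists>j. j \<noteq> i \<and> s $ j = s $ i then a i (SOME j. j \<noteq> i \<and> s $ j = s $ i) else 0)" for i
  have \<alpha>: "\<alpha> i = a i i - a i j" if "j \<noteq> i" "s $ j = s $ i" for i j
  proof -
    define j' where "j' = (SOME j. j \<noteq> i \<and> s $ j = s $ i)"
    have "j' \<noteq> i \<and> s $ j' = s $ i" unfolding j'_def by (rule someI[of _ j]) (use that in auto)
    then have "a i j' = a i j" using swap[of j j' i j'] that by (auto simp: Transposition.transpose_def)
    then show ?thesis unfolding \<alpha>_def j'_def using that by auto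
  qed
  define c where "c i l = a i l - (if i = l then \<alpha> i else 0)" for i l
  have diag: "c i i = a i j" if "j \<noteq> i" "s $ j = s $ i" for i j using \<alpha>[OF that] by (simp add: c_def)
  have off: "c i j = a i j" if "j \<noteq> i" for i j using that by (simp add: c_def)
  have symm: "a j i = a i j" if "s $ j = s $ i" for i j
    using swap[OF that, of i j] by (simp add: Transposition.transpose_def)
  show thesis
  proof
    show "\<forall>h i. A h $ i = \<alpha> i * h $ i + (\<Sum>l\<in>UNIV. c i l * h $ l)"
    proof (intro allI)
      fix h i
      have "(\<Sum>l\<in>UNIV. c i l * h $ l) = (\<Sum>l\<in>UNIV. a i l * h $ l - (if l = i then \<alpha> i * h $ i else 0))"
        by (rule sum.cong) (auto simp: c_def left_diff_distrib)
      then show "A h $ i = \<alpha> i * h $ i + (\<Sum>l\<in>UNIV. c i l * h $ l)" by (simp add: Aa sum_subtractf)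
    qed
    show "\<forall>i j. s $ i = s $ j \<longrightarrow> \<alpha> i = \<alpha> j"
    proof (intro allI impI)
      fix i j assume eq: "s $ i = s $ j"
      show "\<alpha> i = \<alpha> j"
      proof (cases "i = j")
        case False
        have "a i i = a j j" using swap[OF eq, of i i] by (simp add: Transposition.transpose_def)
        then show ?thesis using \<alpha>[of j i] \<alpha>[of i j] symm[OF eq] eq False by simp
      qed simp
    qed
    show "\<forall>i j l. s $ i = s $ j \<longrightarrow> c i l = c j l"
    proof (intro allI impI)
      fix i j l assume eq: "s $ i = s $ j"
      consider "i = j" | "i \<noteq> j" "l = i" | "i \<noteq> j" "l = j" | "i \<noteq> j" "l \<noteq> i" "l \<noteq> j" by blast
      then show "c i l = c j l"
      proof cases
        case 4
        then show ?thesis using swap[OF eq, of i l] by (simp add: off Transposition.transpose_def)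
      qed (use diag[of j i] diag[of i j] off[of i j] off[of j i] symm[OF eq] eq in auto)
    qed
    show "\<forall>i k l. s $ k = s $ l \<longrightarrow> c i k = c i l"
    proof (intro allI impI)
      fix i k l assume eq: "s $ k = s $ l"
      consider "k = l" | "k \<noteq> l" "i = l" | "k \<noteq> l" "i = k" | "k \<noteq> l" "i \<noteq> l" "i \<noteq> k" by blast
      then show "c i k = c i l"
      proof cases
        case 4
        then show ?thesis using swap[OF eq, of i k] by (simp add: off Transposition.transpose_def)
      qed (use diag[of k l] diag[of l k] off[of k l] off[of l k] symm[OF eq] eq in auto)
    qed
    show "\<forall>i l. s $ i = 0 \<or> s $ l = 0 \<longrightarrow> c i l = 0"
    proof (intro allI impI)
      fix i l assume z: "s $ i = 0 \<or> s $ l = 0"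
      show "c i l = 0"
      proof (cases "i = l")
        case True
        then have z: "s $ i = 0" using z by auto
        show ?thesis
        proof (cases "\<exists>j. j \<noteq> i \<and> s $ j = s $ i")
          case True
          then obtain j where "j \<noteq> i" "s $ j = s $ i" by blast
          then show ?thesis using diag[of j i] flip(2)[OF z] \<open>i = l\<close> by simp
        next
          case False
          then have "\<alpha> i = a i i" unfolding \<alpha>_def by (simp only: if_False diff_0_right)
          then show ?thesis using \<open>i = l\<close> by (simp add: c_def)
        qed
      next
        case False
        then show ?thesis using z flip(1)[of l i] flip(2)[of i l] by (auto simp: off)
      qed
    qed
  qed
qed

section \<open>The derivative at a diagonal matrix\<close>

context diag_embedding
begin

text \<open>
  The derivative of the spectral operator at \<open>rect_diag s\<close> has this form: \<open>p\<close> and \<open>q\<close> act on the Hermitian and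
  skew-Hermitian parts of the leading square block, \<open>r\<close> on the remaining columns, and \<open>c\<close> couples the
  diagonal entries.
\<close>

definition block_map :: "('m \<Rightarrow> 'm \<Rightarrow> real) \<Rightarrow> ('m \<Rightarrow> 'm \<Rightarrow> real) \<Rightarrow> ('m \<Rightarrow> real) \<Rightarrow> ('m \<Rightarrow> 'm \<Rightarrow> real)
    \<Rightarrow> ('a::real_or_complex,'m,'n) mtx \<Rightarrow> ('a,'m,'n) mtx"
  where "block_map p q r c H = (\<chi> i k. if k \<in> range e then
      p i (inv e k) *\<^sub>R (H $ i $ k + conjugate (H $ inv e k $ e i))
      + q i (inv e k) *\<^sub>R (H $ i $ k - conjugate (H $ inv e k $ e i))
      + (if i = inv e k then of_real (\<Sum>l\<in>UNIV. c i l * (1 \<bullet> H $ l $ e l)) else 0)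
    else r i *\<^sub>R H $ i $ k)"

lemma linear_block_map: "linear (block_map p q r c :: ('a::real_or_complex,'m,'n) mtx \<Rightarrow> _)"
proof (rule linearI)
  fix X Y :: "('a,'m,'n) mtx" and t
  show "block_map p q r c (X + Y) = block_map p q r c X + block_map p q r c Y"
    by (auto simp: block_map_def vec_eq_iff conjugate_add scaleR_add_right scaleR_diff_right inner_add_right distrib_left sum.distrib)
  have "(\<Sum>l\<in>UNIV. c i l * (t * (1 \<bullet> X $ l $ e l))) = t * (\<Sum>l\<in>UNIV. c i l * (1 \<bullet> X $ l $ e l))" for i
    by (simp add: sum_distrib_left mult.left_commute)
  moreover have "of_real (t * x) = t *\<^sub>R (of_real x :: 'a)" for x by (simp add: scaleR_conv_of_real)
  ultimately show "block_map p q r c (t *\<^sub>R X) = t *\<^sub>R block_map p q r c X"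
    by (auto simp: block_map_def vec_eq_iff scaleR_add_right scaleR_diff_right mult.commute[of _ t]
        simp del: of_real_sum of_real_mult)
qed

lemma block_map_nth:
  "block_map p q r c H $ i $ e j = p i j *\<^sub>R (H $ i $ e j + conjugate (H $ j $ e i))
      + q i j *\<^sub>R (H $ i $ e j - conjugate (H $ j $ e i))
      + (if i = j then of_real (\<Sum>l\<in>UNIV. c i l * (1 \<bullet> H $ l $ e l)) else 0)"
  "k \<notin> range e \<Longrightarrow> block_map p q r c H $ i $ k = r i *\<^sub>R H $ i $ k"
  by (simp_all add: block_map_def inj_e)

text \<open>For H = K D_s - D_s L the sum H_ij + conjugate H_ji is -(s_i - s_j)(K_ij + L_ij), and
  the difference is (s_i + s_j)(K_ij - L_ij). The divided differences \<open>p\<close>,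
  \<open>q\<close>, \<open>r\<close> replace the factors from \<open>s\<close> by those from
  \<open>u\<close>; skewness makes the diagonal of \<open>H\<close> purely imaginary, so the
  coupling by \<open>c\<close> vanishes.\<close>

lemma block_map_tangent:
  fixes K :: "('a::real_or_complex,'m,'m) mtx"
    and L :: "('a,'n,'n) mtx"
  assumes skew: "conj_transpose K = - K" "conj_transpose L = - L"
    and p: "\<And>i j. p i j * (s $ i - s $ j) = (u $ i - u $ j) / 2"
    and q: "\<And>i j. q i j * (s $ i + s $ j) = (u $ i + u $ j) / 2"
    and r: "\<And>i. r i * s $ i = u $ i"
  shows "block_map p q r c (K ** rect_diag s - rect_diag s ** L) = K ** rect_diag u - rect_diag u ** L"
proof -
  define H where "H = K ** rect_diag s - rect_diag s ** L"
  have K: "conjugate (K $ j $ i) = - K $ i $ j" for i j using arg_cong[OF skew(1), of "\<lambda>A. A $ i $ j"] by simp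
  have L: "conjugate (L $ k $ l) = - L $ l $ k" for k l using arg_cong[OF skew(2), of "\<lambda>A. A $ l $ k"] by simp
  have re: "1 \<bullet> z = 0" if "conjugate z = - z" for z :: 'a
    using inner_one_conjugate[of z] that by simp
  have H1: "H $ i $ e j = s $ j *\<^sub>R K $ i $ j - s $ i *\<^sub>R L $ e i $ e j" for i j
    by (simp add: H_def rect_diag_mult_nth scaleR_conv_of_real)
  have H2: "conjugate (H $ j $ e i) = s $ j *\<^sub>R L $ e i $ e j - s $ i *\<^sub>R K $ i $ j" for i j
    by (simp add: H1 conjugate_diff K L)
  have H3: "1 \<bullet> H $ l $ e l = 0" for l
    by (simp add: H1 inner_diff_right re[OF K] re[OF L])
  have "block_map p q r c H $ i $ k = (K ** rect_diag u - rect_diag u ** L) $ i $ k" for i k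
  proof (cases "k \<in> range e")
    case True
    then obtain j where k: "k = e j" by auto
    define x where "x = K $ i $ j"
    define y where "y = L $ e i $ e j"
    have "block_map p q r c H $ i $ k
      = p i j *\<^sub>R ((s $ j *\<^sub>R x - s $ i *\<^sub>R y) + (s $ j *\<^sub>R y - s $ i *\<^sub>R x))
      + q i j *\<^sub>R ((s $ j *\<^sub>R x - s $ i *\<^sub>R y) - (s $ j *\<^sub>R y - s $ i *\<^sub>R x))"
      unfolding k block_map_nth H2 H3 unfolding H1 x_def y_def by simp
    also have "\<dots> = (- (p i j * (s $ i - s $ j))) *\<^sub>R (x + y) + (q i j * (s $ i + s $ j)) *\<^sub>R (x - y)"
      by (simp add: algebra_simps)
    also have "\<dots> = (- ((u $ i - u $ j) / 2)) *\<^sub>R (x + y) + ((u $ i + u $ j) / 2) *\<^sub>R (x - y)" unfolding p q ..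
    also have "\<dots> = u $ j *\<^sub>R x - u $ i *\<^sub>R y"
    proof -
      have "(- ((u $ i - u $ j) / 2)) *\<^sub>R (x + y) + ((u $ i + u $ j) / 2) *\<^sub>R (x - y)
        = ((u $ i + u $ j) / 2 - (u $ i - u $ j) / 2) *\<^sub>R x - ((u $ i + u $ j) / 2 + (u $ i - u $ j) / 2) *\<^sub>R y"
        unfolding scaleR_minus_left scaleR_add_right scaleR_diff_right scaleR_add_left[of "(u $ i + u $ j) / 2"] scaleR_diff_left[of "(u $ i + u $ j) / 2"]
        by simp
      also have "(u $ i + u $ j) / 2 - (u $ i - u $ j) / 2 = u $ j" by (simp add: field_simps)
      also have "(u $ i + u $ j) / 2 + (u $ i - u $ j) / 2 = u $ i" by (simp add: field_simps)
      finally show ?thesis .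
    qed
    finally show ?thesis by (simp add: k x_def y_def rect_diag_mult_nth scaleR_conv_of_real mult.commute)
  next
    case False
    have "r i *\<^sub>R H $ i $ k = - ((r i * s $ i) *\<^sub>R L $ e i $ k)"
      using False by (simp add: H_def mult_rect_diag_nth rect_diag_mult_nth scaleR_conv_of_real)
    then show ?thesis
      using False by (simp add: block_map_nth(2) r mult_rect_diag_nth rect_diag_mult_nth scaleR_conv_of_real)
  qed
  then show ?thesis by (simp add: vec_eq_iff H_def)
qed

text \<open>The zero-defect case of \<open>diag_defect_entries\<close>: combining its two relations
  gives (s_i^2 - s_j^2) P_ij = 0, and likewise for \<open>Q\<close>.\<close>

lemma stabilizer_entries:
  fixes P :: "('a::real_or_complex,'m,'m) mtx"
    and Q :: "('a,'n,'n) mtx"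
  assumes P: "P \<in> unitary_matrices" and Q: "Q \<in> unitary_matrices" and PQ: "P ** rect_diag s = rect_diag s ** Q"
    and s: "\<And>i. 0 \<le> s $ i"
  shows "s $ i \<noteq> s $ j \<Longrightarrow> P $ i $ j = 0" "s $ i \<noteq> s $ j \<Longrightarrow> Q $ e i $ e j = 0"
    "s $ i \<noteq> 0 \<Longrightarrow> Q $ e i $ e j = P $ i $ j"
    "l \<notin> range e \<Longrightarrow> s $ j \<noteq> 0 \<Longrightarrow> Q $ l $ e j = 0"
proof -
  have r0: "norm (rect_diag s ** Q - P ** rect_diag s) = 0" using PQ by simp
  note E = diag_defect_entries[OF P Q, where x=s and y=s, unfolded r0 norm_le_zero_iff right_minus_eq]
  have sq: "(s $ i * s $ i - s $ j * s $ j) *\<^sub>R P $ i $ j = 0" "(s $ i * s $ i - s $ j * s $ j) *\<^sub>R Q $ e i $ e j = 0"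
    using arg_cong[OF E(1)[of i j], of "\<lambda>z. s $ j *\<^sub>R z"] arg_cong[OF E(2)[of i j], of "\<lambda>z. s $ i *\<^sub>R z"]
      arg_cong[OF E(1)[of i j], of "\<lambda>z. s $ i *\<^sub>R z"] arg_cong[OF E(2)[of i j], of "\<lambda>z. s $ j *\<^sub>R z"]
    by (simp_all add: scaleR_diff_left mult.commute)
  have ne: "s $ i * s $ i - s $ j * s $ j \<noteq> 0" if "s $ i \<noteq> s $ j"
  proof -
    have "s $ i + s $ j \<noteq> 0" using that s[of i] s[of j] by (metis add_nonneg_eq_0_iff)
    then show ?thesis using that by (simp add: square_diff_square_factored)
  qed
  show off: "s $ i \<noteq> s $ j \<Longrightarrow> P $ i $ j = 0" "s $ i \<noteq> s $ j \<Longrightarrow> Q $ e i $ e j = 0"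
    using sq ne by auto
  show "s $ i \<noteq> 0 \<Longrightarrow> Q $ e i $ e j = P $ i $ j"
    using E(1)[of i j] off by (cases "s $ i = s $ j") auto
  show "l \<notin> range e \<Longrightarrow> s $ j \<noteq> 0 \<Longrightarrow> Q $ l $ e j = 0"
    using E(4)[of l j] by auto
qed

text \<open>P D_h Q^H is block diagonal. On a block with positive value it is Hermitian, so
  \<open>p\<close> alone acts and multiplies by \<open>\<alpha>\<close>; on the zero block
  \<open>p\<close> and \<open>q\<close> together, and \<open>r\<close> on the extra columns, do the
  same. The coupling \<open>c\<close> sees only block traces, which unitary rotations within blocks
  preserve.\<close>

lemma block_map_normal:
  fixes P :: "('a::real_or_complex,'m,'m) mtx"
    and Q :: "('a,'n,'n) mtx"
  assumes P: "P \<in> unitary_matrices" and Q: "Q \<in> unitary_matrices" and PQ: "P ** rect_diag s = rect_diag s ** Q"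
    and s: "\<And>i. 0 \<le> s $ i"
    and p: "\<And>i j. s $ i = s $ j \<Longrightarrow> p i j = \<alpha> i / 2"
    and q: "\<And>i j. s $ i + s $ j = 0 \<Longrightarrow> q i j = \<alpha> i / 2"
    and r: "\<And>i. s $ i = 0 \<Longrightarrow> r i = \<alpha> i"
    and A: "\<forall>h i. A h $ i = \<alpha> i * h $ i + (\<Sum>l\<in>UNIV. c i l * h $ l)"
    and \<alpha>: "\<forall>i j. s $ i = s $ j \<longrightarrow> \<alpha> i = \<alpha> j"
    and c1: "\<forall>i j l. s $ i = s $ j \<longrightarrow> c i l = c j l"
    and c2: "\<forall>i k l. s $ k = s $ l \<longrightarrow> c i k = c i l"
    and c0: "\<forall>i l. s $ i = 0 \<or> s $ l = 0 \<longrightarrow> c i l = (0::real)"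
  shows "block_map p q r c (P ** rect_diag h ** conj_transpose Q) = P ** rect_diag (A h) ** conj_transpose Q"
proof -
  note E = stabilizer_entries[OF P Q PQ s]
  define N where "N z = P ** rect_diag z ** conj_transpose Q" for z
  define \<gamma> where "\<gamma> i = (\<Sum>l\<in>UNIV. c i l * h $ l)" for i
  \<comment> \<open>\<open>Z\<close> is P D_1 Q^H for the all-ones vector; on blocks of positive
    value it is the identity.\<close>
  define Z where "Z i k = (\<Sum>l\<in>UNIV. P $ i $ l * conjugate (Q $ k $ e l))" for i k
  have N: "N z $ i $ k = (\<Sum>l\<in>UNIV. z $ l *\<^sub>R (P $ i $ l * conjugate (Q $ k $ e l)))" for z i k
  proof -
    have "N z = P ** conj_transpose (Q ** conj_transpose (rect_diag z))"
      by (simp add: N_def conj_transpose_mult matrix_mul_assoc)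
    then show ?thesis
      by (simp add: matrix_matrix_mult_def[of P] mult_conj_rect_diag_nth conjugate_mult scaleR_conv_of_real mult_ac)
  qed
  have NA: "N (A h) $ i $ k = \<alpha> i *\<^sub>R N h $ i $ k + \<gamma> i *\<^sub>R Z i k" for i k
  proof -
    have "A h $ l *\<^sub>R (P $ i $ l * conjugate (Q $ k $ e l))
      = \<alpha> i *\<^sub>R (h $ l *\<^sub>R (P $ i $ l * conjugate (Q $ k $ e l))) + \<gamma> i *\<^sub>R (P $ i $ l * conjugate (Q $ k $ e l))" for l
    proof (cases "s $ i = s $ l")
      case True
      then have "\<alpha> l = \<alpha> i" "\<And>k. c l k = c i k" using \<alpha> c1 by metis+
      then show ?thesis by (simp add: A \<gamma>_def scaleR_add_left)
    next
      case False
      then show ?thesis using E(1) by simp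
    qed
    then show ?thesis by (simp add: N Z_def sum.distrib scaleR_sum_right)
  qed
  have Zpos: "Z i (e j) = (if i = j then 1 else 0)" if "s $ j \<noteq> 0" for i j
  proof -
    have "Z i (e j) = (\<Sum>l\<in>UNIV. P $ i $ l * conjugate (P $ j $ l))" using E(3)[OF that] by (simp add: Z_def)
    also have "\<dots> = (P ** conj_transpose P) $ i $ j" by (simp add: matrix_matrix_mult_def)
    also have "\<dots> = (if i = j then 1 else 0)" using P by (simp add: unitary_right mat_def)
    finally show ?thesis .
  qed
  have off: "N z $ i $ e j = 0" "Z i (e j) = 0" if "s $ i \<noteq> s $ j" for z i j
  proof -
    have "P $ i $ l * conjugate (Q $ e j $ e l) = 0" for l
      using that E(1)[of i l] E(2)[of j l] by (cases "s $ i = s $ l") auto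
    note zero = this
    show "N z $ i $ e j = 0" "Z i (e j) = 0" by (simp_all only: N Z_def zero scaleR_zero_right sum.neutral_const)
  qed
  have out: "N z $ i $ k = 0" "Z i k = 0" if "s $ i \<noteq> 0" "k \<notin> range e" for z i k
  proof -
    have "P $ i $ l * conjugate (Q $ k $ e l) = 0" for l
      using that E(1)[of i l] E(4)[of k l] by (cases "s $ i = s $ l") auto
    note zero = this
    show "N z $ i $ k = 0" "Z i k = 0" by (simp_all only: N Z_def zero scaleR_zero_right sum.neutral_const)
  qed
  have \<gamma>0: "\<gamma> i = 0" if "s $ i = 0" for i using that c0 by (simp add: \<gamma>_def)
  have herm: "conjugate (N h $ j $ e i) = N h $ i $ e j" if "s $ i = s $ j" "s $ i \<noteq> 0" for i j
    using that E(3)[of i] E(3)[of j] by (simp add: N conjugate_sum conjugate_mult mult.commute)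
  have col: "(\<Sum>l\<in>UNIV. (norm (P $ l $ k))\<^sup>2) = 1" for k
  proof -
    have "(of_real (\<Sum>l\<in>UNIV. (norm (P $ l $ k))\<^sup>2) :: 'a) = (conj_transpose P ** P) $ k $ k"
      by (simp add: matrix_matrix_mult_def conjugate_mult_self)
    also have "\<dots> = of_real 1" using P by (simp add: unitary_left mat_def)
    finally show ?thesis unfolding of_real_eq_iff .
  qed
  \<comment> \<open>\<open>P\<close> mixes indices only within blocks, on which \<open>c i\<close>
    is constant, and its columns have norm 1; hence \<open>h\<close> can be read off in place of the
    rotated diagonal.\<close>
  have trace: "(\<Sum>l\<in>UNIV. c i l * (1 \<bullet> N h $ l $ e l)) = \<gamma> i" for i
  proof -
    have "c i l * (1 \<bullet> N h $ l $ e l) = (\<Sum>k\<in>UNIV. c i k * h $ k * (norm (P $ l $ k))\<^sup>2)" for l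
    proof (cases "s $ l = 0")
      case True
      have "c i k * h $ k * (norm (P $ l $ k))\<^sup>2 = 0" for k
        using c0 E(1)[of l k] True by (cases "s $ k = 0") auto
      then have "(\<Sum>k\<in>UNIV. c i k * h $ k * (norm (P $ l $ k))\<^sup>2) = 0" by (intro sum.neutral) blast
      then show ?thesis using True c0 by simp
    next
      case False
      have "P $ l $ k * conjugate (Q $ e l $ e k) = of_real ((norm (P $ l $ k))\<^sup>2)" for k
        using E(3)[OF False] conjugate_mult_self[of "P $ l $ k"] by (simp add: mult.commute)
      then have "1 \<bullet> N h $ l $ e l = (\<Sum>k\<in>UNIV. h $ k * (norm (P $ l $ k))\<^sup>2)"
        by (simp add: N inner_sum_right del: of_real_power)
      then have "c i l * (1 \<bullet> N h $ l $ e l) = (\<Sum>k\<in>UNIV. c i l * (h $ k * (norm (P $ l $ k))\<^sup>2))"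
        by (simp add: sum_distrib_left)
      also have "\<dots> = (\<Sum>k\<in>UNIV. c i k * h $ k * (norm (P $ l $ k))\<^sup>2)"
      proof (rule sum.cong[OF refl])
        fix k
        show "c i l * (h $ k * (norm (P $ l $ k))\<^sup>2) = c i k * h $ k * (norm (P $ l $ k))\<^sup>2"
        proof (cases "s $ l = s $ k")
          case True
          then have "c i l = c i k" using c2 by blast
          then show ?thesis by simp
        next
          case False
          then show ?thesis using E(1) by simp
        qed
      qed
      finally show ?thesis .
    qed
    then have "(\<Sum>l\<in>UNIV. c i l * (1 \<bullet> N h $ l $ e l)) = (\<Sum>l\<in>UNIV. \<Sum>k\<in>UNIV. c i k * h $ k * (norm (P $ l $ k))\<^sup>2)" by simp
    also have "\<dots> = (\<Sum>k\<in>UNIV. c i k * h $ k * (\<Sum>l\<in>UNIV. (norm (P $ l $ k))\<^sup>2))"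
      by (subst sum.swap) (simp add: sum_distrib_left)
    finally show ?thesis by (simp add: col \<gamma>_def)
  qed
  have halves: "(\<alpha> i / 2) *\<^sub>R (x + y) + (\<alpha> i / 2) *\<^sub>R (x - y) = \<alpha> i *\<^sub>R x" for i and x y :: 'a
  proof -
    have "(\<alpha> i / 2) *\<^sub>R (x + y) + (\<alpha> i / 2) *\<^sub>R (x - y) = (\<alpha> i / 2 + \<alpha> i / 2) *\<^sub>R x"
      unfolding scaleR_add_right scaleR_diff_right scaleR_add_left by simp
    then show ?thesis by simp
  qed
  have double: "(\<alpha> i / 2) *\<^sub>R (x + x) = \<alpha> i *\<^sub>R x" for i and x :: 'a
    using halves[of i x x] by simp
  have "block_map p q r c (N h) $ i $ k = N (A h) $ i $ k" for i k
  proof (cases "k \<in> range e")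
    case True
    then obtain j where k: "k = e j" by auto
    consider "s $ i \<noteq> s $ j" | "s $ i = s $ j" "s $ i = 0" | "s $ i = s $ j" "s $ i \<noteq> 0" by blast
    then show ?thesis
    proof cases
      case 1
      then have "i \<noteq> j" "s $ j \<noteq> s $ i" by auto
      then show ?thesis using 1 off unfolding k NA block_map_nth by simp
    next
      case 2
      then have pq: "p i j = \<alpha> i / 2" "q i j = \<alpha> i / 2" using p q by auto
      show ?thesis unfolding k NA block_map_nth trace pq halves \<gamma>0[OF 2(2)] by simp
    next
      case 3
      then have pZ: "p i j = \<alpha> i / 2" "Z i (e j) = (if i = j then 1 else 0)" using p Zpos[of j i] by auto
      show ?thesis unfolding k NA block_map_nth trace herm[OF 3] pZ double by (simp add: of_real_def)
    qed
  next
    case False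
    show ?thesis
    proof (cases "s $ i = 0")
      case True
      then show ?thesis using False by (simp add: block_map_nth(2) r NA \<gamma>0)
    next
      case ne: False
      then show ?thesis using False by (simp add: block_map_nth(2) out)
    qed
  qed
  then show ?thesis by (simp add: vec_eq_iff N_def)
qed

text \<open>The singular vectors of a nearby Y need only be close to some stabilizer pair (P, Q). Up
  to a quadratic error the increment is therefore a rotated diagonal P D_(y-s) Q^H plus a tangent
  direction, and \<open>T\<close> takes the required value on both, whichever (P, Q) occurs.\<close>

lemma spectral_operator_differentiable_sorted:
  assumes s: "sorted_nonneg s" and W: "open W" "s \<in> W" and lip: "L-lipschitz_on W g"
    and eqv: "\<And>x. x \<in> W \<Longrightarrow> signed_equivariant_at g x" and A: "(g has_derivative A) (at s)"
  obtains T where "(spectral_operator g has_derivative T) (at (rect_diag s :: ('a::real_or_complex,'m,'n) mtx))"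
proof -
  have L: "L \<ge> 0" using lip lipschitz_on_nonneg by blast
  have s0: "0 \<le> s $ i" for i using s by (simp add: sorted_nonneg_def)
  obtain \<alpha> c where S: "\<forall>h i. A h $ i = \<alpha> i * h $ i + (\<Sum>l\<in>UNIV. c i l * h $ l)"
    "\<forall>i j. s $ i = s $ j \<longrightarrow> \<alpha> i = \<alpha> j" "\<forall>i j l. s $ i = s $ j \<longrightarrow> c i l = c j l"
    "\<forall>i k l. s $ k = s $ l \<longrightarrow> c i k = c i l" "\<forall>i l. s $ i = 0 \<or> s $ l = 0 \<longrightarrow> c i l = 0"
    by (rule equivariant_derivative_structure[OF W eqv A])
  define u where "u = g s"
  note compat = signed_equivariant_at_compatible[OF eqv[OF W(2)], folded u_def]
  \<comment> \<open>Divided differences where defined. At coinciding values the tangent identity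
    leaves them free, and \<open>\<alpha>\<close> is the value that \<open>block_map_normal\<close>
    requires.\<close>
  define p where "p i j = (if s $ i \<noteq> s $ j then (u $ i - u $ j) / (s $ i - s $ j) else \<alpha> i) / 2" for i j
  define q where "q i j = (if s $ i + s $ j \<noteq> 0 then (u $ i + u $ j) / (s $ i + s $ j) else \<alpha> i) / 2" for i j
  define r where "r i = (if s $ i \<noteq> 0 then u $ i / s $ i else \<alpha> i)" for i
  define T :: "('a,'m,'n) mtx \<Rightarrow> _" where "T = block_map p q r c"
  have linT: "linear T" unfolding T_def by (rule linear_block_map)
  have tangent: "T (K ** rect_diag s - rect_diag s ** M) = K ** rect_diag u - rect_diag u ** M"
    if "conj_transpose K = - K" "conj_transpose M = - M" for K M
    unfolding T_def
  proof (rule block_map_tangent[OF that])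
    fix i j
    show "p i j * (s $ i - s $ j) = (u $ i - u $ j) / 2" using compat(1)[of i j] by (auto simp: p_def)
    show "r i * s $ i = u $ i" using compat(2)[of i] by (auto simp: r_def)
    show "q i j * (s $ i + s $ j) = (u $ i + u $ j) / 2"
    proof (cases "s $ i + s $ j = 0")
      case True
      then have "s $ i = 0" "s $ j = 0" using s0[of i] s0[of j] by linarith+
      then show ?thesis using compat(2)[of i] compat(2)[of j] by simp
    next
      case False
      have "v / z / 2 * z = v / 2" if "z \<noteq> 0" for v z :: real using that by simp
      from this[OF False] False show ?thesis unfolding q_def by simp
    qed
  qed
  have normal: "T (P ** rect_diag h ** conj_transpose Q) = P ** rect_diag (A h) ** conj_transpose Q"
    if "P \<in> unitary_matrices" "Q \<in> unitary_matrices" "P ** rect_diag s = rect_diag s ** Q" for P Q h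
    unfolding T_def by (rule block_map_normal[OF that s0 _ _ _ S]) (simp_all add: p_def q_def r_def)
  obtain B where B: "B \<ge> 0" "\<And>H. norm (T H) \<le> B * norm H"
    using linear_bounded_pos[OF linT] by (metis less_imp_le)
  obtain cs where cs: "cs > 0"
    "\<forall>X Y :: ('a,'m,'n) mtx. norm (singular_values X - singular_values Y) \<le> cs * norm (X - Y)"
    by (rule singular_values_lipschitz) blast
  obtain C1 \<delta> where C1: "C1 \<ge> 0" and \<delta>: "\<delta> > 0" and stab: "\<And>(U :: ('a,'m,'m) mtx) (V :: ('a,'n,'n) mtx).
      U \<in> unitary_matrices \<Longrightarrow> V \<in> unitary_matrices \<Longrightarrow> norm (rect_diag s ** V - U ** rect_diag s) \<le> \<delta> \<Longrightarrow>
      \<exists>P\<in>unitary_matrices. \<exists>Q\<in>unitary_matrices. P ** rect_diag s = rect_diag s ** Q \<and>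
        norm (U - P) \<le> C1 * norm (rect_diag s ** V - U ** rect_diag s) \<and>
        norm (V - Q) \<le> C1 * norm (rect_diag s ** V - U ** rect_diag s)"
    by (rule near_stabilizer[where ?'a='a, OF s0]) blast
  define X where "X = (rect_diag s :: ('a,'m,'n) mtx)"
  have X1: "X = mat 1 ** rect_diag s ** conj_transpose (mat 1)" by (simp add: X_def)
  have sX: "singular_values X = s" unfolding X1 by (rule singular_values_eq[OF unitary_mat_1 unitary_mat_1 s])
  have GX: "spectral_operator g X = rect_diag u"
    using spectral_operator_rect_diag[OF unitary_mat_1 unitary_mat_1 eqv[OF W(2)]] by (simp add: X_def u_def)
  define k where "k = C1 * (1 + cs)"
  have k: "k \<ge> 0" using C1 cs by (simp add: k_def)
  define K1 where "K1 = 2 * k\<^sup>2 * (norm s + cs) + 2 * k * cs"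
  define K2 where "K2 = 2 * k\<^sup>2 * (norm u + L * cs) + 2 * k * (L * cs)"
  have K12: "K1 \<ge> 0" "K2 \<ge> 0" using k cs L by (simp_all add: K1_def K2_def)
  \<comment> \<open>\<open>\<eta>\<close> measures the linearisation error of \<open>g\<close> at
    this one point; all other errors are quadratic.\<close>
  have main: "norm (spectral_operator g Y - spectral_operator g X - T (Y - X)) \<le> \<eta> * (cs * norm (Y - X)) + (K2 + B * K1) * (norm (Y - X))\<^sup>2"
    if Y: "singular_values Y \<in> W" "norm (Y - X) \<le> 1" "(1 + cs) * norm (Y - X) \<le> \<delta>"
      and \<eta>: "0 \<le> \<eta>" "norm (g (singular_values Y) - g s - A (singular_values Y - s)) \<le> \<eta> * norm (singular_values Y - s)" for Y \<eta>
  proof -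
    define y where "y = singular_values Y"
    define \<epsilon> where "\<epsilon> = norm (Y - X)"
    have \<epsilon>: "\<epsilon> \<ge> 0" "\<epsilon> \<le> 1" using Y by (auto simp: \<epsilon>_def)
    have yW: "y \<in> W" using Y by (simp add: y_def)
    have ys: "norm (y - s) \<le> cs * \<epsilon>" using cs(2)[rule_format, of Y X] by (simp add: y_def sX \<epsilon>_def)
    have "cs * \<epsilon> \<le> cs * 1" using \<epsilon> cs by (intro mult_left_mono) auto
    then have ycs: "norm (y - s) \<le> cs" using ys by simp
    have "norm (g y - u) \<le> L * norm (y - s)" using lipschitz_onD[OF lip yW W(2)] by (simp add: dist_norm u_def)
    also have "\<dots> \<le> L * (cs * \<epsilon>)" using ys L by (intro mult_left_mono) auto
    finally have gyu: "norm (g y - u) \<le> L * cs * \<epsilon>" by (simp add: mult.assoc)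
    also have "\<dots> \<le> L * cs * 1" using \<epsilon> cs L by (intro mult_left_mono) auto
    finally have gy: "norm (g y) \<le> norm u + L * cs" using norm_triangle_sub[of "g y" u] by simp
    have ny: "norm y \<le> norm s + cs" using norm_triangle_sub[of y s] ycs by simp
    obtain U V where UV: "U \<in> unitary_matrices" "V \<in> unitary_matrices" "Y = U ** rect_diag y ** conj_transpose V"
      unfolding y_def by (rule svd_exists)
    define \<rho> where "\<rho> = norm (rect_diag s ** V - U ** rect_diag s)"
    have "\<rho> = norm (X - U ** rect_diag s ** conj_transpose V)"
      unfolding \<rho>_def X1 using norm_svd_diff[OF unitary_mat_1 unitary_mat_1 UV(1,2), of "rect_diag s" "rect_diag s"] by simp
    also have "X - U ** rect_diag s ** conj_transpose V = (X - Y) + U ** rect_diag (y - s) ** conj_transpose V"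
      by (simp add: UV(3) rect_diag_diff matrix_distribs)
    also have "norm \<dots> \<le> norm (X - Y) + norm (y - s)"
      using UV by (intro norm_triangle_le) (simp add: norm_unitary_left norm_unitary_right)
    also have "\<dots> \<le> (1 + cs) * \<epsilon>" using ys by (simp add: \<epsilon>_def norm_minus_commute distrib_right)
    finally have \<rho>: "\<rho> \<le> (1 + cs) * \<epsilon>" .
    then have "\<rho> \<le> \<delta>" using Y(3) by (simp add: \<epsilon>_def)
    then obtain P Q where PQ: "P \<in> unitary_matrices" "Q \<in> unitary_matrices" "P ** rect_diag s = rect_diag s ** Q"
      "norm (U - P) \<le> C1 * \<rho>" "norm (V - Q) \<le> C1 * \<rho>"
      using stab[OF UV(1,2)] unfolding \<rho>_def by blast
    define d where "d = k * \<epsilon>"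
    have d: "d \<ge> 0" using k \<epsilon> by (simp add: d_def)
    have rd: "C1 * \<rho> \<le> d" using mult_left_mono[OF \<rho> C1] by (simp add: d_def k_def mult.assoc)
    \<comment> \<open>Peeling off the stabilizer: Y = U1 (P D_y Q^H) V1^H with both outer factors
      near the identity.\<close>
    define U1 where "U1 = U ** conj_transpose P"
    define V1 where "V1 = V ** conj_transpose Q"
    have U1: "U1 \<in> unitary_matrices" "norm (U1 - mat 1) \<le> d"
    proof -
      show "U1 \<in> unitary_matrices" using UV PQ by (simp add: U1_def unitary_mult)
      have "U1 - mat 1 = (U - P) ** conj_transpose P" using PQ by (simp add: U1_def matrix_distribs unitary_right)
      then show "norm (U1 - mat 1) \<le> d" using PQ rd by (simp add: norm_unitary_right)
    qed
    have V1: "V1 \<in> unitary_matrices" "norm (V1 - mat 1) \<le> d"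
    proof -
      show "V1 \<in> unitary_matrices" using UV PQ by (simp add: V1_def unitary_mult)
      have "V1 - mat 1 = (V - Q) ** conj_transpose Q" using PQ by (simp add: V1_def matrix_distribs unitary_right)
      then show "norm (V1 - mat 1) \<le> d" using PQ rd by (simp add: norm_unitary_right)
    qed
    have move: "U ** rect_diag z ** conj_transpose V = U1 ** (P ** rect_diag z ** conj_transpose Q) ** conj_transpose V1" for z
      using PQ by (simp add: U1_def V1_def conj_transpose_mult unitary_cancel flip: matrix_mul_assoc)
    have GY: "spectral_operator g Y = U ** rect_diag (g y) ** conj_transpose V"
      unfolding UV(3) using UV yW by (intro spectral_operator_rect_diag eqv)
    have Ps: "P ** rect_diag s ** conj_transpose Q = X"
      unfolding PQ(3) using PQ(2) by (simp add: X_def unitary_right flip: matrix_mul_assoc)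
    \<comment> \<open>\<open>X\<close> has the decompositions (1, 1) and (P, Q); single-valuedness
      of the spectral operator shows that the stabilizer of \<open>s\<close> also stabilises
      \<open>g s\<close>.\<close>
    have Pu: "P ** rect_diag u ** conj_transpose Q = rect_diag u"
      using spectral_operator_rect_diag[OF PQ(1,2) eqv[OF W(2)]] unfolding Ps GX u_def by simp
    have nP: "norm (P ** rect_diag z ** conj_transpose Q) = norm z" for z
      using PQ by (simp add: norm_unitary_left norm_unitary_right)
    have diff: "P ** rect_diag z ** conj_transpose Q - P ** rect_diag z' ** conj_transpose Q = P ** rect_diag (z - z') ** conj_transpose Q" for z z'
      by (simp add: rect_diag_diff matrix_distribs)
    define K where "K = (1/2) *\<^sub>R (U1 - conj_transpose U1)"
    define M where "M = (1/2) *\<^sub>R (V1 - conj_transpose V1)"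
    have skew: "conj_transpose K = - K" "conj_transpose M = - M"
      using skew_part_bound(1)[OF U1] skew_part_bound(1)[OF V1] by (simp_all add: K_def M_def)
    define R1 where "R1 = Y - P ** rect_diag y ** conj_transpose Q - (K ** rect_diag s - rect_diag s ** M)"
    define R2 where "R2 = spectral_operator g Y - P ** rect_diag (g y) ** conj_transpose Q - (K ** rect_diag u - rect_diag u ** M)"
    have "norm R1 \<le> 2 * d\<^sup>2 * norm (P ** rect_diag y ** conj_transpose Q) + 2 * d * norm (P ** rect_diag y ** conj_transpose Q - X)"
      unfolding R1_def UV(3) move K_def M_def X_def by (rule unitary_expansion[OF U1 V1])
    also have "\<dots> = 2 * d\<^sup>2 * norm y + 2 * d * norm (y - s)" unfolding Ps[symmetric] diff nP ..
    also have "\<dots> \<le> 2 * d\<^sup>2 * (norm s + cs) + 2 * d * (cs * \<epsilon>)" using d ny ys by (intro add_mono mult_left_mono) auto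
    also have "\<dots> = K1 * \<epsilon>\<^sup>2" by (simp add: K1_def d_def power2_eq_square algebra_simps)
    finally have R1: "norm R1 \<le> K1 * \<epsilon>\<^sup>2" .
    have "norm R2 \<le> 2 * d\<^sup>2 * norm (P ** rect_diag (g y) ** conj_transpose Q) + 2 * d * norm (P ** rect_diag (g y) ** conj_transpose Q - rect_diag u)"
      unfolding R2_def GY move K_def M_def by (rule unitary_expansion[OF U1 V1])
    also have "\<dots> = 2 * d\<^sup>2 * norm (g y) + 2 * d * norm (g y - u)" using diff[of "g y" u] by (simp only: Pu nP)
    also have "\<dots> \<le> 2 * d\<^sup>2 * (norm u + L * cs) + 2 * d * (L * cs * \<epsilon>)" using d gy gyu by (intro add_mono mult_left_mono) auto
    also have "\<dots> = K2 * \<epsilon>\<^sup>2" by (simp add: K2_def d_def power2_eq_square algebra_simps)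
    finally have R2: "norm R2 \<le> K2 * \<epsilon>\<^sup>2" .
    have "Y - X = P ** rect_diag (y - s) ** conj_transpose Q + (K ** rect_diag s - rect_diag s ** M) + R1"
      unfolding diff[symmetric] Ps by (simp add: R1_def)
    then have "T (Y - X) = P ** rect_diag (A (y - s)) ** conj_transpose Q + (K ** rect_diag u - rect_diag u ** M) + T R1"
      by (simp only: linear_add[OF linT] normal[OF PQ(1-3)] tangent[OF skew])
    moreover have "spectral_operator g Y - spectral_operator g X = P ** rect_diag (g y - u) ** conj_transpose Q + (K ** rect_diag u - rect_diag u ** M) + R2"
      unfolding diff[symmetric] Pu GX by (simp add: R2_def)
    ultimately have "spectral_operator g Y - spectral_operator g X - T (Y - X) = P ** rect_diag (g y - u - A (y - s)) ** conj_transpose Q + R2 - T R1"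
      by (simp add: rect_diag_diff[of "g y - u"] matrix_distribs)
    also have "norm \<dots> \<le> norm (g y - u - A (y - s)) + norm R2 + norm (T R1)"
      by (rule order_trans[OF norm_triangle_ineq4]) (simp add: norm_triangle_le nP)
    also have "\<dots> \<le> \<eta> * (cs * \<epsilon>) + K2 * \<epsilon>\<^sup>2 + B * (K1 * \<epsilon>\<^sup>2)"
    proof (intro add_mono R2)
      show "norm (g y - u - A (y - s)) \<le> \<eta> * (cs * \<epsilon>)"
        using \<eta>(2) mult_left_mono[OF ys \<eta>(1)] by (simp add: y_def u_def)
      show "norm (T R1) \<le> B * (K1 * \<epsilon>\<^sup>2)" using B(2)[of R1] mult_left_mono[OF R1 B(1)] by simp
    qed
    finally show ?thesis by (simp add: \<epsilon>_def algebra_simps)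
  qed
  have "(spectral_operator g has_derivative T) (at X)"
    unfolding has_derivative_at_alt
  proof (intro conjI allI impI)
    show "bounded_linear T" using linT linear_conv_bounded_linear by blast
    fix e :: real assume e: "0 < e"
    \<comment> \<open>Half of \<open>e\<close> is spent on the linearisation of \<open>g\<close>,
      half on the quadratic remainder.\<close>
    define \<eta> where "\<eta> = e / (2 * cs)"
    have \<eta>: "\<eta> > 0" using e cs by (simp add: \<eta>_def)
    obtain d0 where d0: "d0 > 0" "\<And>y. norm (y - s) < d0 \<Longrightarrow> norm (g y - g s - A (y - s)) \<le> \<eta> * norm (y - s)"
      using A \<eta> unfolding has_derivative_at_alt by blast
    obtain r0 where r0: "r0 > 0" "ball s r0 \<subseteq> W" using W openE by blast
    define K3 where "K3 = K2 + B * K1"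
    have K3: "K3 \<ge> 0" using K12 B by (simp add: K3_def)
    define d where "d = Min {1, \<delta> / (1 + cs), d0 / cs, r0 / cs, e / (2 * (K3 + 1))}"
    have d: "d > 0" using \<delta> cs d0 r0 e K3 by (simp add: d_def)
    show "\<exists>d>0. \<forall>Y. norm (Y - X) < d \<longrightarrow> norm (spectral_operator g Y - spectral_operator g X - T (Y - X)) \<le> e * norm (Y - X)"
    proof (intro exI[of _ d] conjI allI impI d)
      fix Y assume "norm (Y - X) < d"
      then have le: "norm (Y - X) < 1" "norm (Y - X) < \<delta> / (1 + cs)" "norm (Y - X) < d0 / cs" "norm (Y - X) < r0 / cs"
        "norm (Y - X) < e / (2 * (K3 + 1))" by (simp_all add: d_def)
      have y: "norm (singular_values Y - s) \<le> cs * norm (Y - X)" using cs(2)[rule_format, of Y X] by (simp add: sX)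
      have "cs * norm (Y - X) < d0" "cs * norm (Y - X) < r0" using le(3,4) cs(1) by (simp_all add: field_simps)
      then have y': "norm (singular_values Y - s) < d0" "singular_values Y \<in> W"
        using y r0(2) by (auto simp: subset_iff dist_norm norm_minus_commute)
      have "(1 + cs) * norm (Y - X) \<le> \<delta>" using le(2) cs(1) by (simp add: field_simps)
      then have "norm (spectral_operator g Y - spectral_operator g X - T (Y - X)) \<le> \<eta> * (cs * norm (Y - X)) + K3 * (norm (Y - X))\<^sup>2"
        unfolding K3_def using le(1) \<eta> y' d0(2) by (intro main) auto
      also have "\<eta> * (cs * norm (Y - X)) = e / 2 * norm (Y - X)" using cs(1) by (simp add: \<eta>_def)
      also have "K3 * (norm (Y - X))\<^sup>2 \<le> e / 2 * norm (Y - X)"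
      proof -
        have "K3 * norm (Y - X) \<le> (K3 + 1) * (e / (2 * (K3 + 1)))" using le(5) K3 by (intro mult_mono) auto
        also have "\<dots> = e / 2" using K3 by (simp add: field_simps)
        finally have "K3 * norm (Y - X) * norm (Y - X) \<le> e / 2 * norm (Y - X)" by (intro mult_right_mono) auto
        then show ?thesis by (simp add: power2_eq_square mult.assoc)
      qed
      finally show "norm (spectral_operator g Y - spectral_operator g X - T (Y - X)) \<le> e * norm (Y - X)" by simp
    qed
  qed
  then show thesis using that unfolding X_def by blast
qed

end

section \<open>Differentiability at unsorted vectors, and the equivalence\<close>

context diag_embedding
begin

lemma continuous_on_singular_values:
  "continuous_on UNIV (singular_values :: ('a::real_or_complex,'m,'n) mtx \<Rightarrow> _)"
proof -
  obtain c where c: "c > 0"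
    "\<forall>X Y :: ('a,'m,'n) mtx. norm (singular_values X - singular_values Y) \<le> c * norm (X - Y)"
    by (rule singular_values_lipschitz) blast
  have "c-lipschitz_on UNIV (singular_values :: ('a,'m,'n) mtx \<Rightarrow> _)"
    using c by (intro lipschitz_onI) (auto simp: dist_norm)
  then show ?thesis by (rule lipschitz_on_continuous_on)
qed

text \<open>Vectors near the singular values of \<open>Xbar\<close> need be neither sorted nor
  nonnegative. A sorting signed permutation transports neighbourhood, Lipschitz bound, equivariance
  and derivative of \<open>g\<close> to a sorted vector, and its unitary factors transport the
  result back.\<close>

lemma spectral_operator_differentiable:
  fixes U :: "('a::real_or_complex,'m,'m) mtx"
    and V :: "('a,'n,'n) mtx"
  assumes U: "U \<in> unitary_matrices" and V: "V \<in> unitary_matrices"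
    and W: "open W" "x \<in> W" and lip: "L-lipschitz_on W g"
    and eqv: "\<And>y. y \<in> W \<Longrightarrow> signed_equivariant_at g y" and A: "(g has_derivative A) (at x)"
  obtains G' where "(spectral_operator g has_derivative G') (at (U ** rect_diag x ** conj_transpose V))"
proof -
  obtain \<epsilon> :: "'m \<Rightarrow> real" and \<pi> :: "'m \<Rightarrow> 'm" where p: "bij \<pi>" "\<And>i. \<bar>\<epsilon> i\<bar> = 1"
    and s: "sorted_nonneg (\<chi> i. \<epsilon> i * x $ \<pi> i)"
    by (rule signed_sort_exists[of x]) blast
  define q where "q z = (\<chi> i. \<epsilon> i * z $ \<pi> i)" for z :: "(real,'m) vec"
  define q' where "q' z = (\<chi> i. \<epsilon> (inv \<pi> i) * z $ inv \<pi> i)" for z :: "(real,'m) vec"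
  have p': "bij (inv \<pi>)" using p(1) by (rule bij_imp_bij_inv)
  have bl: "bounded_linear q" "bounded_linear q'" unfolding q_def q'_def by (rule bounded_linear_signed_perm)+
  have sq: "\<epsilon> i * \<epsilon> i = 1" for i using p(2)[of i] by (metis abs_mult_self_eq mult_1)
  have qq': "q (q' z) = z" and q'q: "q' (q z) = z" for z
    using bij_inv_eq_iff[OF p(1)] p(1)
    by (simp_all add: q_def q'_def vec_eq_iff sq inv_f_f bij_is_inj surj_f_inv_f bij_is_surj flip: mult.assoc)
  have nq: "norm (q z) = norm z" for z unfolding q_def by (rule norm_signed_perm[OF p])
  have nq': "norm (q' z) = norm z" for z using nq[of "q' z"] by (simp add: qq')
  define W2 where "W2 = q' -` W"
  have "continuous_on UNIV q'" using bl(2) linear_continuous_on by blast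
  then have W2: "open W2" unfolding W2_def using W(1) by (simp add: continuous_on_open_vimage)
  have sW2: "q x \<in> W2" using W(2) by (simp add: W2_def q'q)
  have eqv2: "signed_equivariant_at g z" and gq: "g z = q (g (q' z))" if "z \<in> W2" for z
  proof -
    have W': "signed_equivariant_at g (q' z)" using that eqv by (simp add: W2_def)
    show "signed_equivariant_at g z" using signed_equivariant_at_signed_perm[where \<epsilon>=\<epsilon>, OF W' p] qq'[of z] by (simp add: q_def)
    show "g z = q (g (q' z))" using signed_equivariant_atD[where \<epsilon>=\<epsilon>, OF W' p] qq'[of z] by (simp add: q_def)
  qed
  have lip2: "L-lipschitz_on W2 g"
  proof (rule lipschitz_onI)
    show "0 \<le> L" using lip lipschitz_on_nonneg by blast
    fix y z assume yz: "y \<in> W2" "z \<in> W2"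
    have "norm (g y - g z) = norm (q (g (q' y) - g (q' z)))"
      by (simp add: gq[OF yz(1)] gq[OF yz(2)] linear_diff[OF bounded_linear.linear[OF bl(1)]])
    also have "\<dots> \<le> L * norm (q' y - q' z)"
      unfolding nq using lipschitz_onD[OF lip, of "q' y" "q' z"] yz by (simp add: W2_def dist_norm)
    also have "q' y - q' z = q' (y - z)" by (simp add: linear_diff[OF bounded_linear.linear[OF bl(2)]])
    finally show "dist (g y) (g z) \<le> L * dist y z" by (simp add: dist_norm nq')
  qed
  have "(g has_derivative A) (at (q' (q x)))" using A by (simp add: q'q)
  then have "((\<lambda>z. g (q' z)) has_derivative (\<lambda>h. A (q' h))) (at (q x))"
    using has_derivative_compose[OF bounded_linear_imp_has_derivative[OF bl(2)]] by blast
  then have "((\<lambda>z. q (g (q' z))) has_derivative (\<lambda>h. q (A (q' h)))) (at (q x))"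
    by (rule bounded_linear.has_derivative[OF bl(1)])
  then have A2: "(g has_derivative (\<lambda>h. q (A (q' h)))) (at (q x))"
    by (rule has_derivative_transform_within_open[OF _ W2 sW2]) (simp add: gq[symmetric])
  have s2: "sorted_nonneg (q x)" using s by (simp add: q_def)
  obtain T where T: "(spectral_operator g has_derivative T) (at (rect_diag (q x) :: ('a,'m,'n) mtx))"
    by (rule spectral_operator_differentiable_sorted[where ?'a='a, OF s2 W2 sW2 lip2 eqv2 A2])
  obtain U0 :: "('a,'m,'m) mtx" 
      and V0 :: "('a,'n,'n) mtx"
      where UV0: "U0 \<in> unitary_matrices" "V0 \<in> unitary_matrices"
      and eq: "\<And>x. rect_diag (\<chi> i. \<epsilon> i * x $ \<pi> i) = U0 ** rect_diag x ** V0"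
    by (rule rect_diag_signed_perm[of \<pi> \<epsilon>, OF p(1)]) (use p(2) in blast)+
  define U2 where "U2 = U ** conj_transpose U0"
  define V2 where "V2 = V ** V0"
  have UV2: "U2 \<in> unitary_matrices" "V2 \<in> unitary_matrices" using U V UV0 by (simp_all add: U2_def V2_def unitary_mult)
  define X where "X = U ** rect_diag x ** conj_transpose V"
  define \<Psi> where "\<Psi> Y = conj_transpose U2 ** Y ** V2" for Y
  define \<Phi> where "\<Phi> Z = U2 ** Z ** conj_transpose V2" for Z
  have bl2: "bounded_linear \<Psi>" "bounded_linear \<Phi>" unfolding \<Psi>_def \<Phi>_def by (rule bounded_linear_sandwich)+
  have \<Psi>X: "\<Psi> X = rect_diag (q x)"
    using U V UV0 by (simp add: \<Psi>_def X_def U2_def V2_def q_def eq conj_transpose_mult unitary_cancel flip: matrix_mul_assoc)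
  \<comment> \<open>Commutation of the spectral operator with the unitary factors is established
    where the singular values stay in the equivariance region, which is open by their
    continuity.\<close>
  define O' where "O' = {Y. singular_values (\<Psi> Y) \<in> W2}"
  have "continuous_on UNIV (\<lambda>Y. singular_values (\<Psi> Y))"
    by (intro continuous_on_compose2[OF continuous_on_singular_values] linear_continuous_on bl2) auto
  then have O': "open O'" unfolding O'_def using W2 by (simp add: continuous_on_open_vimage flip: vimage_def)
  have "singular_values (\<Psi> X) = q x"
    unfolding \<Psi>X using singular_values_eq[OF unitary_mat_1 unitary_mat_1 s2] by simp
  then have XO: "X \<in> O'" using sW2 by (simp add: O'_def)
  have G: "spectral_operator g Y = \<Phi> (spectral_operator g (\<Psi> Y))" if "Y \<in> O'" for Y
  proof -
    define z where "z = singular_values (\<Psi> Y)"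
    have z: "signed_equivariant_at g z" using that eqv2 by (simp add: O'_def z_def)
    obtain P Q where PQ: "P \<in> unitary_matrices" "Q \<in> unitary_matrices" "\<Psi> Y = P ** rect_diag z ** conj_transpose Q"
      unfolding z_def by (rule svd_exists)
    have "Y = \<Phi> (\<Psi> Y)" using UV2 by (simp add: \<Phi>_def \<Psi>_def unitary_cancel unitary_right flip: matrix_mul_assoc)
    then have Y: "Y = (U2 ** P) ** rect_diag z ** conj_transpose (V2 ** Q)"
      unfolding PQ(3) by (simp add: \<Phi>_def conj_transpose_mult matrix_mul_assoc)
    have "spectral_operator g Y = (U2 ** P) ** rect_diag (g z) ** conj_transpose (V2 ** Q)"
      unfolding Y by (rule spectral_operator_rect_diag[OF unitary_mult[OF UV2(1) PQ(1)] unitary_mult[OF UV2(2) PQ(2)] z])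
    moreover have "spectral_operator g (\<Psi> Y) = P ** rect_diag (g z) ** conj_transpose Q"
      unfolding PQ(3) by (rule spectral_operator_rect_diag[OF PQ(1,2) z])
    ultimately show ?thesis by (simp add: \<Phi>_def conj_transpose_mult matrix_mul_assoc)
  qed
  have "(spectral_operator g has_derivative T) (at (\<Psi> X))" using T by (simp add: \<Psi>X)
  then have "((\<lambda>Y. spectral_operator g (\<Psi> Y)) has_derivative (\<lambda>H. T (\<Psi> H))) (at X)"
    using has_derivative_compose[OF bounded_linear_imp_has_derivative[OF bl2(1)]] by blast
  then have "((\<lambda>Y. \<Phi> (spectral_operator g (\<Psi> Y))) has_derivative (\<lambda>H. \<Phi> (T (\<Psi> H)))) (at X)"
    by (rule bounded_linear.has_derivative[OF bl2(2)])
  then have "(spectral_operator g has_derivative (\<lambda>H. \<Phi> (T (\<Psi> H)))) (at X)"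
    by (rule has_derivative_transform_within_open[OF _ O' XO]) (simp add: G[symmetric])
  then show thesis using that unfolding X_def by blast
qed

text \<open>The slice of matrices U D_y V^H through \<open>Xbar\<close> is isometric to the vector
  space, so the constant carries over. Differentiability of the operator at the slice point is what
  brings its estimate to bear on a derivative of \<open>g\<close>. Here \<open>\<rho>\<close> stands
  for the full exponent.\<close>

lemma coordinate_semismooth_estimate:
  fixes Xbar :: "('a::real_or_complex,'m,'n) mtx"
  defines "s \<equiv> singular_values Xbar"
  assumes W: "open W" "s \<in> W" and lip: "L-lipschitz_on W g"
    and eqv: "\<And>x. x \<in> W \<Longrightarrow> signed_equivariant_at g x"
    and est: "\<forall>\<^sub>F X in nhds Xbar. \<forall>G'. (spectral_operator g has_derivative G') (at X) \<longrightarrow>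
      norm (spectral_operator g X - spectral_operator g Xbar - G' (X - Xbar)) \<le> C * norm (X - Xbar) powr \<rho>"
  shows "\<forall>\<^sub>F y in nhds s. \<forall>A. (g has_derivative A) (at y) \<longrightarrow>
      norm (g y - g s - A (y - s)) \<le> C * norm (y - s) powr \<rho>"
proof -
  obtain U V where UV: "U \<in> unitary_matrices" "V \<in> unitary_matrices" "Xbar = U ** rect_diag s ** conj_transpose V"
    unfolding s_def by (rule svd_exists)
  define \<Phi> where "\<Phi> h = U ** rect_diag h ** conj_transpose V" for h
  have bl: "bounded_linear \<Phi>"
    unfolding \<Phi>_def by (rule bounded_linear_compose[OF bounded_linear_sandwich bounded_linear_rect_diag])
  have lin: "linear \<Phi>" using bl by (rule bounded_linear.linear)
  have n\<Phi>: "norm (\<Phi> h) = norm h" for h using UV by (simp add: \<Phi>_def norm_unitary_left norm_unitary_right)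
  have Xbar: "Xbar = \<Phi> s" by (simp add: \<Phi>_def UV(3))
  have "isCont \<Phi> s" by (rule linear_continuous_at[OF bl])
  then have "filterlim \<Phi> (nhds Xbar) (nhds s)"
    unfolding Xbar isCont_def tendsto_at_iff_tendsto_nhds .
  then have "\<forall>\<^sub>F y in nhds s. \<forall>G'. (spectral_operator g has_derivative G') (at (\<Phi> y)) \<longrightarrow>
      norm (spectral_operator g (\<Phi> y) - spectral_operator g Xbar - G' (\<Phi> y - Xbar)) \<le> C * norm (\<Phi> y - Xbar) powr \<rho>"
    using est eventually_compose_filterlim by blast
  moreover have "\<forall>\<^sub>F y in nhds s. y \<in> W" using W by (intro eventually_nhds_in_open) auto
  ultimately show ?thesis
  proof eventually_elim
    case (elim y)
    show ?case
    proof (intro allI impI)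
      fix A assume A: "(g has_derivative A) (at y)"
      obtain G' where G': "(spectral_operator g has_derivative G') (at (\<Phi> y))"
        unfolding \<Phi>_def by (rule spectral_operator_differentiable[OF UV(1,2) W(1) elim(2) lip eqv A])
      obtain A' where A': "(g has_derivative A') (at y)" "\<forall>h. G' (\<Phi> h) = \<Phi> (A' h)"
        unfolding \<Phi>_def by (rule spectral_derivative_diag[OF UV(1,2) W(1) elim(2) eqv G'[unfolded \<Phi>_def]]) blast+
      have "A' = A" using has_derivative_unique[OF A'(1) A] .
      have G: "spectral_operator g (\<Phi> z) = \<Phi> (g z)" if "z \<in> W" for z
        unfolding \<Phi>_def by (rule spectral_operator_rect_diag[OF UV(1,2) eqv[OF that]])
      have "spectral_operator g (\<Phi> y) - spectral_operator g Xbar - G' (\<Phi> y - Xbar) = \<Phi> (g y - g s - A (y - s))"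
        unfolding Xbar G[OF elim(2)] G[OF W(2)] linear_diff[OF lin, symmetric] A'(2)[rule_format] \<open>A' = A\<close> ..
      moreover have "\<Phi> y - Xbar = \<Phi> (y - s)" unfolding Xbar linear_diff[OF lin] ..
      moreover have "norm (spectral_operator g (\<Phi> y) - spectral_operator g Xbar - G' (\<Phi> y - Xbar)) \<le> C * norm (\<Phi> y - Xbar) powr \<rho>"
        using elim(1) G' by blast
      ultimately show "norm (g y - g s - A (y - s)) \<le> C * norm (y - s) powr \<rho>" by (simp only: n\<Phi>)
    qed
  qed
qed

text \<open>Intersecting a Lipschitz neighbourhood with \<open>D\<close> provides both the Lipschitz
  bound and equivariance. \<open>G_semismooth_at_iff\<close> makes both sides local, so
  \<open>g\<close> may be given the domain \<open>UNIV\<close>.\<close>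

theorem spectral_operator_G_semismooth_iff:
  fixes Xbar :: "('a::real_or_complex,'m,'n) mtx"
  assumes D: "open D" "absolutely_symmetric_on D g" and \<rho>: "0 < \<rho>" "\<rho> \<le> 1"
    and N: "open N" "singular_values ` N \<subseteq> D" "Xbar \<in> N"
    and lip: "lipschitz_near g (singular_values Xbar)"
  shows "G_semismooth_at N \<rho> (spectral_operator g) Xbar \<longleftrightarrow> G_semismooth_at UNIV \<rho> g (singular_values Xbar)"
proof -
  obtain L W0 where W0: "open W0" "singular_values Xbar \<in> W0" "L-lipschitz_on W0 g"
    using lip unfolding lipschitz_near_def by blast
  define W where "W = W0 \<inter> D"
  have W: "open W" "singular_values Xbar \<in> W" using W0 D N by (auto simp: W_def)
  have lipW: "L-lipschitz_on W g" using W0(3) by (rule lipschitz_on_subset) (simp add: W_def)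
  have eqv: "signed_equivariant_at g x" if "x \<in> W" for x
    using that absolutely_symmetric_on_imp_equivariant[OF D(2)] by (simp add: W_def)
  have lipG: "lipschitz_near (spectral_operator g) Xbar"
    by (rule spectral_operator_lipschitz_near[OF W lipW eqv])
  show ?thesis
    unfolding G_semismooth_at_iff[OF N(1,3) lipG \<rho>(1)] G_semismooth_at_iff[OF open_UNIV UNIV_I lip \<rho>(1)]
    using spectral_semismooth_estimate[OF W lipW eqv \<rho>] coordinate_semismooth_estimate[OF W lipW eqv] by blast
qed

end

theorem theorem4p3:
  fixes g :: "real ^ 'm::{finite,linorder} \<Rightarrow> real ^ 'm::{finite,linorder}"
    and D :: "(real ^ 'm::{finite,linorder}) set"
    and \<rho> :: real
  assumes "CARD('m::{finite,linorder}) \<le> CARD('n::{finite,linorder})"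
    and "open D"
    and "absolutely_symmetric_on D g"
    and "0 < \<rho>" and "\<rho> \<le> 1"
  shows
    "(\<forall>(N :: (real ^ 'n::{finite,linorder} ^ 'm::{finite,linorder}) set) Xbar.
        open N \<and> N \<noteq> {} \<and> singular_values ` N \<subseteq> D \<and> Xbar \<in> N \<and>
        lipschitz_near g (singular_values Xbar) \<longrightarrow>
        (G_semismooth_at N \<rho> (spectral_operator g) Xbar \<longleftrightarrow>
         G_semismooth_at UNIV \<rho> g (singular_values Xbar)))
     \<and>
     (\<forall>(N :: (complex ^ 'n::{finite,linorder} ^ 'm::{finite,linorder}) set) Xbar.
        open N \<and> N \<noteq> {} \<and> singular_values ` N \<subseteq> D \<and> Xbar \<in> N \<and>
        lipschitz_near g (singular_values Xbar) \<longrightarrow>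
        (G_semismooth_at N \<rho> (spectral_operator g) Xbar \<longleftrightarrow>
         G_semismooth_at UNIV \<rho> g (singular_values Xbar)))"
proof -
  \<comment> \<open>The dimension inequality supplies the diagonal embedding; the real and complex
    claims are then two instances of one theorem.\<close>
  obtain e :: "'m \<Rightarrow> 'n" where "diag_embedding e" using diag_embedding_exists[OF assms(1)] by blast
  then interpret diag_embedding e .
  show ?thesis
    by (intro conjI allI impI; elim conjE; rule spectral_operator_G_semismooth_iff[OF assms(2-5)]; assumption)
qed

end
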